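(* Under the hypotheses of Lemma 6.5 — namely: (A) $\partial\Omega$ has a local parabolic support of order $\tau$ at every point, $0\le\tau<\infty$; (B) $R(\boldsymbol{p})\ge C_0|\boldsymbol{p}|^{-2k}$ for $|\boldsymbol{p}|\ge r_0$ ($k\ge0$, $C_0,r_0>0$); (C) $\mu(\Omega)<\int_{\mathbb{R}^d}R\,d\boldsymbol{p}$; (D) there are $C_1'>0$, $\lambda\ge0$ such that each $\boldsymbol{x}_0\in\partial\Omega$ has an open ball $U_\rho(\boldsymbol{x}_0)$ with $\mu(e\cap\Omega)\le C_1'(\sup_{\boldsymbol{x}\in e}\operatorname{dist}(\boldsymbol{x},\partial\Omega))^\lambda|e|$ for all Borel $e\subset U_\rho(\boldsymbol{x}_0)\cap\Omega$; with $K=\frac{d+\tau+1}{\tau+2}+\frac\lambda2$, $k\le K$ if $0\le k<1$ or $k\ge d/2$ and $k<K$ if $1\le k<d/2$; and $I$ an admissible mesh family — the classical Dirichlet problem has a unique generalised solution $u\in W^+(\Omega)\cap C(\overline\Omega)$, and for every $\delta>0$, $$\lim_{I\ni h\to0}\|u_h-u\|_{L^\infty(\overline{\Omega_\delta})}=0,$$ where $u_h$ is the solution of the finite element problem on $\mathcal T_h$.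
   Context: $\Omega\subset\mathbb{R}^d$ is a bounded open convex domain; $g\in C(\partial\Omega)$; $R:\mathbb{R}^d\to(0,\infty)$ locally integrable; $\mu$ a nonnegative Borel measure on $\Omega$; $W^+(U)$ the convex real-valued functions on open convex $U$; $\partial u(\boldsymbol{x})=\{\boldsymbol{p}:\ u(\boldsymbol{y})\ge u(\boldsymbol{x})+\boldsymbol{p}\cdot(\boldsymbol{y}-\boldsymbol{x})\ \forall\boldsymbol{y}\in U\}$, $\partial u(E)=\bigcup_{\boldsymbol{x}\in E}\partial u(\boldsymbol{x})$; $|e|$ Lebesgue measure; $\Omega_\delta=\{\boldsymbol{x}\in\Omega:\operatorname{dist}(\boldsymbol{x},\partial\Omega)>\delta\}$. Generalised solution of the classical Dirichlet problem: $u\in W^+(\Omega)\cap C(\overline\Omega)$ with $\int_{\partial u(e)}R\,d\boldsymbol{p}=\mu(e)$ for every Borel $e\subset\Omega$ and $u=g$ on $\partial\Omega$. Local parabolic support of order $\tau$ at $\boldsymbol{a}_0\in\partial\Omega$: in Cartesian coordinates with $\boldsymbol{a}_0=0$, supporting hyperplane $\{x^d=0\}$ and $x^d$ along the interior normal, $\partial\Omega$ near $\boldsymbol{a}_0$ is a graph $x^d=g_0(x^1,\dots,x^{d-1})$ over its projection $\Pi$, with $g_0\ge\eta(\boldsymbol{a}_0)(\sum_{i<d}|x^i|^2)^{(\tau+2)/2}$ on $\Pi$ for some $\eta(\boldsymbol{a}_0)>0$. Mesh: finite set $\mathcal T_h$ of closed $d$-simplices in $\overline\Omega$, pairwise meeting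 in common sub-simplices of dimension $\le d-1$, $h=\max\operatorname{diam}T$, $\Omega_h:=\operatorname{Int}(\bigcup T)$ convex, all vertices of $\mathcal T_h$ on $\partial\Omega_h$ lying on $\partial\Omega$; interior vertices $\boldsymbol{A}_i$ ($1\le i\le k_h$), vertices on $\partial\Omega_h$: $\boldsymbol{B}_j$. $H_h$: functions $v\in W^+(\Omega_h)\cap C(\overline{\Omega_h})$ with $v(\boldsymbol{x})=\inf\{t:(\boldsymbol{x},t)\in M_h(z)\}$, $M_h(z)$ the convex hull of $\{(\boldsymbol{A}_i,z_i)\}\cup\{(\boldsymbol{B}_j,g(\boldsymbol{B}_j))\}$, for some $z\in\mathbb{R}^{k_h}$. $\phi_{i,h}$: continuous, affine on each simplex, $\phi_{i,h}(\boldsymbol{A}_j)=\delta_{ij}$, $\phi_{i,h}(\boldsymbol{B}_j)=0$. Finite element problem: find $u_h\in H_h$ with $\int_{\partial u_h(\boldsymbol{A}_i)}R\,d\boldsymbol{p}=\int_{\Omega_h}\phi_{i,h}\,d\mu$ for all $i$ (sub-differential relative to $\Omega_h$); it has a unique solution. Admissible mesh family: $I\subset(0,1)$ with $0$ as unique accumulation point, a mesh $\mathcal T_h$ for each $h\in I$, and for every $\delta>0$ some $h_\delta>0$ with $\overline{\Omega_\delta}\subset\Omega_h$ for $h\in I$, $h<h_\delta$. *)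

theory Defs
  imports "HOL-Analysis.Analysis"
begin

definition subdiff :: "'a::euclidean_space set \<Rightarrow> ('a \<Rightarrow> real) \<Rightarrow> 'a \<Rightarrow> 'a set" where
  "subdiff U u x = {p. \<forall>y\<in>U. u y \<ge> u x + p \<bullet> (y - x)}"

definition subdiff_set :: "'a::euclidean_space set \<Rightarrow> ('a \<Rightarrow> real) \<Rightarrow> 'a set \<Rightarrow> 'a set" where
  "subdiff_set U u E = (\<Union>x\<in>E. subdiff U u x)"

definition R_measure :: "('a::euclidean_space \<Rightarrow> real) \<Rightarrow> 'a set \<Rightarrow> ennreal" where
  "R_measure R A = (\<integral>\<^sup>+ p. ennreal (R p) * indicator A p \<partial>lebesgue)"

definition inner_set :: "'a::euclidean_space set \<Rightarrow> real \<Rightarrow> 'a set" where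
  "inner_set \<Omega> \<delta> = {x\<in>\<Omega>. infdist x (frontier \<Omega>) > \<delta>}"

text \<open>Local parabolic support of order \<tau> at a0: n is the (unit) interior normal of a supporting
  hyperplane at a0 (the coordinate \<open>x^d\<close>), the orthogonal projection onto \<open>n\<^sup>\<bottom>\<close> gives
  the coordinates \<open>x^1..x^{d-1}\<close>; near a0 the boundary is a graph over its projection and
  lies above the parabola-type surface \<open>x^d = \<eta> |x'|^(\<tau>+2)\<close>.\<close>
definition local_parabolic_support :: "'a::euclidean_space set \<Rightarrow> real \<Rightarrow> 'a \<Rightarrow> bool" where
  "local_parabolic_support \<Omega> \<tau> a0 \<longleftrightarrow>
     (\<exists>n \<eta> V. norm n = 1 \<and> \<eta> > 0 \<and> open V \<and> a0 \<in> V \<and>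
        (\<forall>x\<in>closure \<Omega>. (x - a0) \<bullet> n \<ge> 0) \<and>
        inj_on (\<lambda>x. (x - a0) - ((x - a0) \<bullet> n) *\<^sub>R n) (frontier \<Omega> \<inter> V) \<and>
        (\<forall>x\<in>frontier \<Omega> \<inter> V.
            (x - a0) \<bullet> n \<ge> \<eta> * norm ((x - a0) - ((x - a0) \<bullet> n) *\<^sub>R n) powr (\<tau> + 2)))"

text \<open>Generalised solution of the classical Dirichlet problem (\<mu> is a measure on the Borel
  subsets of \<Omega>).\<close>
definition gen_solution ::
  "'a::euclidean_space set \<Rightarrow> ('a \<Rightarrow> real) \<Rightarrow> 'a measure \<Rightarrow> ('a \<Rightarrow> real) \<Rightarrow> ('a \<Rightarrow> real) \<Rightarrow> bool" where
  "gen_solution \<Omega> R \<mu> g u \<longleftrightarrow>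
     convex_on \<Omega> u \<and> continuous_on (closure \<Omega>) u \<and>
     (\<forall>e. e \<in> sets borel \<and> e \<subseteq> \<Omega> \<longrightarrow> R_measure R (subdiff_set \<Omega> u e) = emeasure \<mu> e) \<and>
     (\<forall>x\<in>frontier \<Omega>. u x = g x)"

definition mesh_vertices :: "'a::euclidean_space set set \<Rightarrow> 'a set" where
  "mesh_vertices \<T> = (\<Union>T\<in>\<T>. {v. v extreme_point_of T})"

definition mesh_domain :: "'a::euclidean_space set set \<Rightarrow> 'a set" where
  "mesh_domain \<T> = interior (\<Union>\<T>)"

definition interior_vertices :: "'a::euclidean_space set set \<Rightarrow> 'a set" where
  "interior_vertices \<T> = mesh_vertices \<T> \<inter> mesh_domain \<T>"

definition boundary_vertices :: "'a::euclidean_space set set \<Rightarrow> 'a set" where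
  "boundary_vertices \<T> = mesh_vertices \<T> \<inter> frontier (mesh_domain \<T>)"

definition is_mesh :: "'a::euclidean_space set \<Rightarrow> 'a set set \<Rightarrow> real \<Rightarrow> bool" where
  "is_mesh \<Omega> \<T> h \<longleftrightarrow>
     finite \<T> \<and> \<T> \<noteq> {} \<and>
     (\<forall>T\<in>\<T>. (int DIM('a)) simplex T \<and> T \<subseteq> closure \<Omega>) \<and>
     (\<forall>T\<in>\<T>. \<forall>T'\<in>\<T>. T \<noteq> T' \<longrightarrow> (T \<inter> T') face_of T \<and> (T \<inter> T') face_of T') \<and>
     h = Max (diameter ` \<T>) \<and>
     convex (mesh_domain \<T>) \<and>
     boundary_vertices \<T> \<subseteq> frontier \<Omega>"

definition lower_env :: "'a::euclidean_space set set \<Rightarrow> ('a \<Rightarrow> real) \<Rightarrow> ('a \<Rightarrow> real) \<Rightarrow> 'a \<Rightarrow> real" where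
  "lower_env \<T> g z x =
     Inf {t. (x, t) \<in> convex hull ((\<lambda>a. (a, z a)) ` interior_vertices \<T> \<union>
                                  (\<lambda>b. (b, g b)) ` boundary_vertices \<T>)}"

definition H_space :: "'a::euclidean_space set set \<Rightarrow> ('a \<Rightarrow> real) \<Rightarrow> ('a \<Rightarrow> real) set" where
  "H_space \<T> g = {v. convex_on (mesh_domain \<T>) v \<and> continuous_on (closure (mesh_domain \<T>)) v \<and>
      (\<exists>z. \<forall>x\<in>closure (mesh_domain \<T>). v x = lower_env \<T> g z x)}"

definition hat_function :: "'a::euclidean_space set set \<Rightarrow> 'a \<Rightarrow> ('a \<Rightarrow> real) \<Rightarrow> bool" where
  "hat_function \<T> A \<phi> \<longleftrightarrow>
     continuous_on (\<Union>\<T>) \<phi> \<and>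
     (\<forall>T\<in>\<T>. \<exists>c b. \<forall>x\<in>T. \<phi> x = c \<bullet> x + b) \<and>
     \<phi> A = 1 \<and> (\<forall>V\<in>mesh_vertices \<T> - {A}. \<phi> V = 0)"

definition fe_solution ::
  "'a::euclidean_space set set \<Rightarrow> ('a \<Rightarrow> real) \<Rightarrow> 'a measure \<Rightarrow> ('a \<Rightarrow> real) \<Rightarrow> ('a \<Rightarrow> real) \<Rightarrow> bool" where
  "fe_solution \<T> R \<mu> g uh \<longleftrightarrow>
     uh \<in> H_space \<T> g \<and>
     (\<forall>A\<in>interior_vertices \<T>. \<forall>\<phi>. hat_function \<T> A \<phi> \<longrightarrow>
        R_measure R (subdiff (mesh_domain \<T>) uh A) =
        (\<integral>\<^sup>+ x. ennreal (\<phi> x) * indicator (mesh_domain \<T>) x \<partial>\<mu>))"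

definition admissible_family :: "'a::euclidean_space set \<Rightarrow> real set \<Rightarrow> (real \<Rightarrow> 'a set set) \<Rightarrow> bool" where
  "admissible_family \<Omega> I \<T> \<longleftrightarrow>
     I \<subseteq> {0<..<1} \<and> {x. x islimpt I} = {0} \<and>
     (\<forall>h\<in>I. is_mesh \<Omega> (\<T> h) h) \<and>
     (\<forall>\<delta>>0. \<exists>h\<delta>>0. \<forall>h\<in>I. h < h\<delta> \<longrightarrow> closure (inner_set \<Omega> \<delta>) \<subseteq> mesh_domain (\<T> h))"

end

theory Submission
  imports Defs "HOL-Complex_Analysis.Great_Picard"
begin

text \<open>The finite element solutions are bounded, since a deep graph would attain more slopes than \<open>\<mu>(\<Omega>)\<close> allows,
  and hence locally Lipschitz, so every sequence \<open>h \<rightarrow> 0\<close> has a locally uniformly convergent subsequence. Contact points are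
  stable under locally uniform convergence, which identifies the mass of the limit with \<open>\<mu>\<close> in the interior. An affine
  function bounds the solutions from above near a boundary point. From below, suppose the solutions stay at some depth \<open>H > 0\<close> below
  an affine barrier arbitrarily near a boundary point, with \<open>H\<close> minimal. Steep slopes that are tilted at most by a multiple of
  \<open>s * T powr (1 - a)\<close>, \<open>a = 1 / (\<tau> + 2)\<close>, at steepness \<open>s \<le> H / (6 * T)\<close> then touch the graph only over the cap of height
  \<open>3 * T\<close>. Their mass is of order \<open>T powr (2 * k - K0)\<close> per dyadic range of \<open>s\<close>, whereas \<open>\<mu>\<close> of that cap is at most of order
  \<open>T powr (K0 + lam)\<close>, where \<open>K0 = 1 + a * (d - 1)\<close>. For \<open>k < K\<close> one range and small \<open>T\<close> give a contradiction; for
  \<open>k = K\<close> and \<open>2 * k \<ge> d\<close> sufficiently many ranges do. Uniqueness makes the limit independent of the subsequence.\<close>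

section \<open>Slopes, their measure, and slopes with two contact points\<close>

text \<open>The exponents come from two volumes. With \<open>d\<close> the dimension, a cap of
  height \<open>T\<close> has width about \<open>T powr a\<close> in \<open>d - 1\<close>
  directions, hence volume about \<open>T powr K0\<close>; in it the distance to the boundary is at
  most \<open>T\<close>, whence \<open>T powr lam\<close>. A tilt \<open>q\<close> costs at most
  \<open>norm q * norm (y - a0)\<close>. This is harmless against the gain \<open>s * f y\<close> of
  a slope of steepness \<open>s\<close> (\<open>f y\<close> the height of \<open>y\<close>) if
  \<open>norm q\<close> is a small multiple of \<open>s * T powr (1 - a)\<close>, because
  \<open>T powr (1 - a) * f y powr a \<le> T + f y\<close>. For \<open>s\<close> of order
  \<open>1 / T\<close> such slopes fill a volume of order
  \<open>s powr d * T powr ((1 - a) * (d - 1)) = T powr (- K0)\<close>, and the weight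
  \<open>s powr (- 2 * k)\<close> turns it into \<open>T powr (2 * k - K0)\<close>. The obstacle is
  to keep the contact points in a small cap: a steep plane through a moderately deep point could
  touch the graph at a much deeper point further away. Only near the smallest depth that cannot be
  excluded is the possible extra depth elsewhere small compared with \<open>s * T\<close>; hence the
  argument by an infimum of depths.\<close>

lemma R_measure_mono: "A \<subseteq> B \<Longrightarrow> R_measure R A \<le> R_measure R B"
  unfolding R_measure_def by (intro nn_integral_mono) (auto simp: indicator_def)

text \<open>\<open>integrable_on\<close> is the Henstock-Kurzweil notion; positivity upgrades it to
  absolute integrability on balls, and \<open>R\<close> is the pointwise limit of its truncations to
  growing balls.\<close>

lemma measurable_of_integrable_on_compact:
  fixes R :: "'a::euclidean_space \<Rightarrow> real"
  assumes "\<forall>p. R p > 0" "\<forall>K. compact K \<longrightarrow> R integrable_on K" shows "R \<in> borel_measurable lebesgue"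
proof (rule borel_measurable_LIMSEQ_real)
  fix n :: nat
  have "R absolutely_integrable_on cball 0 (real n)"
    using assms by (intro nonnegative_absolutely_integrable_1) (auto simp: less_imp_le)
  then show "(\<lambda>x. indicator (cball 0 (real n)) x *\<^sub>R R x) \<in> borel_measurable lebesgue"
    by (simp add: set_integrable_def borel_measurable_integrable)
next
  fix x :: 'a
  obtain N :: nat where N: "norm x \<le> real N" using real_arch_simple by blast
  have "\<forall>n\<ge>N. indicator (cball 0 (real n)) x *\<^sub>R R x = R x" using N by (auto simp: indicator_def)
  then have "eventually (\<lambda>n. indicator (cball 0 (real n)) x *\<^sub>R R x = R x) sequentially"
    unfolding eventually_sequentially by blast
  then show "(\<lambda>n. indicator (cball 0 (real n)) x *\<^sub>R R x) \<longlonglongrightarrow> R x" by (rule tendsto_eventually)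
qed

text \<open>For an arbitrary set \<open>R_measure\<close> is merely a monotone lower integral;
  additivity and continuity are inherited from the measure with density \<open>R\<close> on Lebesgue
  sets.\<close>

lemma R_measure_eq_emeasure:
  assumes "R \<in> borel_measurable lebesgue" "A \<in> sets lebesgue"
  shows "R_measure R A = emeasure (density lebesgue (\<lambda>p. ennreal (R p))) A"
  unfolding R_measure_def using assms by (subst emeasure_density) auto

lemma R_measure_bounded_finite:
  fixes R :: "'a::euclidean_space \<Rightarrow> real"
  assumes "\<forall>p. R p > 0" "\<forall>K. compact K \<longrightarrow> R integrable_on K" "bounded A" shows "R_measure R A < \<infinity>"
proof -
  obtain r where r: "A \<subseteq> cball 0 r"
    using assms(3) unfolding bounded_iff subset_eq mem_cball_0 by blast
  have "R absolutely_integrable_on cball 0 r"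
    using assms by (intro nonnegative_absolutely_integrable_1) (auto simp: less_imp_le)
  then have "(\<integral>\<^sup>+ p. norm (indicator (cball 0 r) p *\<^sub>R R p) \<partial>lebesgue) < \<infinity>"
    by (simp add: set_integrable_def integrable_iff_bounded)
  also have "(\<integral>\<^sup>+ p. norm (indicator (cball 0 r) p *\<^sub>R R p) \<partial>lebesgue) = R_measure R (cball 0 r)"
    unfolding R_measure_def using assms(1)
    by (intro nn_integral_cong) (auto simp: indicator_def less_imp_le)
  finally show ?thesis using R_measure_mono[OF r, of R] by (rule order.strict_trans1[rotated])
qed

lemma negligible_of_R_measure_zero:
  assumes "R \<in> borel_measurable lebesgue" "\<forall>p. R p > 0" "A \<in> sets lebesgue" "R_measure R A = 0"
  shows "negligible A"
proof -
  have "AE p in lebesgue. ennreal (R p) * indicator A p = 0"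
    using assms unfolding R_measure_def by (subst (asm) nn_integral_0_iff_AE) auto
  then have "AE p in lebesgue. p \<notin> A"
    by (rule AE_mp) (use assms(2) in \<open>auto simp: indicator_def not_le ennreal_eq_0_iff not_less[symmetric] split: if_splits intro!: AE_I2\<close>)
  then have "A \<in> null_sets lebesgue" using assms(3) by (simp add: AE_iff_null_sets)
  then show ?thesis by (simp add: negligible_iff_null_sets)
qed

text \<open>The two integrands agree almost everywhere, whatever \<open>A\<close> is. This allows
  exceptional slopes to be added to or removed from sets whose measurability is not at hand.\<close>

lemma R_measure_Un_negligible:
  assumes "negligible N" shows "R_measure R (A \<union> N) = R_measure R A"
proof -
  have "N \<in> null_sets lebesgue" using assms by (simp add: negligible_iff_null_sets)
  then have "AE p in lebesgue. p \<notin> N" by (rule AE_not_in)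
  then have "AE p in lebesgue. ennreal (R p) * indicator (A \<union> N) p = ennreal (R p) * indicator A p"
    by (rule AE_mp) (auto simp: indicator_def)
  then show ?thesis unfolding R_measure_def by (rule nn_integral_cong_AE)
qed

context
  fixes R :: "'a::euclidean_space \<Rightarrow> real"
  assumes R: "R \<in> borel_measurable lebesgue"
begin

lemma R_measure_UN_le:
  assumes "finite S" "\<And>i. i \<in> S \<Longrightarrow> A i \<in> sets lebesgue"
  shows "R_measure R (\<Union>i\<in>S. A i) \<le> (\<Sum>i\<in>S. R_measure R (A i))"
  using emeasure_subadditive_finite[of S A "density lebesgue (\<lambda>p. ennreal (R p))"] assms
  by (auto simp: R_measure_eq_emeasure[OF R] sets.finite_UN image_subset_iff)

lemma R_measure_disjoint_UN:
  assumes "finite S" "\<And>i. i \<in> S \<Longrightarrow> A i \<in> sets lebesgue" "disjoint_family_on A S"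
  shows "R_measure R (\<Union>i\<in>S. A i) = (\<Sum>i\<in>S. R_measure R (A i))"
  using sum_emeasure[of A S "density lebesgue (\<lambda>p. ennreal (R p))"] assms
  by (auto simp: R_measure_eq_emeasure[OF R] sets.finite_UN image_subset_iff)

lemma R_measure_UN_incseq:
  assumes "\<And>n::nat. A n \<in> sets lebesgue" "incseq A"
  shows "R_measure R (\<Union>n. A n) = (SUP n. R_measure R (A n))"
  using SUP_emeasure_incseq[of A "density lebesgue (\<lambda>p. ennreal (R p))"] assms
  by (auto simp: R_measure_eq_emeasure[OF R] image_subset_iff)

lemma R_measure_INT_decseq:
  assumes "\<And>n::nat. A n \<in> sets lebesgue" "decseq A" "\<And>n. R_measure R (A n) < \<infinity>"
  shows "R_measure R (\<Inter>n. A n) = (INF n. R_measure R (A n))"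
  using INF_emeasure_decseq[of A "density lebesgue (\<lambda>p. ennreal (R p))"] assms
  by (auto simp: R_measure_eq_emeasure[OF R] sets.countable_INT'' image_subset_iff less_top)

lemma R_measure_Diff:
  assumes "A \<in> sets lebesgue" "B \<in> sets lebesgue" "B \<subseteq> A" "R_measure R B < \<infinity>"
  shows "R_measure R (A - B) = R_measure R A - R_measure R B"
  using emeasure_Diff[of "density lebesgue (\<lambda>p. ennreal (R p))" B A] assms
  by (auto simp: R_measure_eq_emeasure[OF R] less_top)

end

lemma R_measure_UNIV: "R_measure R UNIV = (\<integral>\<^sup>+ p. ennreal (R p) \<partial>lebesgue)"
  by (simp add: R_measure_def)

text \<open>A packing bound. It serves twice: to show that sets of kinks are null, and to bound the
  volume of a thin cap by that of a ball.\<close>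

lemma measure_disjoint_translates_le:
  fixes Q :: "'a::euclidean_space set"
  assumes Q: "Q \<in> lmeasurable" and B: "B \<in> lmeasurable"
    and disj: "\<And>i j x y. i < j \<Longrightarrow> j < N \<Longrightarrow> x \<in> Q \<Longrightarrow> y \<in> Q \<Longrightarrow> c i + x \<noteq> c j + y"
    and sub: "\<And>i x. i < N \<Longrightarrow> x \<in> Q \<Longrightarrow> c i + x \<in> B"
  shows "real N * measure lebesgue Q \<le> measure lebesgue B"
proof -
  define G where "G i = (+) (c i) ` Q" for i
  have Gm: "G i \<in> lmeasurable" for i unfolding G_def using Q by (rule measurable_translation)
  have dj: "disjoint_family_on G {..<N}" unfolding disjoint_family_on_def
  proof (intro ballI impI)
    fix i j assume "i \<in> {..<N}" "j \<in> {..<N}" "i \<noteq> j"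
    then show "G i \<inter> G j = {}"
      using disj[of i j] disj[of j i] unfolding G_def by (cases "i < j") (force simp: not_less le_less)+
  qed
  have "real N * measure lebesgue Q = (\<Sum>i<N. measure lebesgue (G i))"
    unfolding G_def by (simp add: measure_translation)
  also have "\<dots> = measure lebesgue (\<Union>i<N. G i)"
    unfolding infinity_ennreal_def[symmetric] using fmeasurableD2[OF Gm, folded infinity_ennreal_def]
    by (intro measure_finite_Union[symmetric] finite_lessThan image_subsetI fmeasurableD[OF Gm] dj)
  also have "\<dots> \<le> measure lebesgue B"
    using sub Gm B by (intro measure_mono_fmeasurable) (auto simp: G_def)
  finally show ?thesis .
qed

text \<open>The \<open>N\<close> translates of a bounded piece by \<open>(i / N) * e\<close> with
  \<open>i < N\<close> are pairwise disjoint and stay in one ball that does not depend on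
  \<open>N\<close>, so the measure of the piece is zero.\<close>

lemma negligible_if_disjoint_translates:
  fixes S :: "'a::euclidean_space set"
  assumes "closed S" and e: "\<And>x t. x \<in> S \<Longrightarrow> t > 0 \<Longrightarrow> x + t *\<^sub>R e \<notin> S" shows "negligible S"
proof -
  have bdd: "negligible B" if B: "compact B" "B \<subseteq> S" for B
  proof -
    have Bm: "B \<in> lmeasurable" using B(1) by (rule lmeasurable_compact)
    obtain r where r: "\<And>x. x \<in> B \<Longrightarrow> norm x \<le> r"
      using compact_imp_bounded[OF B(1)] unfolding bounded_iff by blast
    define C where "C = cball (0::'a) (r + norm e)"
    have Nle: "real N * measure lebesgue B \<le> measure lebesgue C" for N :: nat
    proof (rule measure_disjoint_translates_le[OF Bm, where c="\<lambda>i. (real i / real N) *\<^sub>R e"])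
      show "C \<in> lmeasurable" by (simp add: C_def)
      fix i j x y assume ij: "i < j" "j < N" and xy: "x \<in> B" "y \<in> B"
      show "(real i / real N) *\<^sub>R e + x \<noteq> (real j / real N) *\<^sub>R e + y"
      proof
        assume "(real i / real N) *\<^sub>R e + x = (real j / real N) *\<^sub>R e + y"
        then have "x = y + ((real j - real i) / real N) *\<^sub>R e"
          by (simp add: algebra_simps diff_divide_distrib)
        moreover have "(real j - real i) / real N > 0" using ij by auto
        ultimately show False using e[of y "(real j - real i) / real N"] xy B(2) by auto
      qed
    next
      fix i x assume ix: "i < N" "x \<in> B"
      have "(real i / real N) * norm e \<le> 1 * norm e" using ix by (intro mult_right_mono) auto
      then show "(real i / real N) *\<^sub>R e + x \<in> C"
        using r[OF ix(2)] norm_triangle_ineq[of "(real i / real N) *\<^sub>R e" x] by (simp add: C_def)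
    qed
    have "measure lebesgue B \<le> 0"
    proof (rule ccontr)
      assume "\<not> measure lebesgue B \<le> 0"
      then have "0 < measure lebesgue B" by simp
      from reals_Archimedean3[OF this] obtain N :: nat where "measure lebesgue C < real N * measure lebesgue B"
        by blast
      with Nle[of N] show False by simp
    qed
    then have "measure lebesgue B = 0" by (simp add: order_antisym)
    then show "negligible B" using Bm by (simp add: negligible_iff_measure)
  qed
  have "S = (\<Union>n::nat. S \<inter> cball 0 (real n))" using real_arch_simple by auto
  moreover have "negligible (\<Union>n::nat. S \<inter> cball 0 (real n))"
    using assms(1) by (intro negligible_countable_Union) (auto intro!: bdd closed_Int_compact)
  ultimately show ?thesis by simp
qed

definition legendre :: "'a::euclidean_space set \<Rightarrow> ('a \<Rightarrow> real) \<Rightarrow> 'a \<Rightarrow> real" where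
  "legendre C u p = (SUP y\<in>C. p \<bullet> y - u y)"

lemma continuous_legendre:
  assumes ne: "C \<noteq> {}" and C: "bounded C" and bdd: "\<And>p. bdd_above ((\<lambda>y. p \<bullet> y - u y) ` C)"
  shows "continuous_on UNIV (legendre C u)"
proof -
  obtain B where B: "\<And>x. x \<in> C \<Longrightarrow> norm x \<le> B" using C bounded_iff by blast
  have le: "legendre C u p \<le> legendre C u q + B * norm (p - q)" for p q
    unfolding legendre_def[of C u p]
  proof (rule cSUP_least[OF ne])
    fix y assume y: "y \<in> C"
    have "(p - q) \<bullet> y \<le> norm (p - q) * B"
      using norm_cauchy_schwarz[of "p - q" y] mult_left_mono[OF B[OF y], of "norm (p - q)"] by simp
    moreover have "q \<bullet> y - u y \<le> legendre C u q" unfolding legendre_def using y bdd by (rule cSUP_upper)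
    ultimately show "p \<bullet> y - u y \<le> legendre C u q + B * norm (p - q)" by (simp add: inner_diff_left mult.commute)
  qed
  have "0 \<le> B" using B ne norm_ge_zero order_trans by blast
  have "B-lipschitz_on UNIV (legendre C u)"
  proof (rule lipschitz_onI)
    fix p q show "dist (legendre C u p) (legendre C u q) \<le> B * dist p q"
      using le[of p q] le[of q p] by (simp add: dist_real_def abs_le_iff dist_norm norm_minus_commute)
  qed fact
  then show ?thesis by (rule lipschitz_on_continuous_on)
qed

text \<open>Off this set the contact point is a function of the slope, so that disjoint sets of
  points have disjoint sets of slopes.\<close>

definition overlap :: "'a::euclidean_space set \<Rightarrow> ('a \<Rightarrow> real) \<Rightarrow> 'a set" where
  "overlap U u = {p. \<exists>x\<in>U. \<exists>y\<in>U. x \<noteq> y \<and> p \<in> subdiff U u x \<and> p \<in> subdiff U u y}"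

text \<open>The points of \<open>overlap U u\<close> are kinks of the Legendre transform \<open>f\<close>, along some coordinate
  direction \<open>b\<close>.\<close>

lemma negligible_overlap:
  fixes U :: "'a::euclidean_space set"
  assumes "bounded U" shows "negligible (overlap U u)"
proof (cases "overlap U u = {}")
  case False
  then obtain p0 x0 where x0: "x0 \<in> U" and p0: "p0 \<in> subdiff U u x0" unfolding overlap_def by auto
  obtain B where B: "\<And>x. x \<in> U \<Longrightarrow> norm x \<le> B" using assms bounded_iff by blast
  define f where "f = legendre U u"
  have bdd: "bdd_above ((\<lambda>y. p \<bullet> y - u y) ` U)" for p
  proof (rule bdd_aboveI2)
    fix y assume y: "y \<in> U"
    have "u y \<ge> u x0 + p0 \<bullet> (y - x0)" using p0 y by (auto simp: subdiff_def)
    moreover have "(p - p0) \<bullet> y \<le> norm (p - p0) * B"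
      using norm_cauchy_schwarz[of "p - p0" y] B[OF y] mult_left_mono[of "norm y" B "norm (p - p0)"]
      by simp
    ultimately show "p \<bullet> y - u y \<le> norm (p - p0) * B + p0 \<bullet> x0 - u x0"
      by (simp add: inner_diff_left inner_diff_right)
  qed
  have fge: "f p \<ge> p \<bullet> y - u y" if "y \<in> U" for p y
    unfolding f_def legendre_def using that bdd by (rule cSUP_upper)
  have feq: "f p = p \<bullet> x - u x" if "p \<in> subdiff U u x" "x \<in> U" for p x
  proof (rule antisym)
    show "f p \<le> p \<bullet> x - u x" unfolding f_def legendre_def
      using that by (intro cSUP_least) (auto simp: subdiff_def inner_diff_right algebra_simps)
  qed (rule fge[OF that(2)])
  have fcont: "continuous_on UNIV f"
    unfolding f_def using continuous_legendre[OF _ assms bdd] x0 by blast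
  \<comment> \<open>\<open>M b q\<close> consists of the \<open>p\<close> at which \<open>q\<close>
    is a subgradient of \<open>f\<close> restricted to the line through \<open>p\<close> in
    direction \<open>b\<close>.\<close>
  define M where "M b q = {p. \<forall>t. f (p + t *\<^sub>R b) \<ge> f p + q * t}" for b q
  have Mclosed: "closed (M b q)" for b q
  proof -
    have "M b q = (\<Inter>t. {p. f p + q * t \<le> f (p + t *\<^sub>R b)})" unfolding M_def by auto
    then show ?thesis by (simp add: closed_INT closed_Collect_le continuous_intros
          continuous_on_compose2[OF fcont])
  qed
  define S where "S b q q' = M b q \<inter> M b q'" for b q q'
  \<comment> \<open>Subgradients along a line increase: if \<open>q'\<close> is one at
    \<open>x\<close>, then none at \<open>x + t *\<^sub>R b\<close> with \<open>t > 0\<close> can be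
    as small as \<open>q\<close>.\<close>
  have Sneg: "negligible (S b q q')" if "q < q'" for b q q'
  proof (rule negligible_if_disjoint_translates)
    show "closed (S b q q')" unfolding S_def using Mclosed by auto
    fix x t assume x: "x \<in> S b q q'" and t: "(t::real) > 0"
    show "x + t *\<^sub>R b \<notin> S b q q'"
    proof
      assume "x + t *\<^sub>R b \<in> S b q q'"
      then have "f ((x + t *\<^sub>R b) + (-t) *\<^sub>R b) \<ge> f (x + t *\<^sub>R b) + q * (-t)"
        unfolding S_def M_def by blast
      moreover have "f (x + t *\<^sub>R b) \<ge> f x + q' * t" using x unfolding S_def M_def by blast
      moreover have "q * t < q' * t" using that t by simp
      ultimately show False by simp
    qed
  qed
  have subM: "p \<in> M b (x \<bullet> b)" if "p \<in> subdiff U u x" "x \<in> U" for p x b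
  proof -
    have "f (p + t *\<^sub>R b) \<ge> f p + (x \<bullet> b) * t" for t
      using fge[OF that(2), where p = "p + t *\<^sub>R b"] feq[OF that]
      by (simp add: inner_add_left inner_commute[of x b] mult.commute)
    then show ?thesis unfolding M_def by blast
  qed
  have Mconv: "p \<in> M b q" if "p \<in> M b q1" "p \<in> M b q2" "q1 \<le> q" "q \<le> q2" for p b q q1 q2
  proof -
    have "f (p + t *\<^sub>R b) \<ge> f p + q * t" for t
    proof (cases "t \<ge> 0")
      case True
      then have "q * t \<le> q2 * t" using that by (simp add: mult_right_mono)
      moreover have "f (p + t *\<^sub>R b) \<ge> f p + q2 * t" using that(2) unfolding M_def by blast
      ultimately show ?thesis by linarith
    next
      case False
      then have "q * t \<le> q1 * t" using that by (simp add: mult_right_mono_neg)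
      moreover have "f (p + t *\<^sub>R b) \<ge> f p + q1 * t" using that(1) unfolding M_def by blast
      ultimately show ?thesis by linarith
    qed
    then show ?thesis unfolding M_def by blast
  qed
  \<comment> \<open>Subgradients along a line form an interval, so a kink between
    \<open>x \<bullet> b\<close> and \<open>y \<bullet> b\<close> contains two rational ones;
    countably many null sets suffice.\<close>
  define Q where "Q = {(b, q, q'). b \<in> (Basis::'a set) \<and> q \<in> (\<rat>::real set) \<and> q' \<in> (\<rat>::real set) \<and> q < q'}"
  have "countable Q"
    by (rule countable_subset[of _ "Basis \<times> \<rat> \<times> \<rat>"]) (auto simp: Q_def intro!: countable_SIGMA countable_rat countable_finite[OF finite_Basis])
  have "overlap U u \<subseteq> (\<Union>(b,q,q')\<in>Q. S b q q')"
  proof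
    fix p assume "p \<in> overlap U u"
    then obtain x0 y0 where x0y0: "x0 \<in> U" "y0 \<in> U" "x0 \<noteq> y0" "p \<in> subdiff U u x0" "p \<in> subdiff U u y0"
      unfolding overlap_def by blast
    then obtain b where b: "b \<in> Basis" "x0 \<bullet> b \<noteq> y0 \<bullet> b" by (meson euclidean_eqI)
    have "\<exists>x y. x \<in> U \<and> y \<in> U \<and> p \<in> subdiff U u x \<and> p \<in> subdiff U u y \<and> x \<bullet> b < y \<bullet> b"
      using x0y0 b by (metis linorder_neqE_linordered_idom)
    then obtain x y where xy: "x \<in> U" "y \<in> U" "p \<in> subdiff U u x" "p \<in> subdiff U u y" "x \<bullet> b < y \<bullet> b"
      by blast
    obtain q where q: "q \<in> \<rat>" "x \<bullet> b < q" "q < y \<bullet> b" using Rats_dense_in_real[OF xy(5)] by blast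
    obtain q' where q': "q' \<in> \<rat>" "q < q'" "q' < y \<bullet> b" using Rats_dense_in_real[OF q(3)] by blast
    have "p \<in> S b q q'"
      unfolding S_def using Mconv[OF subM[OF xy(3,1)] subM[OF xy(4,2)]] q q' by auto
    then show "p \<in> (\<Union>(b,q,q')\<in>Q. S b q q')" using b q q' unfolding Q_def by fastforce
  qed
  moreover have "negligible (\<Union>(b,q,q')\<in>Q. S b q q')"
    using \<open>countable Q\<close> Sneg by (intro negligible_countable_Union) (auto simp: Q_def)
  ultimately show ?thesis by (rule negligible_subset[rotated])
qed auto

section \<open>Elementary properties of subdifferentials\<close>

lemma closed_subdiff: "closed (subdiff U u x)"
proof -
  have "subdiff U u x = (\<Inter>y\<in>U. {p. u x + p \<bullet> (y - x) \<le> u y})" unfolding subdiff_def by auto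
  then show ?thesis by (simp add: closed_INT closed_Collect_le continuous_intros)
qed

lemma subdiff_lebesgue: "subdiff U u x \<in> sets lebesgue"
  using borel_closed[OF closed_subdiff[of U u x]] by (intro sets_completionI_sets) simp

text \<open>Contact points of a convergent sequence of slopes accumulate in \<open>K\<close>. This
  closedness is the source of the measurability of slope sets over open sets.\<close>

lemma closed_subdiff_set:
  assumes "compact K" "K \<subseteq> U" "continuous_on K u" shows "closed (subdiff_set U u K)"
  unfolding closed_sequential_limits
proof (intro allI impI, elim conjE)
  fix P :: "nat \<Rightarrow> 'a" and p assume P: "\<forall>n. P n \<in> subdiff_set U u K" "P \<longlonglongrightarrow> p"
  then have "\<forall>n. \<exists>x. x \<in> K \<and> P n \<in> subdiff U u x" unfolding subdiff_set_def by auto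
  then obtain X where X: "\<And>n. X n \<in> K" "\<And>n. P n \<in> subdiff U u (X n)" by metis
  obtain x r where x: "x \<in> K" "strict_mono r" "(X \<circ> r) \<longlonglongrightarrow> x"
    using assms(1) X(1) unfolding compact_def by metis
  have lim: "(\<lambda>n. u ((X \<circ> r) n)) \<longlonglongrightarrow> u x"
    using continuous_on_tendsto_compose[OF assms(3) x(3,1)] X(1) by auto
  have "p \<in> subdiff U u x" unfolding subdiff_def mem_Collect_eq
  proof
    fix y assume y: "y \<in> U"
    have "(\<lambda>n. u ((X \<circ> r) n) + (P \<circ> r) n \<bullet> (y - (X \<circ> r) n)) \<longlonglongrightarrow> u x + p \<bullet> (y - x)"
      by (intro tendsto_intros lim x(3) LIMSEQ_subseq_LIMSEQ[OF P(2) x(2)])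
    moreover have "\<And>n. u ((X \<circ> r) n) + (P \<circ> r) n \<bullet> (y - (X \<circ> r) n) \<le> u y"
      using X(2) y by (auto simp: subdiff_def)
    ultimately show "u x + p \<bullet> (y - x) \<le> u y" by (intro LIMSEQ_le_const2) auto
  qed
  then show "p \<in> subdiff_set U u K" unfolding subdiff_set_def using x(1) by auto
qed

text \<open>A step of length \<open>r\<close> from \<open>x\<close> in the direction of
  \<open>p\<close> raises the supporting plane by \<open>r * norm p\<close>, and the bound on
  \<open>u\<close> allows at most \<open>2 * M\<close>.\<close>

lemma norm_subdiff_le:
  assumes "p \<in> subdiff U u x" "r > 0" "cball x r \<subseteq> U" "\<And>y. y \<in> cball x r \<Longrightarrow> \<bar>u y\<bar> \<le> M"
  shows "norm p \<le> 2 * M / r"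
proof (cases "p = 0")
  case True
  have "0 \<le> M" using assms(4)[of x] assms(2) by auto
  then show ?thesis using True assms(2) by simp
next
  case False
  define y where "y = x + (r / norm p) *\<^sub>R p"
  have y: "y \<in> cball x r" using False assms(2) by (simp add: y_def dist_norm)
  have "u y \<ge> u x + p \<bullet> (y - x)" using assms(1,3) y by (auto simp: subdiff_def)
  moreover have "p \<bullet> (y - x) = r * norm p"
    using False by (simp add: y_def power2_norm_eq_inner[symmetric] power2_eq_square)
  moreover have "\<bar>u y\<bar> \<le> M" "\<bar>u x\<bar> \<le> M" using assms(2,4) y by auto
  ultimately have "r * norm p \<le> 2 * M" by linarith
  then show ?thesis using assms(2) by (simp add: field_simps)
qed

section \<open>Functions on a mesh\<close>

lemma affine_interpolation:
  fixes C :: "'a::euclidean_space set" and f :: "'a \<Rightarrow> real"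
  assumes "\<not> affine_dependent C" shows "\<exists>c b. \<forall>v\<in>C. c \<bullet> v + b = f v"
proof (cases "C = {}")
  case False
  then obtain v0 where v0: "v0 \<in> C" by blast
  define B where "B = (\<lambda>x. - v0 + x) ` (C - {v0})"
  have "independent B" using assms affine_dependent_iff_dependent2[OF v0] unfolding B_def by blast
  then obtain G where G: "linear G" "\<And>y. y \<in> B \<Longrightarrow> G y = f (v0 + y) - f v0"
    using linear_independent_extend[of B "\<lambda>y. f (v0 + y) - f v0"] by blast
  have Gc: "G x = adjoint G 1 \<bullet> x" for x
    using adjoint_works[OF G(1), of x 1] by (simp add: inner_commute)
  have "adjoint G 1 \<bullet> v + (f v0 - adjoint G 1 \<bullet> v0) = f v" if v: "v \<in> C" for v
  proof (cases "v = v0")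
    case False
    then have "- v0 + v \<in> B" using v unfolding B_def by blast
    then have "G (- v0 + v) = f v - f v0" using G(2) by fastforce
    then show ?thesis by (simp add: Gc inner_diff_right)
  qed simp
  then show ?thesis by blast
qed simp

locale mesh_over =
  fixes \<Omega> :: "'a::euclidean_space set" and \<T> :: "'a set set" and h :: real
  assumes open_\<Omega>: "open \<Omega>" and bounded_\<Omega>: "bounded \<Omega>" and convex_\<Omega>: "convex \<Omega>"
    and mesh: "is_mesh \<Omega> \<T> h"
begin

abbreviation "U \<equiv> mesh_domain \<T>"
abbreviation "MV \<equiv> mesh_vertices \<T>"

definition verts :: "'a set \<Rightarrow> 'a set" where "verts T = {v. v extreme_point_of T}"

lemma finite_mesh: "finite \<T>" and mesh_nonempty: "\<T> \<noteq> {}"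
  and simplex_T: "T \<in> \<T> \<Longrightarrow> (int DIM('a)) simplex T" and T_subset: "T \<in> \<T> \<Longrightarrow> T \<subseteq> closure \<Omega>"
  and face_T: "T \<in> \<T> \<Longrightarrow> T' \<in> \<T> \<Longrightarrow> T \<noteq> T' \<Longrightarrow> (T \<inter> T') face_of T \<and> (T \<inter> T') face_of T'"
  and h_eq: "h = Max (diameter ` \<T>)" and convex_U: "convex U"
  and bv_subset: "boundary_vertices \<T> \<subseteq> frontier \<Omega>" using mesh unfolding is_mesh_def by auto

lemma compact_T: "T \<in> \<T> \<Longrightarrow> compact T" and convex_T: "T \<in> \<T> \<Longrightarrow> convex T" and closed_T: "T \<in> \<T> \<Longrightarrow> closed T"
  using simplex_T compact_simplex convex_simplex closed_simplex by blast+

lemma verts_affine_independent: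
  assumes "T \<in> \<T>" shows "\<not> affine_dependent (verts T)" "T = convex hull (verts T)"
proof -
  obtain C where C: "\<not> affine_dependent C" "T = convex hull C"
    using simplex_T[OF assms] unfolding simplex_def by blast
  then have "verts T = C"
    unfolding verts_def using extreme_point_of_convex_hull_affine_independent by blast
  with C show "\<not> affine_dependent (verts T)" "T = convex hull (verts T)" by auto
qed

lemma finite_verts: "T \<in> \<T> \<Longrightarrow> finite (verts T)"
  using verts_affine_independent(1) aff_independent_finite by blast

lemma MV_eq: "MV = (\<Union>T\<in>\<T>. verts T)" by (simp add: mesh_vertices_def verts_def)

lemma finite_MV: "finite MV" using finite_mesh finite_verts by (auto simp: MV_eq)

lemma verts_subset: "verts T \<subseteq> T" by (auto simp: verts_def extreme_point_of_def)

lemma compact_Union: "compact (\<Union>\<T>)"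
  using finite_mesh simplex_T compact_simplex by (intro compact_Union) auto

lemma closure_interior_T: "T \<in> \<T> \<Longrightarrow> closure (interior T) = T"
  and interior_T_nonempty: "T \<in> \<T> \<Longrightarrow> interior T \<noteq> {}"
proof -
  assume T: "T \<in> \<T>"
  have c: "convex T" "closed T" using simplex_T[OF T] convex_simplex closed_simplex by blast+
  have "aff_dim T = int DIM('a)" using simplex_T[OF T] aff_dim_simplex by blast
  then show i: "interior T \<noteq> {}" using rel_interior_eq_empty[OF c(1)]
    by (auto simp: interior_rel_interior_gen)
  show "closure (interior T) = T" using convex_closure_interior[OF c(1) i] c(2) by simp
qed

lemma closure_U: "closure U = \<Union>\<T>"
proof
  show "closure U \<subseteq> \<Union>\<T>"
    using compact_Union by (simp add: mesh_domain_def closure_minimal interior_subset compact_imp_closed)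
  show "\<Union>\<T> \<subseteq> closure U"
  proof
    fix x assume "x \<in> \<Union>\<T>"
    then obtain T where T: "T \<in> \<T>" "x \<in> T" by blast
    have "interior T \<subseteq> U" using T by (auto simp: mesh_domain_def intro!: interior_mono)
    then have "closure (interior T) \<subseteq> closure U" by (rule closure_mono)
    then show "x \<in> closure U" using closure_interior_T T by auto
  qed
qed

lemma open_U: "open U" by (simp add: mesh_domain_def)

lemma U_nonempty: "U \<noteq> {}"
  proof -
  obtain T where T: "T \<in> \<T>" using mesh_nonempty by blast
  have "interior T \<subseteq> U" using T by (auto simp: mesh_domain_def intro!: interior_mono)
  then show ?thesis using interior_T_nonempty[OF T] by blast
qed

text \<open>The simplices lie only in the closure of \<Omega>; an open convex set is the interior of
  its closure.\<close>

lemma U_subset: "U \<subseteq> \<Omega>"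
proof -
  have "U \<subseteq> interior (closure \<Omega>)" unfolding mesh_domain_def using T_subset by (intro interior_mono) auto
  then show ?thesis using convex_interior_closure[OF convex_\<Omega>] open_\<Omega> by (simp add: interior_open)
qed

lemma bounded_U: "bounded U" using U_subset bounded_\<Omega> bounded_subset by blast

lemma compact_closure_U: "compact (closure U)" using closure_U compact_Union by simp

lemma closure_U_subset: "closure U \<subseteq> closure \<Omega>" using U_subset closure_mono by blast

lemma MV_subset: "MV \<subseteq> closure U" using verts_subset by (auto simp: MV_eq closure_U)

lemma MV_split: "MV = interior_vertices \<T> \<union> boundary_vertices \<T>"
  using MV_subset open_U by (auto simp: interior_vertices_def boundary_vertices_def frontier_def interior_open)

lemma vertex_not_boundary: "v \<in> MV \<Longrightarrow> v \<notin> U \<Longrightarrow> v \<in> boundary_vertices \<T>"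
  using MV_split unfolding interior_vertices_def by blast

text \<open>By Krein-Milman it suffices to treat extreme points of \<open>closure U\<close>. Such a
  point is extreme in any simplex containing it, hence a vertex, and it is not interior. Bounds by
  boundary data alone rest on this.\<close>

lemma hull_boundary_vertices: "closure U = convex hull (boundary_vertices \<T>)"
proof -
  have K: "closure U = convex hull {x. x extreme_point_of closure U}"
    using compact_closure_U convex_U by (intro Krein_Milman_Minkowski) (auto simp: convex_closure)
  have "{x. x extreme_point_of closure U} \<subseteq> boundary_vertices \<T>"
  proof clarify
    fix x assume x: "x extreme_point_of closure U"
    then have xc: "x \<in> closure U" by (simp add: extreme_point_of_def)
    then obtain T where T: "T \<in> \<T>" "x \<in> T" using closure_U by blast
    have "x extreme_point_of T" using x T closure_U unfolding extreme_point_of_def by blast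
    then have "x \<in> MV" using T by (auto simp: MV_eq verts_def)
    moreover have "x \<notin> interior (closure U)" using extreme_point_not_in_interior[OF x] .
    then have "x \<notin> U" using open_U closure_subset interior_maximal by blast
    ultimately show "x \<in> boundary_vertices \<T>" by (rule vertex_not_boundary)
  qed
  then have "closure U \<subseteq> convex hull (boundary_vertices \<T>)" using K hull_mono by metis
  moreover have "convex hull (boundary_vertices \<T>) \<subseteq> closure U"
    using MV_subset convex_U by (intro hull_minimal) (auto simp: MV_split convex_closure)
  ultimately show ?thesis by blast
qed

lemma dist_vertex_le:
  assumes "T \<in> \<T>" "x \<in> T" "v \<in> verts T" shows "dist x v \<le> h"
proof -
  have "bounded T" using simplex_T[OF assms(1)] compact_simplex compact_imp_bounded by blast
  then have "dist x v \<le> diameter T" using assms verts_subset by (intro diameter_bounded_bound) auto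
  also have "\<dots> \<le> h" unfolding h_eq using finite_mesh assms(1) by simp
  finally show ?thesis .
qed

text \<open>Affine interpolation on each simplex. Two interpolants agree on a common face because
  that face is the hull of its extreme points, which are vertices of both simplices.\<close>

lemma hat_exists: "\<exists>\<phi>. hat_function \<T> A \<phi>" if A: "A \<in> MV"
proof -
  define d where "d v = (if v = A then 1 else 0 :: real)" for v
  have "\<forall>T\<in>\<T>. \<exists>cb. \<forall>v\<in>verts T. fst cb \<bullet> v + snd cb = d v"
  proof
    fix T assume "T \<in> \<T>"
    from affine_interpolation[OF verts_affine_independent(1)[OF this], of d]
    obtain c b where "\<forall>v\<in>verts T. c \<bullet> v + b = d v" by blast
    then show "\<exists>cb. \<forall>v\<in>verts T. fst cb \<bullet> v + snd cb = d v" by (intro exI[of _ "(c, b)"]) simp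
  qed
  then obtain cb where cb: "\<And>T v. T \<in> \<T> \<Longrightarrow> v \<in> verts T \<Longrightarrow> fst (cb T) \<bullet> v + snd (cb T) = d v"
    unfolding bchoice_iff by blast
  define a where "a T x = fst (cb T) \<bullet> x + snd (cb T)" for T x
  have agree: "a T x = a T' x" if T: "T \<in> \<T>" "T' \<in> \<T>" "x \<in> T" "x \<in> T'" for T T' x
  proof (cases "T = T'")
    case False
    define F where "F = T \<inter> T'"
    have f: "F face_of T" "F face_of T'" using face_T[OF T(1,2) False] by (auto simp: F_def)
    have "compact F" "convex F"
      unfolding F_def using compact_T[OF T(1)] compact_T[OF T(2)] convex_T[OF T(1)] convex_T[OF T(2)]
      by (auto intro!: compact_Int convex_Int)
    then have "F = convex hull {v. v extreme_point_of F}" by (intro Krein_Milman_Minkowski) auto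
    also have "\<dots> \<subseteq> {y. (fst (cb T) - fst (cb T')) \<bullet> y = snd (cb T') - snd (cb T)}"
    proof (intro hull_minimal subsetI CollectI)
      fix v assume "v \<in> {v. v extreme_point_of F}"
      then have "v \<in> verts T" "v \<in> verts T'"
        using extreme_point_of_face[OF f(1)] extreme_point_of_face[OF f(2)] by (auto simp: verts_def)
      then show "(fst (cb T) - fst (cb T')) \<bullet> v = snd (cb T') - snd (cb T)"
        using cb[OF T(1)] cb[OF T(2)] by (fastforce simp: inner_diff_left)
    qed (simp add: convex_hyperplane)
    finally have "x \<in> {y. (fst (cb T) - fst (cb T')) \<bullet> y = snd (cb T') - snd (cb T)}"
      using T unfolding F_def by blast
    then show ?thesis by (simp add: a_def inner_diff_left)
  qed simp
  define \<phi> where "\<phi> x = a (SOME T. T \<in> \<T> \<and> x \<in> T) x" for x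
  have phi: "\<phi> x = a T x" if "T \<in> \<T>" "x \<in> T" for T x
    unfolding \<phi>_def using that someI[of "\<lambda>T. T \<in> \<T> \<and> x \<in> T" T] by (intro agree) auto
  have phiv: "\<phi> v = d v" if v: "v \<in> MV" for v
  proof -
    obtain T where "T \<in> \<T>" "v \<in> verts T" using v MV_eq by blast
    then show ?thesis using phi[of T v] cb verts_subset by (auto simp: a_def)
  qed
  have "continuous_on (\<Union>T\<in>\<T>. T) \<phi>"
  proof (rule continuous_on_closed_Union)
    fix T assume T: "T \<in> \<T>"
    show "closed T" using simplex_T[OF T] closed_simplex by blast
    show "continuous_on T \<phi>"
      using phi[OF T] by (subst continuous_on_cong[OF refl, of _ _ "a T"]) (auto simp: a_def intro!: continuous_intros)
  qed (rule finite_mesh)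
  moreover have "\<forall>T\<in>\<T>. \<exists>c b. \<forall>x\<in>T. \<phi> x = c \<bullet> x + b" using phi by (auto simp: a_def)
  ultimately have "hat_function \<T> A \<phi>" unfolding hat_function_def using phiv A by (auto simp: d_def)
  then show ?thesis by blast
qed

definition hat :: "'a \<Rightarrow> 'a \<Rightarrow> real" where "hat A = (SOME \<phi>. hat_function \<T> A \<phi>)"

lemma hat_function_hat: "A \<in> MV \<Longrightarrow> hat_function \<T> A (hat A)"
  unfolding hat_def using hat_exists by (rule someI_ex)

lemma hat_vertex: "A \<in> MV \<Longrightarrow> v \<in> MV \<Longrightarrow> hat A v = (if v = A then 1 else 0)"
  using hat_function_hat[of A] by (auto simp: hat_function_def)

text \<open>An affine function commutes with barycentric combinations, so \<open>hat A x\<close> is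
  the barycentric coordinate of \<open>x\<close> that belongs to \<open>A\<close>.\<close>

lemma hat_sum:
  assumes T: "T \<in> \<T>" and S: "S \<subseteq> MV"
    and l: "sum l (verts T) = 1" "(\<Sum>v\<in>verts T. l v *\<^sub>R v) = x" "x \<in> T"
  shows "(\<Sum>A\<in>S. hat A x) = sum l (verts T \<inter> S)"
proof -
  have vM: "verts T \<subseteq> MV" using T MV_eq by blast
  have fS: "finite S" using S finite_MV finite_subset by blast
  have one: "hat A x = (if A \<in> verts T then l A else 0)" if A: "A \<in> S" for A
  proof -
    have "hat_function \<T> A (hat A)" by (rule hat_function_hat[OF subsetD[OF S A]])
    then have "\<forall>T\<in>\<T>. \<exists>c b. \<forall>x\<in>T. hat A x = c \<bullet> x + b" unfolding hat_function_def by (elim conjE)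
    from bspec[OF this T] obtain c b where cb: "\<And>y. y \<in> T \<Longrightarrow> hat A y = c \<bullet> y + b" by blast
    have "hat A x = c \<bullet> (\<Sum>v\<in>verts T. l v *\<^sub>R v) + b * sum l (verts T)" using cb l by simp
    also have "\<dots> = (\<Sum>v\<in>verts T. l v * (c \<bullet> v + b))"
      by (simp add: inner_sum_right sum_distrib_left sum.distrib algebra_simps)
    also have "\<dots> = (\<Sum>v\<in>verts T. l v * hat A v)" using cb verts_subset by (intro sum.cong) (auto simp: subset_iff)
    also have "\<dots> = (\<Sum>v\<in>verts T. if v = A then l v else 0)"
      using A S vM by (intro sum.cong) (auto simp: hat_vertex subset_iff)
    also have "\<dots> = (if A \<in> verts T then l A else 0)" using finite_verts[OF T] by simp
    finally show ?thesis .
  qed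
  have "(\<Sum>A\<in>S. hat A x) = (\<Sum>A\<in>S. if A \<in> verts T then l A else 0)" using one by (intro sum.cong) auto
  also have "\<dots> = sum l (verts T \<inter> S)" using fS by (simp add: sum.inter_restrict Int_commute)
  finally show ?thesis .
qed

text \<open>All that is used of the mesh from here on: sums of hats at \<open>x\<close> are partial
  sums of a probability weight on vertices within \<open>h\<close> of \<open>x\<close>. Hence they
  lie between 0 and 1, are 1 if all near vertices take part and 0 if none does.\<close>

lemma barycentric_coordinates:
  assumes x: "x \<in> \<Union>\<T>"
  obtains V l where "finite V" "V \<subseteq> MV" "\<And>v. v \<in> V \<Longrightarrow> 0 \<le> l v" "sum l V = 1" "\<And>v. v \<in> V \<Longrightarrow> dist x v \<le> h"
    "\<And>S. S \<subseteq> MV \<Longrightarrow> (\<Sum>A\<in>S. hat A x) = sum l (V \<inter> S)"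
proof -
  obtain T where T: "T \<in> \<T>" "x \<in> T" using x by blast
  have "x \<in> convex hull (verts T)" using verts_affine_independent(2)[OF T(1)] T(2) by simp
  then obtain l where l: "\<forall>v\<in>verts T. 0 \<le> l v" "sum l (verts T) = 1" "(\<Sum>v\<in>verts T. l v *\<^sub>R v) = x"
    unfolding convex_hull_finite[OF finite_verts[OF T(1)]] by blast
  show ?thesis by (rule that[of "verts T" l])
      (use l T finite_verts dist_vertex_le[OF T] hat_sum[OF T(1) _ l(2,3) T(2)] in \<open>auto simp: MV_eq\<close>)
qed

lemma hat_sum_le_1:
  assumes "x \<in> \<Union>\<T>" "S \<subseteq> MV" shows "(\<Sum>A\<in>S. hat A x) \<le> 1" "0 \<le> (\<Sum>A\<in>S. hat A x)"
proof -
  obtain V l where l: "finite V" "\<And>v. v \<in> V \<Longrightarrow> 0 \<le> l v" "sum l V = 1" "(\<Sum>A\<in>S. hat A x) = sum l (V \<inter> S)"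
    using barycentric_coordinates[OF assms(1)] assms(2) by metis
  have "sum l (V \<inter> S) \<le> sum l V" using l by (intro sum_mono2) auto
  then show "(\<Sum>A\<in>S. hat A x) \<le> 1" "0 \<le> (\<Sum>A\<in>S. hat A x)" using l by (auto intro!: sum_nonneg)
qed

lemma hat_nonneg: "x \<in> \<Union>\<T> \<Longrightarrow> A \<in> MV \<Longrightarrow> 0 \<le> hat A x" using hat_sum_le_1(2)[of x "{A}"] by simp

lemma hat_sum_eq_1:
  assumes "x \<in> \<Union>\<T>" "S \<subseteq> MV" "\<And>v. v \<in> MV \<Longrightarrow> dist x v \<le> h \<Longrightarrow> v \<in> S" shows "(\<Sum>A\<in>S. hat A x) = 1"
proof -
  obtain V l where l: "V \<subseteq> MV" "sum l V = 1" "\<And>v. v \<in> V \<Longrightarrow> dist x v \<le> h" "(\<Sum>A\<in>S. hat A x) = sum l (V \<inter> S)"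
    using barycentric_coordinates[OF assms(1)] assms(2) by metis
  have "V \<inter> S = V" using assms(3) l by blast
  then show ?thesis using l by simp
qed

lemma hat_sum_eq_0:
  assumes "x \<in> \<Union>\<T>" "S \<subseteq> MV" "\<And>v. v \<in> S \<Longrightarrow> \<not> dist x v \<le> h" shows "(\<Sum>A\<in>S. hat A x) = 0"
proof -
  obtain V l where l: "\<And>v. v \<in> V \<Longrightarrow> dist x v \<le> h" "(\<Sum>A\<in>S. hat A x) = sum l (V \<inter> S)"
    using barycentric_coordinates[OF assms(1)] assms(2) by metis
  have "V \<inter> S = {}" using assms(3) l by blast
  then show ?thesis using l by simp
qed

section \<open>Functions of \<open>H_space\<close> as lower boundaries of lifted hulls\<close>

definition lift_hull :: "('a \<Rightarrow> real) \<Rightarrow> ('a \<times> real) set" where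
  "lift_hull \<zeta> = convex hull ((\<lambda>w. (w, \<zeta> w)) ` MV)"

text \<open>\<open>\<zeta>\<close> merges the free interior values with the boundary data. The
  infimum defining the envelope is attained, since the fibre of the hull over \<open>x\<close> is
  compact and, as \<open>MV\<close> spans \<open>closure U\<close>, nonempty.\<close>

lemma H_space_hull:
  assumes "v \<in> H_space \<T> g"
  obtains \<zeta> where "\<And>b. b \<in> boundary_vertices \<T> \<Longrightarrow> \<zeta> b = g b"
    "\<And>x. x \<in> closure U \<Longrightarrow> (x, v x) \<in> lift_hull \<zeta>" "\<And>x t. x \<in> closure U \<Longrightarrow> (x, t) \<in> lift_hull \<zeta> \<Longrightarrow> v x \<le> t"
proof -
  obtain z where z: "\<And>x. x \<in> closure U \<Longrightarrow> v x = lower_env \<T> g z x" using assms unfolding H_space_def by blast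
  define \<zeta> where "\<zeta> w = (if w \<in> U then z w else g w)" for w
  have bv: "\<zeta> b = g b" if "b \<in> boundary_vertices \<T>" for b
    using that open_U by (auto simp: \<zeta>_def boundary_vertices_def frontier_def interior_open)
  define S where "S x = {t. (x, t) \<in> lift_hull \<zeta>}" for x
  have "(\<lambda>a. (a, z a)) ` interior_vertices \<T> = (\<lambda>w. (w, \<zeta> w)) ` interior_vertices \<T>"
    by (intro image_cong) (auto simp: \<zeta>_def interior_vertices_def)
  moreover have "(\<lambda>a. (a, g a)) ` boundary_vertices \<T> = (\<lambda>w. (w, \<zeta> w)) ` boundary_vertices \<T>"
    using bv by (intro image_cong) auto
  ultimately have vS: "v x = Inf (S x)" if "x \<in> closure U" for x
    unfolding z[OF that] lower_env_def S_def lift_hull_def MV_split image_Un by simp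
  have cS: "compact (S x)" for x
  proof -
    have "compact (lift_hull \<zeta> \<inter> ({x} \<times> UNIV))" unfolding lift_hull_def using finite_MV
      by (intro compact_Int_closed compact_convex_hull finite_imp_compact closed_Times) auto
    then have "compact (snd ` (lift_hull \<zeta> \<inter> ({x} \<times> UNIV)))"
      by (intro compact_continuous_image continuous_intros) auto
    moreover have "snd ` (lift_hull \<zeta> \<inter> ({x} \<times> UNIV)) = S x" by (force simp: S_def)
    ultimately show ?thesis by simp
  qed
  have "fst ` lift_hull \<zeta> = convex hull MV"
    unfolding lift_hull_def convex_hull_linear_image[OF linear_fst] by (simp add: image_image)
  then have "closure U \<subseteq> fst ` lift_hull \<zeta>"
    unfolding hull_boundary_vertices MV_split by (simp add: hull_mono)
  then have "x \<in> fst ` lift_hull \<zeta>" if "x \<in> closure U" for x using that by blast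
  then have neS: "S x \<noteq> {}" if "x \<in> closure U" for x using that unfolding S_def by force
  have bb: "bdd_below (S x)" for x by (rule bounded_imp_bdd_below[OF compact_imp_bounded[OF cS]])
  have "(x, v x) \<in> lift_hull \<zeta>" if "x \<in> closure U" for x
    using closed_contains_Inf[OF neS[OF that] bb compact_imp_closed[OF cS]] vS[OF that] by (simp add: S_def)
  moreover have "v x \<le> t" if "x \<in> closure U" "(x, t) \<in> lift_hull \<zeta>" for x t
    unfolding vS[OF that(1)] using that(2) bb by (intro cInf_lower) (simp add: S_def)
  ultimately show ?thesis using that bv by blast
qed

text \<open>Over each point of \<open>closure U\<close> there is a point of the hull of the lifted
  boundary vertices alone, and that hull lies below the affine function. Values at interior vertices
  can only lower the envelope.\<close>

lemma H_space_le_affine: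
  assumes "v \<in> H_space \<T> g" "x \<in> closure U" "\<And>b. b \<in> boundary_vertices \<T> \<Longrightarrow> g b \<le> c \<bullet> b + a"
  shows "v x \<le> c \<bullet> x + a"
proof -
  obtain \<zeta> where Z: "\<And>b. b \<in> boundary_vertices \<T> \<Longrightarrow> \<zeta> b = g b" "\<And>t. (x, t) \<in> lift_hull \<zeta> \<Longrightarrow> v x \<le> t"
    using H_space_hull[OF assms(1)] assms(2) by metis
  let ?L = "convex hull ((\<lambda>w. (w, \<zeta> w)) ` boundary_vertices \<T>)"
  have "fst ` ?L = closure U"
    unfolding hull_boundary_vertices convex_hull_linear_image[OF linear_fst] by (simp add: image_image)
  then obtain t where t: "(x, t) \<in> ?L" using assms(2) by force
  have "?L \<subseteq> {z. (- c, 1) \<bullet> z \<le> a}"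
    using Z(1) assms(3) by (intro hull_minimal convex_halfspace_le) (auto simp: inner_prod_def diff_le_eq add.commute)
  then have "t \<le> c \<bullet> x + a" using t by (auto simp: inner_prod_def)
  moreover have "?L \<subseteq> lift_hull \<zeta>" unfolding lift_hull_def MV_split by (intro hull_mono) auto
  ultimately show ?thesis using Z(2) t by force
qed

text \<open>Adding a large multiple of a function supporting \<open>U\<close> at \<open>x\<close> makes the affine bound hold at the interior vertices too.\<close>

lemma H_space_ge_affine_frontier:
  assumes "v \<in> H_space \<T> g" "x \<in> frontier U" "\<And>b. b \<in> boundary_vertices \<T> \<Longrightarrow> g b \<ge> c \<bullet> b + a"
  shows "v x \<ge> c \<bullet> x + a"
proof -
  have xc: "x \<in> closure U" "x \<notin> U" using assms(2) open_U by (auto simp: frontier_def interior_open)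
  obtain \<zeta> where Z: "\<And>b. b \<in> boundary_vertices \<T> \<Longrightarrow> \<zeta> b = g b" "(x, v x) \<in> lift_hull \<zeta>"
    using H_space_hull[OF assms(1)] xc(1) by metis
  have "U \<inter> {x} = {}" using xc by auto
  then obtain p b where p: "p \<noteq> 0" "\<And>y. y \<in> U \<Longrightarrow> p \<bullet> y \<le> b" "p \<bullet> x \<ge> b"
    using separating_hyperplane_sets[of U "{x}"] convex_U U_nonempty by auto
  have pc: "p \<bullet> y \<le> b" if "y \<in> closure U" for y
  proof -
    have "closure U \<subseteq> {y. p \<bullet> y \<le> b}" using p(2) by (intro closure_minimal) (auto simp: closed_halfspace_le)
    then show ?thesis using that by blast
  qed
  have pU: "p \<bullet> y < b" if y: "y \<in> U" for y
  proof (rule ccontr)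
    assume n: "\<not> p \<bullet> y < b"
    obtain e where e: "e > 0" "cball y e \<subseteq> U" using y open_U open_contains_cball by blast
    have "y + (e / norm p) *\<^sub>R p \<in> U" using e p(1) by (intro subsetD[OF e(2)]) (auto simp: dist_norm)
    then have "p \<bullet> y + e * norm p \<le> b"
      using p(1,2) by (fastforce simp: inner_add_right power2_norm_eq_inner[symmetric] power2_eq_square)
    moreover have "e * norm p > 0" using e p by simp
    ultimately show False using n by simp
  qed
  \<comment> \<open>Multiple of the supporting function that suffices at the vertex
    \<open>w\<close>; the sum of these finitely many nonnegative numbers suffices at all interior
    vertices.\<close>
  define r where "r w = \<bar>c \<bullet> w + a - \<zeta> w\<bar> / (b - p \<bullet> w)" for w
  define N where "N = sum r (MV \<inter> U)"
  have r0: "0 \<le> r w" if "w \<in> MV \<inter> U" for w using pU that by (simp add: r_def less_imp_le)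
  have N0: "0 \<le> N" unfolding N_def by (rule sum_nonneg[OF r0])
  have above: "c \<bullet> w + a + N * (p \<bullet> w - b) \<le> \<zeta> w" if w: "w \<in> MV" for w
  proof (cases "w \<in> U")
    case True
    then have "r w \<le> N" unfolding N_def using w finite_MV r0 by (intro member_le_sum) auto
    then have "r w * (b - p \<bullet> w) \<le> N * (b - p \<bullet> w)" using pU[OF True] by (intro mult_right_mono) auto
    moreover have "r w * (b - p \<bullet> w) = \<bar>c \<bullet> w + a - \<zeta> w\<bar>" using pU[OF True] by (simp add: r_def)
    ultimately show ?thesis by (simp add: right_diff_distrib)
  next
    case False
    then have "w \<in> boundary_vertices \<T>" using w vertex_not_boundary by blast
    moreover have "N * (p \<bullet> w - b) \<le> 0" using N0 pc MV_subset w by (intro mult_nonneg_nonpos) auto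
    ultimately show ?thesis using Z(1) assms(3) by force
  qed
  have "lift_hull \<zeta> \<subseteq> {z. (- (c + N *\<^sub>R p), 1) \<bullet> z \<ge> a - N * b}" unfolding lift_hull_def using above
    by (intro hull_minimal convex_halfspace_ge) (auto simp: inner_prod_def inner_diff_left algebra_simps)
  then have "a - N * b \<le> v x - c \<bullet> x - N * (p \<bullet> x)"
    using Z(2) by (auto simp: inner_prod_def inner_diff_left)
  moreover have "N * b \<le> N * (p \<bullet> x)" using p(3) N0 by (rule mult_left_mono)
  ultimately show ?thesis by simp
qed

lemma subdiff_closure:
  assumes "continuous_on (closure U) v" "p \<in> subdiff U v x" "y \<in> closure U"
  shows "v y \<ge> v x + p \<bullet> (y - x)"
proof -
  have "v x + p \<bullet> (y - x) - v y \<le> 0"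
  proof (rule continuous_le_on_closure[where f="\<lambda>y. v x + p \<bullet> (y - x) - v y" and S=U])
    show "continuous_on (closure U) (\<lambda>y. v x + p \<bullet> (y - x) - v y)"
      using assms(1) by (intro continuous_intros)
    show "y \<in> closure U" by fact
    show "v x + p \<bullet> (y - x) - v y \<le> 0" if "y \<in> U" for y using that assms(2) by (auto simp: subdiff_def)
  qed
  then show ?thesis by simp
qed

text \<open>The supporting plane at \<open>x\<close> passes through some lifted vertex, since
  otherwise the whole lifted hull, and with it the point over \<open>x\<close>, would lie strictly
  above it. The plane then touches the graph along the segment from \<open>x\<close> to that
  vertex.\<close>

lemma subdiff_vertex_or_overlap:
  assumes v: "v \<in> H_space \<T> g" and x: "x \<in> U" and p: "p \<in> subdiff U v x" and nv: "x \<notin> MV"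
  shows "p \<in> overlap U v"
proof -
  have cont: "continuous_on (closure U) v" using v unfolding H_space_def by blast
  have xc: "x \<in> closure U" using x closure_subset by blast
  obtain \<zeta> where Z: "(x, v x) \<in> lift_hull \<zeta>" "\<And>x t. x \<in> closure U \<Longrightarrow> (x, t) \<in> lift_hull \<zeta> \<Longrightarrow> v x \<le> t"
    using H_space_hull[OF v] xc by metis
  have vert: "(w, \<zeta> w) \<in> lift_hull \<zeta>" if "w \<in> MV" for w using that unfolding lift_hull_def by (intro hull_inc) auto
  have ge: "v x + p \<bullet> (w - x) \<le> \<zeta> w" if w: "w \<in> MV" for w
    using subdiff_closure[OF cont p, of w] Z(2)[OF _ vert[OF w]] MV_subset w by force
  have "\<exists>w\<in>MV. \<zeta> w = v x + p \<bullet> (w - x)"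
  proof (rule ccontr)
    assume "\<not> (\<exists>w\<in>MV. \<zeta> w = v x + p \<bullet> (w - x))"
    then have "\<And>w. w \<in> MV \<Longrightarrow> v x + p \<bullet> (w - x) < \<zeta> w" using ge by (auto simp: less_le)
    then have "lift_hull \<zeta> \<subseteq> {z. (- p, 1) \<bullet> z > v x - p \<bullet> x}"
      unfolding lift_hull_def by (intro hull_minimal convex_halfspace_gt) (auto simp: inner_prod_def inner_diff_right algebra_simps)
    then show False using Z(1) by (auto simp: inner_prod_def)
  qed
  then obtain w where w: "w \<in> MV" "\<zeta> w = v x + p \<bullet> (w - x)" by blast
  obtain e where e: "e > 0" "ball x e \<subseteq> U" using x open_U open_contains_ball by blast
  have "w \<noteq> x" using w nv by auto
  \<comment> \<open>The vertex \<open>w\<close> may lie on the boundary, whereas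
    \<open>overlap\<close> asks for contact points in \<open>U\<close>: a point of the segment close
    to \<open>x\<close> serves as the second one.\<close>
  define s where "s = min 1 (e / (2 * norm (w - x)))"
  have s: "0 < s" "s \<le> 1" using e \<open>w \<noteq> x\<close> by (auto simp: s_def)
  define y where "y = x + s *\<^sub>R (w - x)"
  have "s * norm (w - x) \<le> (e / (2 * norm (w - x))) * norm (w - x)"
    unfolding s_def by (intro mult_right_mono) auto
  also have "\<dots> < e" using e \<open>w \<noteq> x\<close> by simp
  finally have yU: "y \<in> U" using s by (intro subsetD[OF e(2)]) (auto simp: y_def dist_norm)
  have "(1 - s) *\<^sub>R (x, v x) + s *\<^sub>R (w, \<zeta> w) \<in> lift_hull \<zeta>"
    using Z(1) vert[OF w(1)] s unfolding lift_hull_def by (intro convexD_alt[OF convex_convex_hull]) auto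
  moreover have "(1 - s) *\<^sub>R (x, v x) + s *\<^sub>R (w, \<zeta> w) = (y, v x + p \<bullet> (y - x))"
    unfolding w(2) by (simp add: y_def algebra_simps)
  ultimately have vy: "v y \<le> v x + p \<bullet> (y - x)" using Z(2)[of y] yU closure_subset by auto
  have "p \<in> subdiff U v y" unfolding subdiff_def
  proof (intro CollectI ballI)
    fix z assume "z \<in> U"
    then have "v z \<ge> v x + p \<bullet> (z - x)" using p by (auto simp: subdiff_def)
    then show "v y + p \<bullet> (z - y) \<le> v z" using vy by (simp add: inner_diff_right)
  qed
  moreover have "y \<noteq> x" using s \<open>w \<noteq> x\<close> by (simp add: y_def)
  ultimately show ?thesis unfolding overlap_def using x yU p by blast
qed

section \<open>Mass equations of finite element solutions\<close>

lemma hat_measurable: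
  assumes "sets \<mu> = sets (restrict_space borel \<Omega>)" "A \<in> MV"
  shows "(\<lambda>x. ennreal (hat A x) * indicator U x) \<in> borel_measurable \<mu>"
proof -
  have cont: "continuous_on U (hat A)"
    using hat_function_hat[OF assms(2)] closure_U closure_subset[of U]
    unfolding hat_function_def by (metis continuous_on_subset)
  have "(\<lambda>x. indicator U x *\<^sub>R hat A x) \<in> borel_measurable borel"
    using cont open_U by (intro borel_measurable_continuous_on_indicator) auto
  then have "(\<lambda>x. ennreal (indicator U x *\<^sub>R hat A x)) \<in> borel_measurable (restrict_space borel \<Omega>)"
    by (intro measurable_restrict_space1 measurable_compose[OF _ measurable_ennreal])
  moreover have "(\<lambda>x. ennreal (indicator U x *\<^sub>R hat A x)) = (\<lambda>x. ennreal (hat A x) * indicator U x)"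
    by (auto simp: indicator_def)
  ultimately show ?thesis unfolding measurable_cong_sets[OF assms(1) refl] by (simp only:)
qed

lemma fe_solution_vertex_sum:
  assumes "sets \<mu> = sets (restrict_space borel \<Omega>)" "fe_solution \<T> R \<mu> g v" "S \<subseteq> interior_vertices \<T>"
  shows "(\<Sum>A\<in>S. R_measure R (subdiff U v A)) = (\<integral>\<^sup>+ x. ennreal (\<Sum>A\<in>S. hat A x) * indicator U x \<partial>\<mu>)"
proof -
  have SM: "S \<subseteq> MV" using assms(3) MV_split by blast
  have "(\<Sum>A\<in>S. R_measure R (subdiff U v A)) = (\<Sum>A\<in>S. \<integral>\<^sup>+ x. ennreal (hat A x) * indicator U x \<partial>\<mu>)"
  proof (rule sum.cong[OF refl])
    fix A assume "A \<in> S"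
    then have "A \<in> interior_vertices \<T>" "hat_function \<T> A (hat A)" using assms(3) SM hat_function_hat by auto
    then show "R_measure R (subdiff U v A) = (\<integral>\<^sup>+ x. ennreal (hat A x) * indicator U x \<partial>\<mu>)"
      using assms(2) unfolding fe_solution_def by blast
  qed
  also have "\<dots> = (\<integral>\<^sup>+ x. (\<Sum>A\<in>S. ennreal (hat A x) * indicator U x) \<partial>\<mu>)"
    using SM by (intro nn_integral_sum[symmetric] hat_measurable assms(1)) auto
  also have "\<dots> = (\<integral>\<^sup>+ x. ennreal (\<Sum>A\<in>S. hat A x) * indicator U x \<partial>\<mu>)"
  proof (rule nn_integral_cong)
    fix x
    show "(\<Sum>A\<in>S. ennreal (hat A x) * indicator U x) = ennreal (\<Sum>A\<in>S. hat A x) * indicator U x"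
    proof (cases "x \<in> U")
      case True
      then have "x \<in> \<Union>\<T>" using closure_U closure_subset by blast
      then have "\<And>A. A \<in> S \<Longrightarrow> 0 \<le> hat A x" using SM hat_nonneg by blast
      then show ?thesis using True by (simp add: sum_ennreal)
    qed simp
  qed
  finally show ?thesis .
qed

text \<open>Up to \<open>overlap\<close>, slopes attained in \<open>E\<close> are attained at the
  finitely many interior vertices in \<open>E\<close>. By the mass equations these carry at most the
  integral of the sum of their hats, which is at most 1 and vanishes farther than \<open>h\<close>
  from \<open>E\<close>. The closed set \<open>P\<close> avoids the question whether
  \<open>subdiff_set U v E\<close> is measurable.\<close>

lemma R_measure_subdiff_set_le:
  assumes mu: "sets \<mu> = sets (restrict_space borel \<Omega>)" and v: "fe_solution \<T> R \<mu> g v"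
    and R: "R \<in> borel_measurable lebesgue"
    and F: "F \<in> sets \<mu>" "\<And>x y. x \<in> U \<Longrightarrow> y \<in> E \<Longrightarrow> dist x y \<le> h \<Longrightarrow> x \<in> F"
    and E: "E \<subseteq> U"
  obtains P where "closed P" "\<And>p. p \<in> subdiff_set U v E \<Longrightarrow> p \<in> P \<or> p \<in> overlap U v" "R_measure R P \<le> emeasure \<mu> F"
proof -
  define S where "S = interior_vertices \<T> \<inter> E"
  have fS: "finite S" using finite_MV MV_split by (auto simp: S_def)
  have SM: "S \<subseteq> MV" by (auto simp: S_def MV_split)
  define P where "P = (\<Union>A\<in>S. subdiff U v A)"
  have "closed P" unfolding P_def using fS closed_subdiff by (intro closed_UN) auto
  moreover have "p \<in> P \<or> p \<in> overlap U v" if p: "p \<in> subdiff_set U v E" for p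
  proof -
    obtain x where x: "x \<in> E" "p \<in> subdiff U v x" using p unfolding subdiff_set_def by blast
    show ?thesis
    proof (cases "x \<in> MV")
      case True
      then have "x \<in> S" using x E by (auto simp: S_def interior_vertices_def)
      then show ?thesis using x unfolding P_def by blast
    next
      case False
      have "v \<in> H_space \<T> g" using v unfolding fe_solution_def by blast
      then show ?thesis using subdiff_vertex_or_overlap[OF _ _ x(2) False] x E by blast
    qed
  qed
  moreover have "R_measure R P \<le> emeasure \<mu> F"
  proof -
    have "R_measure R P \<le> (\<Sum>A\<in>S. R_measure R (subdiff U v A))"
      unfolding P_def using fS by (intro R_measure_UN_le[OF R] subdiff_lebesgue)
    also have "\<dots> = (\<integral>\<^sup>+ x. ennreal (\<Sum>A\<in>S. hat A x) * indicator U x \<partial>\<mu>)"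
      by (rule fe_solution_vertex_sum[OF mu v]) (simp add: S_def)
    also have "\<dots> \<le> (\<integral>\<^sup>+ x. indicator F x \<partial>\<mu>)"
    proof (rule nn_integral_mono)
      fix x
      show "ennreal (\<Sum>A\<in>S. hat A x) * indicator U x \<le> indicator F x"
      proof (cases "x \<in> U")
        case True
        then have xT: "x \<in> \<Union>\<T>" using closure_U closure_subset by blast
        show ?thesis
        proof (cases "x \<in> F")
          case True
          then show ?thesis using hat_sum_le_1(1)[OF xT SM] \<open>x \<in> U\<close>
            by (simp add: ennreal_le_1)
        next
          case False
          then have "(\<Sum>A\<in>S. hat A x) = 0"
            using F(2)[OF \<open>x \<in> U\<close>] by (intro hat_sum_eq_0[OF xT SM]) (auto simp: S_def)
          then show ?thesis by simp
        qed
      qed simp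
    qed
    also have "\<dots> = emeasure \<mu> F" using F(1) by simp
    finally show ?thesis .
  qed
  ultimately show ?thesis using that by blast
qed

text \<open>The hats at vertices in \<open>E\<close> sum to 1 on \<open>K\<close>, because every
  vertex within \<open>h\<close> of \<open>K\<close> lies in \<open>E\<close>. Subdifferentials at
  distinct vertices meet only in \<open>overlap\<close>, so the masses of the vertices add up to the
  mass of a union.\<close>

lemma R_measure_subdiff_vertices_ge:
  assumes mu: "sets \<mu> = sets (restrict_space borel \<Omega>)" and v: "fe_solution \<T> R \<mu> g v"
    and R: "R \<in> borel_measurable lebesgue"
    and K: "K \<in> sets \<mu>" "K \<subseteq> U" "\<And>x y. x \<in> K \<Longrightarrow> dist x y \<le> h \<Longrightarrow> y \<in> E" and E: "E \<subseteq> U"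
  shows "\<exists>P. closed P \<and> P \<subseteq> subdiff_set U v E \<and> emeasure \<mu> K \<le> R_measure R P"
proof -
  define S where "S = interior_vertices \<T> \<inter> E"
  have fS: "finite S" using finite_MV MV_split by (auto simp: S_def)
  have SM: "S \<subseteq> MV" by (auto simp: S_def MV_split)
  define P where "P = (\<Union>A\<in>S. subdiff U v A)"
  have oN: "negligible (overlap U v)" using bounded_U by (rule negligible_overlap)
  then have oL: "overlap U v \<in> sets lebesgue" by (rule negligible_imp_sets)
  have "emeasure \<mu> K = (\<integral>\<^sup>+ x. indicator K x \<partial>\<mu>)" using K(1) by simp
  also have "\<dots> \<le> (\<integral>\<^sup>+ x. ennreal (\<Sum>A\<in>S. hat A x) * indicator U x \<partial>\<mu>)"
  proof (rule nn_integral_mono)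
    fix x
    show "indicator K x \<le> ennreal (\<Sum>A\<in>S. hat A x) * indicator U x"
    proof (cases "x \<in> K")
      case True
      then have xU: "x \<in> U" "x \<in> \<Union>\<T>" using K(2) closure_U closure_subset by blast+
      have "(\<Sum>A\<in>S. hat A x) = 1"
      proof (rule hat_sum_eq_1[OF xU(2) SM])
        fix w assume "w \<in> MV" "dist x w \<le> h"
        then show "w \<in> S" using K(3)[OF True] E by (auto simp: S_def interior_vertices_def)
      qed
      then show ?thesis using xU True by simp
    qed simp
  qed
  also have "\<dots> = (\<Sum>A\<in>S. R_measure R (subdiff U v A))"
    by (rule fe_solution_vertex_sum[OF mu v, symmetric]) (simp add: S_def)
  also have "\<dots> = (\<Sum>A\<in>S. R_measure R (subdiff U v A - overlap U v))"
  proof (rule sum.cong[OF refl])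
    fix A
    have "R_measure R (subdiff U v A) \<le> R_measure R ((subdiff U v A - overlap U v) \<union> overlap U v)"
      by (intro R_measure_mono) auto
    also have "\<dots> = R_measure R (subdiff U v A - overlap U v)" by (rule R_measure_Un_negligible[OF oN])
    finally show "R_measure R (subdiff U v A) = R_measure R (subdiff U v A - overlap U v)"
      by (rule antisym) (intro R_measure_mono Diff_subset)
  qed
  also have "\<dots> = R_measure R (\<Union>A\<in>S. subdiff U v A - overlap U v)"
  proof (rule R_measure_disjoint_UN[OF R fS, symmetric])
    show "subdiff U v A - overlap U v \<in> sets lebesgue" for A
      using oL by (intro sets.Diff subdiff_lebesgue)
    show "disjoint_family_on (\<lambda>A. subdiff U v A - overlap U v) S"
      using E unfolding disjoint_family_on_def overlap_def S_def by blast
  qed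
  also have "\<dots> \<le> R_measure R P" by (intro R_measure_mono) (auto simp: P_def)
  finally have "emeasure \<mu> K \<le> R_measure R P" .
  moreover have "closed P" unfolding P_def using fS closed_subdiff by (intro closed_UN) auto
  moreover have "P \<subseteq> subdiff_set U v E" unfolding P_def S_def subdiff_set_def by blast
  ultimately show ?thesis by blast
qed

end

section \<open>Stability of contact points; recovering the measure of Borel sets\<close>

lemma convex_on_minus_linear:
  assumes "convex_on S v" shows "convex_on S (\<lambda>y. v y - p \<bullet> y)"
proof -
  have "convex_on S (\<lambda>y. - (p \<bullet> y))"
    using convex_on_imp_convex[OF assms] by (auto simp: convex_on_def inner_add_right)
  from convex_on_add[OF assms this] show ?thesis by simp
qed

lemma interior_minimum_subdiff:
  assumes "convex_on U v" "ball x r \<subseteq> U" "y \<in> ball x r"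
    and "\<And>z. z \<in> ball x r \<Longrightarrow> v y - p \<bullet> y \<le> v z - p \<bullet> z" shows "p \<in> subdiff U v y"
proof -
  have sub: "ball y (r - dist x y) \<subseteq> ball x r"
  proof
    fix z assume "z \<in> ball y (r - dist x y)"
    then show "z \<in> ball x r" using dist_triangle[of x z y] by (simp add: dist_commute)
  qed
  have "\<forall>z\<in>U. v y - p \<bullet> y \<le> v z - p \<bullet> z"
  proof (rule convex_local_global_minimum)
    show "r - dist x y > 0" using assms(3) by simp
    show "convex_on U (\<lambda>y. v y - p \<bullet> y)" by (rule convex_on_minus_linear[OF assms(1)])
    show "ball y (r - dist x y) \<subseteq> U" using sub assms(2) by blast
    show "\<forall>z\<in>ball y (r - dist x y). v y - p \<bullet> y \<le> v z - p \<bullet> z" using sub assms(4) by blast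
  qed
  then show ?thesis by (auto simp: subdiff_def inner_diff_right algebra_simps)
qed

text \<open>As \<open>p\<close> is outside \<open>overlap\<close>, the plane stays below
  \<open>u\<close> on the sphere by some margin \<open>c\<close>. Errors below \<open>c / 3\<close>
  at the centre and at the sphere cannot move the minimum of \<open>v j\<close> minus the linear
  function onto the sphere, and by convexity an interior minimum is global.\<close>

lemma contact_stable:
  fixes u :: "'a::euclidean_space \<Rightarrow> real" and v :: "nat \<Rightarrow> 'a \<Rightarrow> real"
  assumes u: "continuous_on \<Omega> u" and p: "p \<in> subdiff \<Omega> u x" "p \<notin> overlap \<Omega> u"
    and r: "r > 0" "cball x r \<subseteq> \<Omega>"
    and v: "\<And>j. convex_on (U j) (v j)" "\<forall>\<^sub>F j in sequentially. cball x r \<subseteq> U j"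
      "\<And>j. continuous_on (U j) (v j)"
    and lim: "uniform_limit (cball x r) v u sequentially"
  shows "\<forall>\<^sub>F j in sequentially. \<exists>y\<in>cball x r. p \<in> subdiff (U j) (v j) y"
proof -
  have x: "x \<in> \<Omega>" using r by auto
  define f where "f y = u y - u x - p \<bullet> (y - x)" for y
  have fpos: "f y > 0" if y: "y \<in> sphere x r" for y
  proof (rule ccontr)
    assume n: "\<not> f y > 0"
    have y\<Omega>: "y \<in> \<Omega>" "y \<noteq> x" using y r by auto
    have "p \<in> subdiff \<Omega> u y" unfolding subdiff_def
    proof (intro CollectI ballI)
      fix z assume "z \<in> \<Omega>"
      then have "u z \<ge> u x + p \<bullet> (z - x)" using p by (auto simp: subdiff_def)
      then show "u y + p \<bullet> (z - y) \<le> u z" using n by (simp add: f_def inner_diff_right)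
    qed
    then show False using p x y\<Omega> unfolding overlap_def by blast
  qed
  have "\<exists>c>0. \<forall>y\<in>sphere x r. c \<le> f y"
  proof -
    have "sphere x r \<subseteq> \<Omega>" using r by auto
    then have "continuous_on (sphere x r) f"
      unfolding f_def using u by (intro continuous_intros) (auto intro: continuous_on_subset)
    moreover have "sphere x r \<noteq> {}" using r by simp
    ultimately obtain y where "y \<in> sphere x r" "\<forall>z\<in>sphere x r. f y \<le> f z"
      using continuous_attains_inf[of "sphere x r" f] by auto
    then show ?thesis using fpos by blast
  qed
  then obtain c where c: "c > 0" "\<And>y. y \<in> sphere x r \<Longrightarrow> c \<le> f y" by blast
  have "\<forall>\<^sub>F j in sequentially. \<forall>y\<in>cball x r. dist (v j y) (u y) < c / 3"
    using uniform_limitD[OF lim, of "c / 3"] c by simp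
  with v(2) show ?thesis
  proof eventually_elim
    case (elim j)
    have "continuous_on (cball x r) (\<lambda>y. v j y - p \<bullet> y)"
      using v(3)[of j] elim(1) by (intro continuous_intros) (auto intro: continuous_on_subset)
    moreover have "cball x r \<noteq> {}" using r by simp
    ultimately obtain y where y: "y \<in> cball x r" "\<forall>z\<in>cball x r. v j y - p \<bullet> y \<le> v j z - p \<bullet> z"
      using continuous_attains_inf[of "cball x r" "\<lambda>y. v j y - p \<bullet> y"] by auto
    have "y \<notin> sphere x r"
    proof
      assume ys: "y \<in> sphere x r"
      have "v j y - p \<bullet> y \<le> v j x - p \<bullet> x" using y r by auto
      moreover have "\<bar>v j y - u y\<bar> < c / 3" "\<bar>v j x - u x\<bar> < c / 3"
        using elim(2) y(1) r by (auto simp: dist_real_def)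
      moreover have "c \<le> u y - u x - (p \<bullet> y - p \<bullet> x)" using c(2)[OF ys] by (simp add: f_def inner_diff_right)
      ultimately show False using c(1) by linarith
    qed
    then have "y \<in> ball x r" using y by auto
    moreover have "ball x r \<subseteq> U j" using elim(1) ball_subset_cball by blast
    ultimately have "p \<in> subdiff (U j) (v j) y"
      using y(2) by (intro interior_minimum_subdiff[OF v(1)]) auto
    then show ?case using y(1) by blast
  qed
qed

text \<open>The contact relation is closed under simultaneous convergence of functions and contact
  points. The index map \<open>j\<close> need only tend to infinity, so that it can select indices
  at which a given slope recurs.\<close>

lemma contact_limit:
  fixes u :: "'a::euclidean_space \<Rightarrow> real" and v :: "nat \<Rightarrow> 'a \<Rightarrow> real"
  assumes u: "continuous_on \<Omega> u" and K: "compact K" "K \<subseteq> \<Omega>"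
    and v: "\<And>y. y \<in> \<Omega> \<Longrightarrow> \<forall>\<^sub>F j in sequentially. y \<in> U j"
    and lim: "uniform_limit K v u sequentially" "\<And>y. y \<in> \<Omega> \<Longrightarrow> (\<lambda>j. v j y) \<longlonglongrightarrow> u y"
    and j: "filterlim j sequentially sequentially"
    and X: "\<And>n. X n \<in> K" "X \<longlonglongrightarrow> x" "\<And>n. p \<in> subdiff (U (j n)) (v (j n)) (X n)"
  shows "x \<in> K" "p \<in> subdiff \<Omega> u x"
proof -
  show xK: "x \<in> K" using closed_sequentially[OF compact_imp_closed[OF K(1)] X(1,2)] .
  have "(\<lambda>n. u (X n)) \<longlonglongrightarrow> u x"
    using continuous_on_tendsto_compose[OF continuous_on_subset[OF u K(2)] X(2) xK] X(1) by auto
  moreover have "(\<lambda>n. v (j n) (X n) - u (X n)) \<longlonglongrightarrow> 0"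
  proof (rule tendstoI)
    fix e :: real assume "e > 0"
    then have "\<forall>\<^sub>F k in sequentially. \<forall>x\<in>K. dist (v k x) (u x) < e" using uniform_limitD[OF lim(1)] by blast
    then have "\<forall>\<^sub>F n in sequentially. \<forall>x\<in>K. dist (v (j n) x) (u x) < e"
      using eventually_compose_filterlim[OF _ j] by blast
    then show "\<forall>\<^sub>F n in sequentially. dist (v (j n) (X n) - u (X n)) 0 < e"
      by eventually_elim (use X(1) in \<open>auto simp: dist_real_def\<close>)
  qed
  ultimately have vlim: "(\<lambda>n. v (j n) (X n)) \<longlonglongrightarrow> u x"
    using tendsto_add[of "\<lambda>n. v (j n) (X n) - u (X n)" 0 sequentially "\<lambda>n. u (X n)"] by simp
  show "p \<in> subdiff \<Omega> u x" unfolding subdiff_def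
  proof (intro CollectI ballI)
    fix y assume y: "y \<in> \<Omega>"
    have "(\<lambda>n. v (j n) (X n) + p \<bullet> (y - X n)) \<longlonglongrightarrow> u x + p \<bullet> (y - x)"
      by (intro tendsto_intros vlim X(2))
    moreover have "(\<lambda>n. v (j n) y) \<longlonglongrightarrow> u y" using filterlim_compose[OF lim(2)[OF y] j] .
    moreover have "\<forall>\<^sub>F n in sequentially. v (j n) (X n) + p \<bullet> (y - X n) \<le> v (j n) y"
      using eventually_compose_filterlim[OF v[OF y] j]
      by eventually_elim (use X(3) in \<open>auto simp: subdiff_def\<close>)
    ultimately show "u x + p \<bullet> (y - x) \<le> u y" using tendsto_le[OF sequentially_bot] by blast
  qed
qed

section \<open>Closed neighbourhoods of compact sets, and slope sets over open and Borel
  sets\<close>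

definition nbhd :: "'a::metric_space set \<Rightarrow> real \<Rightarrow> 'a set" where
  "nbhd K r = (\<Union>x\<in>K. cball x r)"

lemma compact_nbhd: "compact (K::'a::euclidean_space set) \<Longrightarrow> compact (nbhd K r)"
proof -
  assume "compact K"
  then have "compact ((\<lambda>(x,y). x + y) ` (K \<times> cball 0 r))"
    by (intro compact_continuous_image compact_Times) (auto intro!: continuous_intros simp: case_prod_unfold)
  moreover have "(\<lambda>(x,y). x + y) ` (K \<times> cball 0 r) = nbhd K r"
  proof (intro set_eqI iffI)
    fix z assume "z \<in> nbhd K r"
    then obtain x where "x \<in> K" "dist x z \<le> r" unfolding nbhd_def by auto
    then show "z \<in> (\<lambda>(x,y). x + y) ` (K \<times> cball 0 r)"
      by (intro image_eqI[of _ _ "(x, z - x)"]) (auto simp: dist_norm norm_minus_commute)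
  qed (force simp: nbhd_def dist_norm)
  ultimately show ?thesis by simp
qed

lemma nbhd_mono: "r \<le> s \<Longrightarrow> nbhd K r \<subseteq> nbhd K s" unfolding nbhd_def by fastforce

lemma subset_nbhd: "0 \<le> r \<Longrightarrow> K \<subseteq> nbhd K r" unfolding nbhd_def by fastforce

lemma nbhd_dist: "x \<in> nbhd K r \<Longrightarrow> dist x y \<le> s \<Longrightarrow> y \<in> nbhd K (r + s)"
proof -
  assume "x \<in> nbhd K r" "dist x y \<le> s"
  then obtain z where "z \<in> K" "dist z x \<le> r" unfolding nbhd_def by auto
  then show ?thesis using \<open>dist x y \<le> s\<close> dist_triangle[of z y x] unfolding nbhd_def
    by (intro UN_I[of z]) auto
qed

lemma nbhd_limit:
  fixes K :: "'a::euclidean_space set"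
  assumes "compact K" "X \<longlonglongrightarrow> x" "\<And>n. X n \<in> nbhd K (s n)" "s \<longlonglongrightarrow> 0" shows "x \<in> K"
proof -
  obtain Z where Z: "\<And>n. Z n \<in> K" "\<And>n. dist (Z n) (X n) \<le> s n"
    using assms(3) unfolding nbhd_def by (simp, metis)
  have "(\<lambda>n. dist (Z n) (X n)) \<longlonglongrightarrow> 0"
    by (rule tendsto_sandwich[OF _ _ tendsto_const assms(4)]) (use Z(2) in auto)
  then have "(\<lambda>n. Z n - X n) \<longlonglongrightarrow> 0" unfolding dist_norm by (rule tendsto_norm_zero_cancel)
  from tendsto_add[OF this assms(2)] have "Z \<longlonglongrightarrow> x" by simp
  then show ?thesis using closed_sequentially[OF compact_imp_closed[OF assms(1)], of Z x] Z(1) by blast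
qed

lemma nbhd_inter:
  fixes K :: "'a::euclidean_space set"
  assumes "compact K" shows "(\<Inter>n. nbhd K (r / Suc n)) \<subseteq> K"
proof
  fix x assume "x \<in> (\<Inter>n. nbhd K (r / Suc n))"
  then show "x \<in> K" using lim_const_over_n[of r] LIMSEQ_Suc[OF lim_const_over_n[of r]]
    by (intro nbhd_limit[OF assms, of "\<lambda>_. x" x "\<lambda>n. r / Suc n"]) auto
qed

lemma compact_nbhd_exhausts:
  assumes "compact K" "open S" "K \<subseteq> S"
  obtains r where "r > 0" "nbhd K r \<subseteq> S"
  using compact_subset_open_imp_cball_epsilon_subset[OF assms] unfolding nbhd_def by blast

lemma subdiff_set_open_lebesgue:
  assumes u: "continuous_on \<Omega> u" and S: "open S" "S \<subseteq> \<Omega>" shows "subdiff_set \<Omega> u S \<in> sets lebesgue"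
proof -
  obtain C where C: "\<And>n::nat. compact(C n)" "\<And>n. C n \<subseteq> S" "\<Union>(range C) = S"
    using open_Union_compact_subsets[OF S(1)] by metis
  have "subdiff_set \<Omega> u (C n) \<in> sets lebesgue" for n
  proof -
    have "C n \<subseteq> \<Omega>" using C(2) S(2) by blast
    from borel_closed[OF closed_subdiff_set[OF C(1) this continuous_on_subset[OF u this]]]
    show ?thesis by (intro sets_completionI_sets) simp
  qed
  moreover have "subdiff_set \<Omega> u S = (\<Union>n. subdiff_set \<Omega> u (C n))" unfolding C(3)[symmetric] subdiff_set_def by blast
  ultimately show ?thesis by auto
qed

text \<open>Off the null set \<open>overlap \<Omega> u\<close> the contact point \<open>X p\<close> of a slope \<open>p\<close> is unique, so that
  \<open>e \<mapsto> R_measure R (subdiff_set \<Omega> u e)\<close> is the push-forward under \<open>X\<close> of a measure.\<close>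

lemma R_measure_subdiff_set_eq_if_compact:
  fixes \<Omega> :: "'a::euclidean_space set"
  assumes \<Omega>: "open \<Omega>" "bounded \<Omega>" and u: "continuous_on \<Omega> u" and R: "R \<in> borel_measurable lebesgue"
    and mu: "sets \<mu> = sets (restrict_space borel \<Omega>)" "emeasure \<mu> \<Omega> < \<infinity>"
    and K: "\<And>K. compact K \<Longrightarrow> K \<subseteq> \<Omega> \<Longrightarrow> R_measure R (subdiff_set \<Omega> u K) = emeasure \<mu> K"
    and e: "e \<in> sets borel" "e \<subseteq> \<Omega>" shows "R_measure R (subdiff_set \<Omega> u e) = emeasure \<mu> e"
proof -
  define ov where "ov = overlap \<Omega> u"
  have ovn: "negligible ov" unfolding ov_def by (rule negligible_overlap[OF \<Omega>(2)])
  then have ovs: "ov \<in> sets lebesgue" by (rule negligible_imp_sets)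
  define D where "D = subdiff_set \<Omega> u \<Omega> - ov"
  have D: "D \<in> sets lebesgue" unfolding D_def using subdiff_set_open_lebesgue[OF u \<Omega>(1)] ovs by auto
  define X where "X p = (SOME x. x \<in> \<Omega> \<and> p \<in> subdiff \<Omega> u x)" for p
  have Xp: "X p \<in> \<Omega>" "p \<in> subdiff \<Omega> u (X p)" if "p \<in> D" for p
  proof -
    have "\<exists>x. x \<in> \<Omega> \<and> p \<in> subdiff \<Omega> u x" using that unfolding D_def subdiff_set_def by blast
    from someI_ex[OF this] show "X p \<in> \<Omega>" "p \<in> subdiff \<Omega> u (X p)" unfolding X_def by auto
  qed
  have vim: "X -` A \<inter> D = subdiff_set \<Omega> u (A \<inter> \<Omega>) - ov" for A
  proof (intro set_eqI iffI)
    fix p assume "p \<in> X -` A \<inter> D"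
    then show "p \<in> subdiff_set \<Omega> u (A \<inter> \<Omega>) - ov" using Xp unfolding subdiff_set_def D_def by blast
  next
    fix p assume p: "p \<in> subdiff_set \<Omega> u (A \<inter> \<Omega>) - ov"
    then obtain x where x: "x \<in> A" "x \<in> \<Omega>" "p \<in> subdiff \<Omega> u x" unfolding subdiff_set_def by blast
    have pD: "p \<in> D" using p unfolding D_def subdiff_set_def by blast
    then have "X p = x" using Xp[OF pD] x p unfolding ov_def overlap_def by blast
    then show "p \<in> X -` A \<inter> D" using x pD by blast
  qed
  define M where "M = density lebesgue (\<lambda>p. ennreal (R p))"
  define M' where "M' = restrict_space M D"
  have spM: "space M = UNIV" "sets M = sets lebesgue" unfolding M_def by auto
  have spM': "space M' = D" unfolding M'_def by (simp add: space_restrict_space spM)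
  have setM': "A \<in> sets M' \<longleftrightarrow> A \<subseteq> D \<and> A \<in> sets lebesgue" for A
    unfolding M'_def using D by (subst sets_restrict_space_iff) (auto simp: spM)
  have X: "X \<in> borel_measurable M'"
  proof (rule borel_measurableI)
    fix S :: "'a set" assume S: "open S"
    have "subdiff_set \<Omega> u (S \<inter> \<Omega>) \<in> sets lebesgue" using S \<Omega>(1) by (intro subdiff_set_open_lebesgue[OF u]) auto
    then have "X -` S \<inter> D \<in> sets lebesgue" unfolding vim using ovs by auto
    then show "X -` S \<inter> space M' \<in> sets M'" unfolding spM' setM' by blast
  qed
  have Rov: "R_measure R (A - ov) = R_measure R A" for A
  proof (rule antisym)
    have "R_measure R A \<le> R_measure R ((A - ov) \<union> ov)" by (intro R_measure_mono) auto
    then show "R_measure R A \<le> R_measure R (A - ov)" by (simp add: R_measure_Un_negligible[OF ovn] del: Un_Diff_cancel2)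
  qed (intro R_measure_mono Diff_subset)
  have nu: "emeasure (distr M' borel X) A = R_measure R (subdiff_set \<Omega> u (A \<inter> \<Omega>))" if A: "A \<in> sets borel" for A
  proof -
    have s: "X -` A \<inter> D \<in> sets M'" using measurable_sets[OF X A] spM' by simp
    have "emeasure (distr M' borel X) A = emeasure M' (X -` A \<inter> D)"
      using A X by (simp add: emeasure_distr spM')
    also have "\<dots> = emeasure M (X -` A \<inter> D)"
      unfolding M'_def using D by (intro emeasure_restrict_space) (auto simp: spM)
    also have "\<dots> = R_measure R (X -` A \<inter> D)"
      unfolding M_def using s setM' by (intro R_measure_eq_emeasure[symmetric] R) blast
    finally show ?thesis by (simp add: vim Rov)
  qed
  \<comment> \<open>\<open>\<mu>\<close> lives on the Borel subsets of \<Omega>; pushing it to the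
    Borel sets of the whole space makes it comparable with the image measure under
    \<open>X\<close>.\<close>
  define N where "N = distr \<mu> borel (\<lambda>x. x)"
  have idm: "(\<lambda>x. x) \<in> borel_measurable \<mu>"
    unfolding measurable_cong_sets[OF mu(1) refl] by (intro measurable_restrict_space1) auto
  have spmu: "space \<mu> = \<Omega>" using sets_eq_imp_space_eq[OF mu(1)] by (simp add: space_restrict_space)
  have N: "emeasure N A = emeasure \<mu> (A \<inter> \<Omega>)" if "A \<in> sets borel" for A
    unfolding N_def using that idm by (simp add: emeasure_distr spmu)
  have "distr M' borel X = N"
  proof (rule measure_eqI_generator_eq[where E="{S. open S}" and \<Omega>=UNIV and A="\<lambda>_. UNIV"])
    \<comment> \<open>The hypothesis covers compact sets only, so an open set is exhausted by
      compact ones; open sets in turn form an intersection-stable generator.\<close>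
    show eqo: "emeasure (distr M' borel X) S = emeasure N S" if S: "S \<in> {S. open S}" for S
    proof -
      have SO: "open (S \<inter> \<Omega>)" using S \<Omega>(1) by auto
      obtain C where C: "\<And>n::nat. compact(C n)" "\<And>n. C n \<subseteq> S \<inter> \<Omega>" "\<And>n. C n \<subseteq> interior (C (Suc n))" "\<Union>(range C) = S \<inter> \<Omega>"
        using open_Union_compact_subsets[OF SO] by metis
      have inc: "incseq C" using C(3) interior_subset by (intro incseq_SucI) blast
      have Cs: "range C \<subseteq> sets borel" using C(1) by (auto intro!: borel_closed compact_imp_closed)
      have "emeasure (distr M' borel X) (S \<inter> \<Omega>) = (SUP n. emeasure (distr M' borel X) (C n))"
        unfolding C(4)[symmetric] using Cs inc by (intro SUP_emeasure_incseq[symmetric]) auto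
      also have "\<dots> = (SUP n. emeasure N (C n))"
      proof (rule SUP_cong[OF refl])
        fix n
        have "C n \<inter> \<Omega> = C n" using C(2) by blast
        then show "emeasure (distr M' borel X) (C n) = emeasure N (C n)"
          using Cs C(1,2) K[of "C n"] by (simp add: nu N range_subsetD)
      qed
      also have "\<dots> = emeasure N (S \<inter> \<Omega>)"
        unfolding C(4)[symmetric] using Cs inc by (intro SUP_emeasure_incseq) (auto simp: N_def)
      finally show ?thesis using S \<Omega>(1) SO by (simp add: nu N Int_assoc)
    qed
    have "emeasure (distr M' borel X) UNIV = emeasure N UNIV" by (rule eqo) simp
    then show "emeasure (distr M' borel X) UNIV \<noteq> \<infinity>" for i :: nat using mu(2) by (simp add: N)
  qed (auto simp: Int_stable_def N_def borel_def)
  then have "emeasure (distr M' borel X) e = emeasure N e" by simp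
  then show ?thesis using e by (simp add: nu N Int_absorb2)
qed

section \<open>Limits of finite element solutions\<close>

text \<open>Indexed by natural numbers rather than by the mesh size, so that a subsequence is again
  an instance.\<close>

locale fe_sequence =
  fixes \<Omega> :: "'a::euclidean_space set" and g R :: "'a \<Rightarrow> real" and \<mu> :: "'a measure"
    and \<T> :: "nat \<Rightarrow> 'a set set" and hs :: "nat \<Rightarrow> real" and v :: "nat \<Rightarrow> 'a \<Rightarrow> real"
  assumes open_dom: "open \<Omega>" and bounded_dom: "bounded \<Omega>" and convex_dom: "convex \<Omega>" and dom_nonempty: "\<Omega> \<noteq> {}"
    and R_pos: "\<forall>p. R p > 0" and R_loc: "\<forall>K. compact K \<longrightarrow> R integrable_on K"
    and mu_sets: "sets \<mu> = sets (restrict_space borel \<Omega>)"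
    and mass: "emeasure \<mu> \<Omega> < R_measure R UNIV"
    and mesh_T: "\<And>j. is_mesh \<Omega> (\<T> j) (hs j)"
    and fe_v: "\<And>j. fe_solution (\<T> j) R \<mu> g (v j)"
    and hs_lim: "hs \<longlonglongrightarrow> 0"
    and exhaust: "\<And>K. compact K \<Longrightarrow> K \<subseteq> \<Omega> \<Longrightarrow> \<forall>\<^sub>F j in sequentially. K \<subseteq> mesh_domain (\<T> j)"

context fe_sequence
begin

abbreviation "D j \<equiv> mesh_domain (\<T> j)"

lemma mesh_over_\<T>: "mesh_over \<Omega> (\<T> j) (hs j)"
  by unfold_locales (rule open_dom bounded_dom convex_dom mesh_T)+

lemma R_meas: "R \<in> borel_measurable lebesgue"
  using measurable_of_integrable_on_compact[OF R_pos R_loc] .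

lemma v_H: "v j \<in> H_space (\<T> j) g" and v_convex: "convex_on (D j) (v j)"
  and v_cont: "continuous_on (closure (D j)) (v j)"
  using fe_v[of j] unfolding fe_solution_def H_space_def by auto

lemma v_cont_D: "continuous_on (D j) (v j)" by (rule continuous_on_subset[OF v_cont closure_subset])

lemma hs_small: "r > 0 \<Longrightarrow> \<forall>\<^sub>F j in sequentially. hs j < r" using order_tendstoD(2)[OF hs_lim] .

lemma space_mu: "space \<mu> = \<Omega>"
  using sets_eq_imp_space_eq[OF mu_sets] by (simp add: space_restrict_space)

lemma in_sets_mu: "A \<in> sets borel \<Longrightarrow> A \<subseteq> \<Omega> \<Longrightarrow> A \<in> sets \<mu>"
  unfolding mu_sets using open_dom by (subst sets_restrict_space_iff) auto

lemma compact_sets_mu: "compact A \<Longrightarrow> A \<subseteq> \<Omega> \<Longrightarrow> A \<in> sets \<mu>"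
  by (intro in_sets_mu borel_closed compact_imp_closed)

lemma mu_finite: "emeasure \<mu> A < \<infinity>"
proof -
  have "emeasure \<mu> A \<le> emeasure \<mu> \<Omega>" using emeasure_space[of \<mu> A] by (simp add: space_mu)
  also have "\<dots> < \<infinity>" using mass by (rule order_less_le_trans) simp
  finally show ?thesis .
qed

text \<open>Slopes attained by \<open>v j\<close> near \<open>K\<close> for infinitely many
  \<open>j\<close> are attained by \<open>u\<close> on \<open>K\<close>. The closed sets
  \<open>P j\<close> carry at least the mass of \<open>K\<close> and lie in one ball of finite
  \<open>R\<close>-mass, so continuity from above passes this mass on to their limes
  superior.\<close>

lemma limit_mass_ge:
  assumes u: "continuous_on \<Omega> u" and lim: "\<And>K. compact K \<Longrightarrow> K \<subseteq> \<Omega> \<Longrightarrow> uniform_limit K v u sequentially"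
    and K: "compact K" "K \<subseteq> \<Omega>" shows "emeasure \<mu> K \<le> R_measure R (subdiff_set \<Omega> u K)"
proof -
  obtain r0 where r0: "r0 > 0" "nbhd K r0 \<subseteq> \<Omega>" using compact_nbhd_exhausts[OF K(1) open_dom K(2)] by blast
  define r where "r = r0 / 2"
  have r: "r > 0" "r + r = r0" using r0 by (auto simp: r_def)
  have cN: "compact (nbhd K s)" for s using K(1) by (rule compact_nbhd)
  obtain M where M: "\<And>x. x \<in> nbhd K r0 \<Longrightarrow> \<bar>u x\<bar> \<le> M"
    using compact_imp_bounded[OF compact_continuous_image[OF continuous_on_subset[OF u r0(2)] cN]]
    unfolding bounded_iff by auto
  have "\<forall>\<^sub>F j in sequentially. nbhd K r0 \<subseteq> D j \<and> (\<forall>x\<in>nbhd K r0. dist (v j x) (u x) < 1) \<and> hs j < r"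
    using exhaust[OF cN r0(2)] uniform_limitD[OF lim[OF cN r0(2)], of 1] hs_small[OF r(1)]
    by (simp add: eventually_conj_iff)
  then obtain N where N: "\<And>j. j \<ge> N \<Longrightarrow> nbhd K r0 \<subseteq> D j"
    "\<And>j x. j \<ge> N \<Longrightarrow> x \<in> nbhd K r0 \<Longrightarrow> dist (v j x) (u x) < 1" "\<And>j. j \<ge> N \<Longrightarrow> hs j < r"
    unfolding eventually_sequentially by blast
  \<comment> \<open>Slope bound: a ball of radius \<open>r\<close> about a contact point stays in
    \<open>nbhd K r0\<close>, where all late \<open>v j\<close> are bounded by
    \<open>M + 1\<close>.\<close>
  define L where "L = 2 * (M + 1) / r"
  have "\<exists>P. closed P \<and> P \<subseteq> subdiff_set (D j) (v j) (nbhd K (hs j)) \<and> emeasure \<mu> K \<le> R_measure R P" if j: "j \<ge> N" for j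
  proof (rule mesh_over.R_measure_subdiff_vertices_ge[OF mesh_over_\<T> mu_sets fe_v R_meas])
    show "K \<in> sets \<mu>" by (rule compact_sets_mu[OF K])
    show "K \<subseteq> D j" using N(1)[OF j] subset_nbhd[of r0 K] r0 by auto
    show "y \<in> nbhd K (hs j)" if "x \<in> K" "dist x y \<le> hs j" for x y using that unfolding nbhd_def by auto
    show "nbhd K (hs j) \<subseteq> D j" using N(1,3)[OF j] nbhd_mono[of "hs j" r0 K] r by auto
  qed
  then obtain P where P: "\<And>j. j \<ge> N \<Longrightarrow> closed (P j)" "\<And>j. j \<ge> N \<Longrightarrow> P j \<subseteq> subdiff_set (D j) (v j) (nbhd K (hs j))"
    "\<And>j. j \<ge> N \<Longrightarrow> emeasure \<mu> K \<le> R_measure R (P j)" by metis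
  have Pb: "P j \<subseteq> cball 0 L" if j: "j \<ge> N" for j
  proof
    fix p assume "p \<in> P j"
    then obtain x where x: "x \<in> nbhd K (hs j)" "p \<in> subdiff (D j) (v j) x" using P(2)[OF j] unfolding subdiff_set_def by blast
    have xr: "x \<in> nbhd K r" using x nbhd_mono[of "hs j" r K] N(3)[OF j] by auto
    have sub: "cball x r \<subseteq> nbhd K r0" using nbhd_dist[OF xr, of _ r, unfolded r(2)] by auto
    have "norm p \<le> 2 * (M + 1) / r"
    proof (rule norm_subdiff_le[OF x(2) r(1)])
      show "cball x r \<subseteq> D j" using sub N(1)[OF j] by blast
      fix y assume "y \<in> cball x r"
      then have y: "y \<in> nbhd K r0" using sub by blast
      show "\<bar>v j y\<bar> \<le> M + 1" using M[OF y] N(2)[OF j y] by (auto simp: dist_real_def)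
    qed
    then show "p \<in> cball 0 L" by (simp add: L_def)
  qed
  define G where "G n = (\<Union>j\<in>{n + N..}. P j)" for n
  have Pm: "P j \<in> sets lebesgue" if "j \<ge> N" for j
    using borel_closed[OF P(1)[OF that]] by (intro sets_completionI_sets) simp
  have Gm: "G n \<in> sets lebesgue" for n unfolding G_def using Pm by (intro sets.countable_UN') auto
  have Gb: "G n \<subseteq> cball 0 L" for n unfolding G_def by (intro UN_least Pb) auto
  have "R_measure R (\<Inter>n. G n) = (INF n. R_measure R (G n))"
    by (rule R_measure_INT_decseq[OF R_meas Gm _ R_measure_bounded_finite[OF R_pos R_loc bounded_subset[OF bounded_cball Gb]]])
      (fastforce simp: G_def decseq_def)
  moreover have "emeasure \<mu> K \<le> (INF n. R_measure R (G n))"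
  proof (rule INF_greatest)
    fix n
    have "R_measure R (P (n + N)) \<le> R_measure R (G n)" unfolding G_def by (intro R_measure_mono) auto
    then show "emeasure \<mu> K \<le> R_measure R (G n)" using P(3)[of "n + N"] by simp
  qed
  moreover have "(\<Inter>n. G n) \<subseteq> subdiff_set \<Omega> u K"
  proof
    fix p assume "p \<in> (\<Inter>n. G n)"
    then have "\<forall>n. \<exists>j. j \<ge> n + N \<and> p \<in> P j" unfolding G_def by auto
    then obtain j where j: "\<And>n. j n \<ge> n + N" "\<And>n. p \<in> P (j n)" by metis
    have jN: "j n \<ge> N" for n using j(1)[of n] by simp
    have "\<forall>n. \<exists>x. x \<in> nbhd K (hs (j n)) \<and> p \<in> subdiff (D (j n)) (v (j n)) x"
      using P(2)[OF jN] j(2) unfolding subdiff_set_def by blast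
    then obtain X where X: "\<And>n. X n \<in> nbhd K (hs (j n))" "\<And>n. p \<in> subdiff (D (j n)) (v (j n)) (X n)" by metis
    have Xr: "X n \<in> nbhd K r0" for n using X(1)[of n] N(3)[OF jN, of n] nbhd_mono[of "hs (j n)" r0 K] r by auto
    then obtain x s where s: "strict_mono s" "(X \<circ> s) \<longlonglongrightarrow> x"
      using cN[of r0] unfolding compact_def by metis
    have "n \<le> j (s n)" for n using j(1)[of "s n"] seq_suble[OF s(1), of n] by linarith
    then have jl: "filterlim (\<lambda>n. j (s n)) sequentially sequentially"
      by (intro filterlim_at_top_mono[OF filterlim_ident]) auto
    have "p \<in> subdiff \<Omega> u x"
    proof (rule contact_limit(2)[OF u cN r0(2) _ lim[OF cN r0(2)] _ jl])
      show "\<forall>\<^sub>F j in sequentially. y \<in> D j" if "y \<in> \<Omega>" for y using exhaust[of "{y}"] that by auto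
      show "(\<lambda>j. v j y) \<longlonglongrightarrow> u y" if "y \<in> \<Omega>" for y
        using tendsto_uniform_limitI[OF lim[of "{y}"], of y] that by auto
      show "(\<lambda>n. X (s n)) \<longlonglongrightarrow> x" using s(2) by (simp add: comp_def)
    qed (use Xr X(2) in auto)
    moreover have "x \<in> K"
    proof (rule nbhd_limit[OF K(1)])
      show "(\<lambda>n. X (s n)) \<longlonglongrightarrow> x" using s(2) by (simp add: comp_def)
      show "(\<lambda>n. hs (j (s n))) \<longlonglongrightarrow> 0" by (rule filterlim_compose[OF hs_lim jl])
    qed (rule X(1))
    ultimately show "p \<in> subdiff_set \<Omega> u K" unfolding subdiff_set_def by blast
  qed
  ultimately show ?thesis using R_measure_mono order_trans by metis
qed

text \<open>A slope attained by \<open>u\<close> on \<open>K\<close> outside \<open>overlap\<close>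
  is attained near \<open>K\<close> by all late \<open>v j\<close>, so it lies in a limes inferior
  of slope sets, whose mass is bounded by continuity from below. Of the radius \<open>r + r\<close>,
  one half is the drift of the contact points and the other the mesh size.\<close>

lemma limit_mass_le_nbhd:
  assumes u: "continuous_on \<Omega> u" and lim: "\<And>K. compact K \<Longrightarrow> K \<subseteq> \<Omega> \<Longrightarrow> uniform_limit K v u sequentially"
    and K: "compact K" and r: "r > 0" "nbhd K (r + r) \<subseteq> \<Omega>"
  shows "R_measure R (subdiff_set \<Omega> u K) \<le> emeasure \<mu> (nbhd K (r + r))"
proof -
  have cN: "compact (nbhd K s)" for s using K(1) by (rule compact_nbhd)
  have "\<forall>\<^sub>F j in sequentially. nbhd K (r + r) \<subseteq> D j \<and> hs j < r"
    using exhaust[OF cN r(2)] hs_small[OF r(1)] by (simp add: eventually_conj_iff)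
  then obtain N where N: "\<And>j. j \<ge> N \<Longrightarrow> nbhd K (r + r) \<subseteq> D j" "\<And>j. j \<ge> N \<Longrightarrow> hs j < r"
    unfolding eventually_sequentially by blast
  have "\<exists>P. closed P \<and> (\<forall>p. p \<in> subdiff_set (D j) (v j) (nbhd K r) \<longrightarrow> p \<in> P \<or> p \<in> overlap (D j) (v j)) \<and>
      R_measure R P \<le> emeasure \<mu> (nbhd K (r + r))" if j: "j \<ge> N" for j
  proof (rule mesh_over.R_measure_subdiff_set_le[OF mesh_over_\<T> mu_sets fe_v R_meas])
    show "nbhd K (r + r) \<in> sets \<mu>" by (rule compact_sets_mu[OF cN r(2)])
    show "x \<in> nbhd K (r + r)" if "x \<in> D j" "y \<in> nbhd K r" "dist x y \<le> hs j" for x y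
      using nbhd_dist[OF that(2), of x r] that(3) N(2)[OF j] by (simp add: dist_commute)
    show "nbhd K r \<subseteq> D j" using N(1)[OF j] nbhd_mono[of r "r + r" K] r by auto
  qed blast
  then obtain P where P: "\<And>j. j \<ge> N \<Longrightarrow> closed (P j)"
    "\<And>j p. j \<ge> N \<Longrightarrow> p \<in> subdiff_set (D j) (v j) (nbhd K r) \<Longrightarrow> p \<in> P j \<or> p \<in> overlap (D j) (v j)"
    "\<And>j. j \<ge> N \<Longrightarrow> R_measure R (P j) \<le> emeasure \<mu> (nbhd K (r + r))" by metis
  define S where "S j = P j \<union> overlap (D j) (v j)" for j
  have ovn: "negligible (overlap (D j) (v j))" for j by (rule negligible_overlap[OF mesh_over.bounded_U[OF mesh_over_\<T>]])
  have Sm: "S j \<in> sets lebesgue" if "j \<ge> N" for j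
    unfolding S_def using borel_closed[OF P(1)[OF that]]
    by (intro sets.Un sets_completionI_sets[of "P j"] negligible_imp_sets[OF ovn]) simp
  define L where "L n = (\<Inter>j\<in>{n + N..}. S j)" for n
  have Lm: "L n \<in> sets lebesgue" for n unfolding L_def using Sm by (intro sets.countable_INT'') auto
  have "R_measure R (\<Union>n. L n) = (SUP n. R_measure R (L n))"
    by (rule R_measure_UN_incseq[OF R_meas Lm]) (fastforce simp: L_def incseq_def)
  also have "\<dots> \<le> emeasure \<mu> (nbhd K (r + r))"
  proof (rule SUP_least)
    fix n
    have "R_measure R (L n) \<le> R_measure R (S (n + N))" unfolding L_def by (intro R_measure_mono) auto
    also have "\<dots> = R_measure R (P (n + N))" unfolding S_def by (rule R_measure_Un_negligible[OF ovn])
    also have "\<dots> \<le> emeasure \<mu> (nbhd K (r + r))" using P(3) by simp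
    finally show "R_measure R (L n) \<le> emeasure \<mu> (nbhd K (r + r))" .
  qed
  finally have *: "R_measure R (\<Union>n. L n) \<le> emeasure \<mu> (nbhd K (r + r))" .
  have "subdiff_set \<Omega> u K \<subseteq> (\<Union>n. L n) \<union> overlap \<Omega> u"
  proof
    fix p assume p: "p \<in> subdiff_set \<Omega> u K"
    then obtain x where x: "x \<in> K" "p \<in> subdiff \<Omega> u x" unfolding subdiff_set_def by blast
    show "p \<in> (\<Union>n. L n) \<union> overlap \<Omega> u"
    proof (cases "p \<in> overlap \<Omega> u")
      case False
      have cb: "cball x r \<subseteq> nbhd K r" using x unfolding nbhd_def by blast
      then have cb\<Omega>: "cball x r \<subseteq> \<Omega>" using nbhd_mono[of r "r + r" K] r by auto
      have "\<forall>\<^sub>F j in sequentially. \<exists>y\<in>cball x r. p \<in> subdiff (D j) (v j) y"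
        by (rule contact_stable[OF u x(2) False r(1) cb\<Omega> v_convex exhaust[OF compact_cball cb\<Omega>] v_cont_D lim[OF compact_cball cb\<Omega>]])
      then obtain n where n: "\<And>j. j \<ge> n \<Longrightarrow> \<exists>y\<in>cball x r. p \<in> subdiff (D j) (v j) y"
        unfolding eventually_sequentially by blast
      have "p \<in> S j" if "j \<ge> n + N" for j
      proof -
        have "p \<in> subdiff_set (D j) (v j) (nbhd K r)" using n[of j] that cb unfolding subdiff_set_def by fastforce
        then show ?thesis using P(2)[of j p] that unfolding S_def by auto
      qed
      then have "p \<in> L n" unfolding L_def by auto
      then show ?thesis by blast
    qed simp
  qed
  then have "R_measure R (subdiff_set \<Omega> u K) \<le> R_measure R ((\<Union>n. L n) \<union> overlap \<Omega> u)" by (rule R_measure_mono)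
  also have "\<dots> = R_measure R (\<Union>n. L n)" by (rule R_measure_Un_negligible[OF negligible_overlap[OF bounded_dom]])
  finally show ?thesis using * by simp
qed

lemma limit_mass_le:
  assumes u: "continuous_on \<Omega> u" and lim: "\<And>K. compact K \<Longrightarrow> K \<subseteq> \<Omega> \<Longrightarrow> uniform_limit K v u sequentially"
    and K: "compact K" "K \<subseteq> \<Omega>" shows "R_measure R (subdiff_set \<Omega> u K) \<le> emeasure \<mu> K"
proof -
  obtain r where r: "r > 0" "nbhd K r \<subseteq> \<Omega>" using compact_nbhd_exhausts[OF K(1) open_dom K(2)] by blast
  have sub: "nbhd K (r / Suc n) \<subseteq> \<Omega>" for n
    using nbhd_mono[of "r / Suc n" r K] r by (auto simp: field_simps)
  have "R_measure R (subdiff_set \<Omega> u K) \<le> (INF n. emeasure \<mu> (nbhd K (r / Suc n)))"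
  proof (rule INF_greatest)
    fix n
    have e: "r / Suc n / 2 + r / Suc n / 2 = r / Suc n" by (rule field_sum_of_halves)
    show "R_measure R (subdiff_set \<Omega> u K) \<le> emeasure \<mu> (nbhd K (r / Suc n))"
      using limit_mass_le_nbhd[OF u lim K(1), of "r / Suc n / 2", unfolded e] r(1) sub by simp
  qed
  also have "\<dots> = emeasure \<mu> (\<Inter>n. nbhd K (r / Suc n))"
  proof (rule INF_emeasure_decseq)
    show "range (\<lambda>n. nbhd K (r / Suc n)) \<subseteq> sets \<mu>"
      using compact_sets_mu[OF compact_nbhd[OF K(1)] sub] by blast
    show "decseq (\<lambda>n. nbhd K (r / Suc n))"
      using r(1) by (intro decseq_SucI nbhd_mono) (simp add: field_simps)
    show "emeasure \<mu> (nbhd K (r / Suc n)) \<noteq> \<infinity>" for n using mu_finite by (simp add: less_top)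
  qed
  also have "\<dots> \<le> emeasure \<mu> K" by (rule emeasure_mono[OF nbhd_inter[OF K(1)] compact_sets_mu[OF K]])
  finally show ?thesis .
qed

lemma limit_mass_eq:
  assumes u: "continuous_on \<Omega> u" and lim: "\<And>K. compact K \<Longrightarrow> K \<subseteq> \<Omega> \<Longrightarrow> uniform_limit K v u sequentially"
    and e: "e \<in> sets borel" "e \<subseteq> \<Omega>" shows "R_measure R (subdiff_set \<Omega> u e) = emeasure \<mu> e"
  by (rule R_measure_subdiff_set_eq_if_compact[OF open_dom bounded_dom u R_meas mu_sets mu_finite _ e])
    (intro antisym limit_mass_le[OF u lim] limit_mass_ge[OF u lim])

end

section \<open>Caps at a boundary point and steep slopes\<close>

lemma exit_point:
  fixes \<Omega> :: "'a::euclidean_space set"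
  assumes "bounded \<Omega>" "norm n = 1" and supp: "\<And>y. y \<in> closure \<Omega> \<Longrightarrow> 0 \<le> (y - a0) \<bullet> n"
    and y: "y \<in> closure \<Omega>"
  obtains s where "0 \<le> s" "s \<le> (y - a0) \<bullet> n" "y - s *\<^sub>R n \<in> frontier \<Omega>"
proof -
  \<comment> \<open>The extra 1 puts \<open>y'\<close> strictly below the supporting hyperplane,
    hence outside the closure, and forces the segment to cross the frontier.\<close>
  define b where "b = (y - a0) \<bullet> n + 1"
  define y' where "y' = y - b *\<^sub>R n"
  have nn: "n \<bullet> n = 1" using assms(2) by (simp add: norm_eq_1)
  have "(y' - a0) \<bullet> n < 0" by (simp add: y'_def b_def inner_diff_left nn algebra_simps)
  then have "y' \<notin> closure \<Omega>" using supp by force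
  then have "closed_segment y y' - closure \<Omega> \<noteq> {}" by auto
  moreover have "closed_segment y y' \<inter> closure \<Omega> \<noteq> {}" using y by auto
  ultimately obtain z where z: "z \<in> closed_segment y y'" "z \<in> frontier (closure \<Omega>)"
    using connected_Int_frontier[OF connected_segment(1), of y y' "closure \<Omega>"] by blast
  have zf: "z \<in> frontier \<Omega>" using z(2) interior_mono[OF closure_subset, of \<Omega>] by (auto simp: frontier_def)
  obtain t where t: "0 \<le> t" "t \<le> 1" "z = (1 - t) *\<^sub>R y + t *\<^sub>R y'" using z(1) by (auto simp: closed_segment_def)
  have zeq: "z = y - (t * b) *\<^sub>R n" unfolding t(3) y'_def by (simp add: algebra_simps)
  have "0 \<le> (z - a0) \<bullet> n" using zf supp by (auto simp: frontier_def)
  then have "t * b \<le> (y - a0) \<bullet> n" by (simp add: zeq inner_diff_left nn)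
  moreover have "0 \<le> t * b" using t supp[OF y] by (simp add: b_def)
  ultimately show ?thesis using that zf zeq by blast
qed

text \<open>The height over the supporting hyperplane controls the distance to the boundary point: near \<open>a0\<close>
  one descends to the boundary along \<open>-n\<close>, elsewhere one contracts towards \<open>a0\<close>.\<close>

lemma parabolic_support_height:
  fixes \<Omega> :: "'a::euclidean_space set"
  assumes \<Omega>: "bounded \<Omega>" "convex \<Omega>" and a0: "a0 \<in> frontier \<Omega>"
    and \<tau>: "0 \<le> \<tau>" and supp: "local_parabolic_support \<Omega> \<tau> a0"
  shows "\<exists>n C. norm n = 1 \<and> 1 \<le> C \<and> (\<forall>y\<in>closure \<Omega>. 0 \<le> (y - a0) \<bullet> n \<and> norm (y - a0) \<le> C * ((y - a0) \<bullet> n) powr (1 / (\<tau> + 2)))"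
proof -
  obtain n \<eta> V where n: "norm n = 1" and \<eta>: "\<eta> > 0" and V: "open V" "a0 \<in> V"
    and sup: "\<And>x. x \<in> closure \<Omega> \<Longrightarrow> 0 \<le> (x - a0) \<bullet> n"
    and par: "\<And>x. x \<in> frontier \<Omega> \<Longrightarrow> x \<in> V \<Longrightarrow>
        (x - a0) \<bullet> n \<ge> \<eta> * norm ((x - a0) - ((x - a0) \<bullet> n) *\<^sub>R n) powr (\<tau> + 2)"
    using supp unfolding local_parabolic_support_def by auto
  have nn: "n \<bullet> n = 1" using n by (simp add: norm_eq_1)
  define a where "a = 1 / (\<tau> + 2)"
  have a: "0 < a" "a \<le> 1" "(\<tau> + 2) * a = 1" using \<tau> by (auto simp: a_def)
  define f where "f y = (y - a0) \<bullet> n" for y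
  obtain r' where r': "r' > 0" "ball a0 r' \<subseteq> V" using V open_contains_ball by blast
  \<comment> \<open>Descending along \<open>-n\<close> by at most
    \<open>f y \<le> norm (y - a0)\<close> at most doubles the distance to \<open>a0\<close>, so
    points within \<open>r\<close> end up in \<open>V\<close>, where the parabolic bound
    holds.\<close>
  define r where "r = min 1 (r' / 3)"
  have r: "r > 0" "r \<le> 1" "2 * r < r'" using r' by (auto simp: r_def min_def)
  obtain B' where B': "\<And>y. y \<in> closure \<Omega> \<Longrightarrow> norm y \<le> B'"
    using bounded_closure[OF \<Omega>(1)] unfolding bounded_iff by blast
  define B where "B = max 1 (B' + norm a0)"
  have B: "1 \<le> B" "norm (y - a0) \<le> B" if "y \<in> closure \<Omega>" for y
    using B'[OF that] norm_triangle_ineq4[of y a0] by (auto simp: B_def)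
  have a0c: "a0 \<in> closure \<Omega>" using a0 by (simp add: frontier_def)
  have B1: "1 \<le> B" by (simp add: B_def)
  have fle: "f y \<le> norm (y - a0)" for y using norm_cauchy_schwarz[of "y - a0" n] n by (simp add: f_def)
  have f0: "0 \<le> f y" if "y \<in> closure \<Omega>" for y using sup[OF that] by (simp add: f_def)
  define C1 where "C1 = \<eta> powr (- a) + B"
  have C1: "1 \<le> C1" using B1 by (simp add: C1_def add_increasing)
  have near: "norm (y - a0) \<le> C1 * f y powr a" if y: "y \<in> closure \<Omega>" "norm (y - a0) \<le> r" for y
  proof -
    obtain s where s: "0 \<le> s" "s \<le> f y" "y - s *\<^sub>R n \<in> frontier \<Omega>"
      using exit_point[OF \<Omega>(1) n sup y(1)] unfolding f_def by blast
    define z where "z = y - s *\<^sub>R n"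
    have zf: "z \<in> frontier \<Omega>" using s by (simp add: z_def)
    have "norm (z - a0) \<le> norm (y - a0) + s"
      using norm_triangle_ineq4[of "y - a0" "s *\<^sub>R n"] s n by (simp add: z_def algebra_simps)
    then have "norm (z - a0) < r'" using s(2) fle[of y] y(2) r by linarith
    then have zV: "z \<in> V" using r'(2) by (auto simp: dist_norm norm_minus_commute)
    have fz: "f z = f y - s" by (simp add: f_def z_def inner_diff_left nn)
    define P where "P = norm ((y - a0) - f y *\<^sub>R n)"
    \<comment> \<open>Descending along \<open>n\<close> does not change the tangential part, so the
      bound at the frontier point \<open>z\<close> controls that of \<open>y\<close>.\<close>
    have eq: "(z - a0) - f z *\<^sub>R n = (y - a0) - f y *\<^sub>R n"
      unfolding fz by (simp add: z_def algebra_simps)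
    have "\<eta> * P powr (\<tau> + 2) \<le> f z" using par[OF zf zV, folded f_def] unfolding P_def eq .
    also have "\<dots> \<le> f y" using fz s by simp
    finally have "P powr (\<tau> + 2) \<le> f y / \<eta>" using \<eta> by (simp add: field_simps)
    then have "(P powr (\<tau> + 2)) powr a \<le> (f y / \<eta>) powr a" using a by (intro powr_mono2) auto
    then have P: "P \<le> f y powr a * \<eta> powr (- a)"
      using f0[OF y(1)] \<eta> a(3) by (simp add: P_def powr_powr powr_divide powr_minus_divide)
    have fB: "f y \<le> B * f y powr a"
    proof (cases "f y \<le> 1")
      case True
      have "f y powr 1 \<le> f y powr a" using True f0[OF y(1)] a by (intro powr_mono') auto
      also have "\<dots> \<le> B * f y powr a" using B1 by (simp add: mult_le_cancel_right1)
      finally show ?thesis using f0[OF y(1)] by simp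
    next
      case False
      then have "1 \<le> f y powr a" using a by (intro ge_one_powr_ge_zero) auto
      then have "B * 1 \<le> B * f y powr a" using B1 by (intro mult_left_mono) auto
      then show ?thesis using fle[of y] B(2)[OF y(1)] by linarith
    qed
    have "norm (y - a0) \<le> P + norm (f y *\<^sub>R n)"
      using norm_triangle_ineq[of "(y - a0) - f y *\<^sub>R n" "f y *\<^sub>R n"] by (simp add: P_def)
    also have "\<dots> = P + f y" using n f0[OF y(1)] by simp
    also have "\<dots> \<le> C1 * f y powr a" using P fB by (simp add: C1_def algebra_simps)
    finally show ?thesis .
  qed
  define C where "C = C1 * (B / r)"
  have BR: "1 \<le> B / r" using B1 r by (simp add: field_simps)
  have C: "1 \<le> C" "C1 \<le> C" using mult_mono[OF C1 BR] mult_left_mono[OF BR, of C1] C1 by (auto simp: C_def)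
  have all: "norm (y - a0) \<le> C * f y powr a" if y: "y \<in> closure \<Omega>" for y
  proof (cases "norm (y - a0) \<le> r")
    case True
    have "C1 * f y powr a \<le> C * f y powr a" using C by (intro mult_right_mono) auto
    then show ?thesis using near[OF y True] by simp
  next
    case False
    \<comment> \<open>Contraction towards \<open>a0\<close> onto the sphere of radius
      \<open>r\<close>: by convexity the image stays in the closure, and its height is no larger
      than that of \<open>y\<close>, so \<open>near\<close> bounds the height of \<open>y\<close>
      from below.\<close>
    define s where "s = r / norm (y - a0)"
    have s: "0 < s" "s \<le> 1" "s * norm (y - a0) = r" using False r order_less_trans[OF r(1), of "norm (y - a0)"] by (auto simp: s_def not_le divide_le_eq)
    define w where "w = (1 - s) *\<^sub>R a0 + s *\<^sub>R y"
    have w: "w \<in> closure \<Omega>" unfolding w_def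
      using convex_closure[OF \<Omega>(2)] y a0c s by (intro convexD_alt) auto
    have wa: "w - a0 = s *\<^sub>R (y - a0)" by (simp add: w_def algebra_simps)
    have nw: "norm (w - a0) = r" using s by (simp add: wa)
    have fw: "f w = s * f y" unfolding f_def wa by simp
    have "f w \<le> f y" using s f0[OF y] unfolding fw by (simp add: mult_left_le_one_le)
    then have "f w powr a \<le> f y powr a" using f0[OF w] a by (intro powr_mono2) auto
    then have "C1 * f w powr a \<le> C1 * f y powr a" using C1 by (intro mult_left_mono) auto
    then have rle: "r \<le> C1 * f y powr a" using near[OF w] nw by simp
    have "norm (y - a0) \<le> (B / r) * r" using B(2)[OF y] r by simp
    also have "\<dots> \<le> (B / r) * (C1 * f y powr a)" using rle BR by (intro mult_left_mono) auto
    finally show ?thesis by (simp add: C_def mult_ac)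
  qed
  show ?thesis using n C(1) all f0 unfolding f_def a_def by blast
qed

text \<open>About \<open>T powr a / T\<close> disjoint translates of the cap \<open>{y. (y - a0) \<bullet> n \<le> T}\<close> along \<open>n\<close> fit into a ball of radius
  comparable to \<open>T powr a\<close>.\<close>

lemma cap_volume:
  fixes Q :: "'a::euclidean_space set"
  assumes n: "norm n = 1" and C: "1 \<le> C" and a: "0 < a" "a \<le> 1" and T: "0 < T" "T \<le> 1" and Q: "Q \<in> sets borel"
    and Q0: "\<And>y. y \<in> Q \<Longrightarrow> 0 \<le> (y - a0) \<bullet> n" "\<And>y. y \<in> Q \<Longrightarrow> (y - a0) \<bullet> n \<le> T"
    and geom: "\<And>y. y \<in> Q \<Longrightarrow> norm (y - a0) \<le> C * ((y - a0) \<bullet> n) powr a"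
  shows "emeasure lborel Q \<le> ennreal (unit_ball_vol DIM('a) * 5 ^ DIM('a) * C ^ (DIM('a) - 1) * T powr (1 + a * (real DIM('a) - 1)))"
proof -
  have nn: "n \<bullet> n = 1" using n by (simp add: norm_eq_1)
  define r where "r = C * T powr a"
  have "T powr 1 \<le> T powr a" using T a by (intro powr_mono') auto
  then have "1 * T \<le> r" unfolding r_def using C T by (intro mult_mono) auto
  then have r: "T \<le> r" "0 < r" using T by auto
  have Qr: "norm (y - a0) \<le> r" if "y \<in> Q" for y
  proof -
    have "((y - a0) \<bullet> n) powr a \<le> T powr a" using Q0[OF that] a by (intro powr_mono2) auto
    then have "C * ((y - a0) \<bullet> n) powr a \<le> r" unfolding r_def using C by (intro mult_left_mono) auto
    then show ?thesis using geom[OF that] by simp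
  qed
  define N where "N = nat \<lceil>r / T\<rceil>"
  have N: "r / T \<le> real N" "real N \<le> r / T + 1"
    using r T unfolding N_def by (auto simp: real_nat_ceiling_ge)
  have NT: "real N * T \<le> 2 * r" using mult_right_mono[OF N(2), of T] T r by (simp add: distrib_right)
  have bdd: "bounded Q" using Qr by (intro boundedI[where B="r + norm a0"]) (metis add.commute diff_le_eq norm_triangle_ineq2 order_trans)
  then have Qm: "Q \<in> lmeasurable" using Q by (intro bounded_set_imp_lmeasurable) auto
  have "real N * measure lebesgue Q \<le> measure lebesgue (cball a0 (5 * r))"
  \<comment> \<open>Heights in \<open>Q\<close> range over an interval of length \<open>T\<close>,
    so shifts by multiples of \<open>2 * T\<close> along \<open>n\<close> are disjoint. The total
    shift is at most \<open>2 * N * T \<le> 4 * r\<close>; with the radius \<open>r\<close> of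
    \<open>Q\<close> this makes \<open>5 * r\<close>.\<close>
  proof (rule measure_disjoint_translates_le[OF Qm, where c="\<lambda>i. (2 * T * real i) *\<^sub>R n"])
    fix i j :: nat and x y assume ij: "i < j" and xy: "x \<in> Q" "y \<in> Q"
    show "(2 * T * real i) *\<^sub>R n + x \<noteq> (2 * T * real j) *\<^sub>R n + y"
    proof
      assume "(2 * T * real i) *\<^sub>R n + x = (2 * T * real j) *\<^sub>R n + y"
      then have "((2 * T * real i) *\<^sub>R n + x - a0) \<bullet> n = ((2 * T * real j) *\<^sub>R n + y - a0) \<bullet> n" by simp
      then have "2 * T * real i + (x - a0) \<bullet> n = 2 * T * real j + (y - a0) \<bullet> n"
        by (simp add: inner_add_left inner_diff_left nn)
      moreover have "2 * T * (real i + 1) \<le> 2 * T * real j" using ij T by (intro mult_left_mono) auto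
      ultimately show False using Q0(2)[OF xy(1)] Q0(1)[OF xy(2)] T by (simp add: distrib_left)
    qed
  next
    fix i :: nat and x assume ix: "i < N" "x \<in> Q"
    have "norm ((2 * T * real i) *\<^sub>R n + x - a0) \<le> 2 * T * real i + norm (x - a0)"
      using norm_triangle_ineq[of "(2 * T * real i) *\<^sub>R n" "x - a0"] n T by (simp add: algebra_simps)
    moreover have "2 * T * real i \<le> 2 * (real N * T)" using ix T by simp
    ultimately show "(2 * T * real i) *\<^sub>R n + x \<in> cball a0 (5 * r)"
      using Qr[OF ix(2)] NT r by (simp add: dist_norm norm_minus_commute)
  qed simp
  also have "\<dots> = unit_ball_vol DIM('a) * (5 * r) ^ DIM('a)" using r by (simp add: content_cball)
  finally have *: "real N * measure lebesgue Q \<le> unit_ball_vol DIM('a) * (5 * r) ^ DIM('a)" .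
  have dpos: "DIM('a) = Suc (DIM('a) - 1)" by simp
  have "(r / T) * measure lebesgue Q \<le> real N * measure lebesgue Q" using N by (intro mult_right_mono) auto
  also note *
  finally have "measure lebesgue Q \<le> unit_ball_vol DIM('a) * (5 * r) ^ DIM('a) * (T / r)"
    using r T by (simp add: field_simps)
  also have "\<dots> = unit_ball_vol DIM('a) * 5 ^ DIM('a) * (T * r ^ (DIM('a) - 1))"
  proof -
    have "r ^ DIM('a) = r * r ^ (DIM('a) - 1)" using power_minus_mult[of "DIM('a)" r] by (simp add: mult.commute)
    then show ?thesis using r by (simp add: power_mult_distrib)
  qed
  also have "T * r ^ (DIM('a) - 1) = C ^ (DIM('a) - 1) * T powr (1 + a * (real DIM('a) - 1))"
  proof -
    have "(T powr a) ^ (DIM('a) - 1) = T powr (a * (real DIM('a) - 1))"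
      using T by (simp add: powr_powr powr_realpow[symmetric] of_nat_diff Suc_leI)
    then show ?thesis using T by (simp add: r_def power_mult_distrib powr_add)
  qed
  finally have "measure lebesgue Q \<le> unit_ball_vol DIM('a) * 5 ^ DIM('a) * C ^ (DIM('a) - 1) * T powr (1 + a * (real DIM('a) - 1))"
    by (simp add: mult_ac)
  moreover have "emeasure lborel Q = ennreal (measure lebesgue Q)"
  proof -
    have "emeasure lebesgue Q = emeasure lborel Q" using Q by simp
    then show ?thesis using emeasure_eq_measure2[OF Qm] by simp
  qed
  ultimately show ?thesis by (simp add: ennreal_leI)
qed

lemma R_measure_ball_ge:
  fixes R :: "'a::euclidean_space \<Rightarrow> real"
  assumes "0 \<le> c" "0 \<le> \<rho>" "\<And>p. p \<in> ball z \<rho> \<Longrightarrow> c \<le> R p"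
  shows "ennreal (c * (unit_ball_vol DIM('a) * \<rho> ^ DIM('a))) \<le> R_measure R (ball z \<rho>)"
proof -
  have "ennreal (c * (unit_ball_vol DIM('a) * \<rho> ^ DIM('a))) = ennreal c * emeasure lebesgue (ball z \<rho>)"
    using assms(1,2) by (simp add: emeasure_ball ennreal_mult)
  also have "\<dots> = (\<integral>\<^sup>+ p. ennreal c * indicator (ball z \<rho>) p \<partial>lebesgue)"
    by (subst nn_integral_cmult_indicator) auto
  also have "\<dots> \<le> R_measure R (ball z \<rho>)"
    unfolding R_measure_def using assms(3) by (intro nn_integral_mono) (auto simp: indicator_def ennreal_leI)
  finally show ?thesis .
qed

text \<open>The steep slopes \<open>-(c0 + s) n + q\<close>, \<open>s\<close> ranging over the \<open>J\<close> dyadic shells below \<open>\<omega> / T\<close>; each shell contains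
  about \<open>T powr (a - 1)\<close> disjoint balls of radius comparable to \<open>s * T powr (1 - a)\<close>.\<close>

lemma steep_slopes_mass:
  fixes R :: "'a::euclidean_space \<Rightarrow> real"
  assumes R: "R \<in> borel_measurable lebesgue" and n: "norm n = 1" and C: "1 \<le> C" and a: "0 < a" "a \<le> 1"
    and T: "0 < T" "T \<le> 1" and k: "0 \<le> k" "0 < C0" and growth: "\<And>p. norm p \<ge> r0 \<Longrightarrow> R p \<ge> C0 * norm p powr (- 2 * k)"
    and \<omega>: "0 < \<omega>" and c0: "0 \<le> c0" and J: "J = 1 \<or> real DIM('a) \<le> 2 * k"
    and big: "c0 \<le> \<omega> / T / 2 ^ J" "r0 \<le> \<omega> / T / 2 ^ J"
  defines "c1 \<equiv> C * C0 * 3 powr (- 2 * k) * unit_ball_vol DIM('a) / (8 * C) ^ DIM('a)"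
  obtains P where "P \<in> sets lebesgue"
    "\<And>p. p \<in> P \<Longrightarrow> \<exists>s q. p = q - (c0 + s) *\<^sub>R n \<and> norm q \<le> s * T powr (1 - a) / (4 * C) \<and> \<omega> / T / 2 ^ J \<le> s \<and> s \<le> \<omega> / T"
    "ennreal (real J * c1 * \<omega> powr (real DIM('a) - 2 * k) * T powr (2 * k - (1 + a * (real DIM('a) - 1)))) \<le> R_measure R P"
proof -
  have nn: "n \<bullet> n = 1" using n by (simp add: norm_eq_1)
  have dim: "real DIM('a) \<ge> 1" by (simp add: Suc_leI)
  define S where "S l = \<omega> / T / 2 ^ l" for l :: nat
  \<comment> \<open>Half of the permitted ratio of tilt to steepness: a ball of shell
    \<open>l\<close> has radius \<open>S l * b\<close>, whereas the steepness of its centre is only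
    known to be at least \<open>S l / 2\<close>.\<close>
  define b where "b = T powr (1 - a) / (8 * C)"
  have "T powr (1 - a) \<le> 1" using T a by (intro powr_le1) auto
  then have b: "0 < b" "b \<le> 1 / 8" using T C by (auto simp: b_def field_simps)
  \<comment> \<open>Number of balls of diameter \<open>2 * S l * b\<close> that fit along
    \<open>n\<close> into a shell of thickness \<open>S l / 2\<close>; it is the same for all shells
    and of order \<open>T powr (a - 1)\<close>.\<close>
  define N where "N = nat \<lfloor>1 / (4 * b)\<rfloor>"
  have "1 \<le> 1 / (4 * b)" using b by (simp add: field_simps)
  then have "1 \<le> \<lfloor>1 / (4 * b)\<rfloor>" by (simp add: le_floor_iff)
  then have N1: "real N \<le> 1 / (4 * b)" "1 / (4 * b) \<le> real N + 1" "1 \<le> real N"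
    unfolding N_def by linarith+
  have N: "real N * (4 * b) \<le> 1" "C * T powr (a - 1) \<le> real N"
  proof -
    show "real N * (4 * b) \<le> 1" using N1(1) b by (simp add: field_simps)
    have "1 / (8 * b) = C * T powr (a - 1)" using C T by (simp add: b_def powr_diff field_simps powr_minus)
    moreover have "1 / (4 * b) = 2 * (1 / (8 * b))" by simp
    ultimately show "C * T powr (a - 1) \<le> real N" using N1 by linarith
  qed
  define \<rho> where "\<rho> l = S l * b" for l
  define \<sigma> where "\<sigma> l i = S l / 2 + (2 * real i + 1) * \<rho> l" for l i :: nat
  define B where "B = (\<lambda>(l, i). ball (- (c0 + \<sigma> l i) *\<^sub>R n) (\<rho> l))"
  have Spos: "0 < S l" "0 < \<rho> l" for l using T \<omega> b by (auto simp: S_def \<rho>_def)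
  have SSuc: "S (Suc l) = S l / 2" for l by (simp add: S_def)
  have Santi: "S l' \<le> S l" if "l \<le> l'" for l l'
    using that T \<omega> by (auto simp: S_def intro!: divide_left_mono power_increasing)
  have \<sigma>: "S l / 2 + \<rho> l \<le> \<sigma> l i" "\<sigma> l i + \<rho> l \<le> S l" if "i < N" for l i
  proof -
    show "S l / 2 + \<rho> l \<le> \<sigma> l i" using Spos[of l] by (simp add: \<sigma>_def)
    have "(2 * real i + 2) * \<rho> l \<le> (2 * real N) * \<rho> l" using that Spos[of l] by (intro mult_right_mono) auto
    also have "\<dots> = (real N * (4 * b)) * (S l / 2)" by (simp add: \<rho>_def)
    also have "\<dots> \<le> 1 * (S l / 2)" using N(1) Spos[of l] by (intro mult_right_mono) auto
    finally show "\<sigma> l i + \<rho> l \<le> S l" by (simp add: \<sigma>_def algebra_simps)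
  qed
  \<comment> \<open>Reads the steepness off the normal component of a slope; its value singles out
    the shell and the ball, which makes all balls disjoint.\<close>
  define h where "h p = - (p \<bullet> n) - c0" for p
  have normq: "norm (p + c *\<^sub>R n) = dist (- c *\<^sub>R n) p" for p c
    using norm_minus_commute[of p "- c *\<^sub>R n"] by (simp add: dist_norm)
  have hB: "\<bar>h p - \<sigma> l i\<bar> < \<rho> l" if "p \<in> B (l, i)" for p l i
  proof -
    define q where "q = p + (c0 + \<sigma> l i) *\<^sub>R n"
    have "norm q < \<rho> l" using that unfolding q_def normq by (simp add: B_def)
    moreover have "q \<bullet> n = - (h p - \<sigma> l i)" by (simp add: q_def h_def inner_add_left nn)
    moreover have "\<bar>q \<bullet> n\<bar> \<le> norm q" using Cauchy_Schwarz_ineq2[of q n] n by simp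
    ultimately show ?thesis by simp
  qed
  define X where "X = {..<J} \<times> {..<N}"
  have fX: "finite X" by (simp add: X_def)
  have disj: "disjoint_family_on B X" unfolding disjoint_family_on_def
  proof (intro ballI impI)
    fix x y assume "x \<in> X" "y \<in> X" "x \<noteq> y"
    then obtain l i l' i' where xy: "x = (l, i)" "y = (l', i')" "i < N" "i' < N" by (auto simp: X_def)
    show "B x \<inter> B y = {}"
    proof (rule ccontr)
      assume "B x \<inter> B y \<noteq> {}"
      then obtain p where p: "p \<in> B (l, i)" "p \<in> B (l', i')" using xy by auto
      have hl: "S l / 2 < h p" "h p < S l" "S l' / 2 < h p" "h p < S l'"
        using hB[OF p(1)] hB[OF p(2)] \<sigma>[OF xy(3), of l] \<sigma>[OF xy(4), of l'] by linarith+
      have "\<not> l < l'" "\<not> l' < l" using hl Santi[of "Suc l" l'] Santi[of "Suc l'" l] SSuc[of l] SSuc[of l'] by auto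
      then have ll: "l = l'" by simp
      then have ii: "i \<noteq> i'" using \<open>x \<noteq> y\<close> xy by simp
      have ne: False if "j < j'" "\<bar>h p - \<sigma> l j\<bar> < \<rho> l" "\<bar>h p - \<sigma> l j'\<bar> < \<rho> l" for j j'
      proof -
        have "(2 * real j + 2) * \<rho> l \<le> (2 * real j') * \<rho> l" using that(1) Spos[of l] by (intro mult_right_mono) auto
        then have "\<sigma> l j + 2 * \<rho> l \<le> \<sigma> l j'" by (simp add: \<sigma>_def algebra_simps)
        then show False using that(2,3) by linarith
      qed
      show False using ne[of i i'] ne[of i' i] ii hB[OF p(1)] hB[OF p(2)] ll by (cases "i < i'") auto
    qed
  qed
  define P where "P = (\<Union>x\<in>X. B x)"
  have Bl: "B x \<in> sets lebesgue" for x by (auto simp: B_def split: prod.split)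
  show ?thesis
  proof (rule that[of P])
    show "P \<in> sets lebesgue" unfolding P_def using fX Bl by (intro sets.finite_UN) auto
    fix p assume "p \<in> P"
    then obtain l i where li: "l < J" "i < N" "p \<in> B (l, i)" unfolding P_def X_def by auto
    define q where "q = p + (c0 + \<sigma> l i) *\<^sub>R n"
    have sl: "S J \<le> \<sigma> l i" "\<sigma> l i \<le> \<omega> / T"
      using \<sigma>[OF li(2), of l] Spos[of l] Santi[of "Suc l" J] SSuc[of l] Santi[of 0 l] li(1) by (auto simp: S_def)
    have "norm q \<le> \<rho> l" using li(3) unfolding q_def normq by (simp add: B_def)
    also have "\<dots> \<le> (2 * \<sigma> l i) * b" unfolding \<rho>_def using b \<sigma>(1)[OF li(2), of l] Spos[of l] by (intro mult_right_mono) auto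
    also have "\<dots> = \<sigma> l i * T powr (1 - a) / (4 * C)" by (simp add: b_def)
    finally have "norm q \<le> \<sigma> l i * T powr (1 - a) / (4 * C)" .
    moreover have "p = q - (c0 + \<sigma> l i) *\<^sub>R n" by (simp add: q_def)
    ultimately show "\<exists>s q. p = q - (c0 + s) *\<^sub>R n \<and> norm q \<le> s * T powr (1 - a) / (4 * C) \<and> \<omega> / T / 2 ^ J \<le> s \<and> s \<le> \<omega> / T"
      using sl unfolding S_def by blast
  next
    define E where "E = T powr (2 * k - (1 + a * (real DIM('a) - 1)))"
    define V where "V l = C0 * (3 * S l) powr (- 2 * k) * (unit_ball_vol DIM('a) * \<rho> l ^ DIM('a))" for l
    have one: "ennreal (V l) \<le> R_measure R (B (l, i))" if li: "l < J" "i < N" for l i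
      unfolding V_def B_def prod.case
    proof (rule R_measure_ball_ge)
      show "0 \<le> C0 * (3 * S l) powr (- 2 * k)" using k by simp
      show "0 \<le> \<rho> l" using Spos[of l] by simp
      fix p assume "p \<in> ball (- (c0 + \<sigma> l i) *\<^sub>R n) (\<rho> l)"
      then have p: "p \<in> B (l, i)" by (simp add: B_def)
      have SJ: "S J \<le> S l / 2" using Santi[of "Suc l" J] SSuc[of l] li by simp
      have hp: "S l / 2 < h p" "h p < S l" using hB[OF p] \<sigma>[OF li(2), of l] by linarith+
      have "h p + c0 \<le> norm p" using Cauchy_Schwarz_ineq2[of p n] n by (simp add: h_def)
      then have np1: "r0 \<le> norm p" "0 < norm p" using hp SJ big(2) c0 Spos[of l] by (auto simp: S_def)
      have "norm p \<le> norm (p - (- (c0 + \<sigma> l i) *\<^sub>R n)) + norm (- (c0 + \<sigma> l i) *\<^sub>R n)"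
        using norm_triangle_ineq[of "p - (- (c0 + \<sigma> l i) *\<^sub>R n)" "- (c0 + \<sigma> l i) *\<^sub>R n"] by simp
      also have "\<dots> \<le> \<rho> l + (c0 + \<sigma> l i)"
        using p n c0 \<sigma>(1)[OF li(2), of l] Spos[of l] by (simp add: B_def dist_norm norm_minus_commute[of _ p])
      also have "\<dots> \<le> 3 * S l" using \<sigma>(2)[OF li(2), of l] big(1)[folded S_def] SJ Spos[of l] by linarith
      finally have "(3 * S l) powr (- 2 * k) \<le> norm p powr (- 2 * k)"
        using np1 k by (intro powr_mono2') auto
      then have "C0 * (3 * S l) powr (- 2 * k) \<le> C0 * norm p powr (- 2 * k)" using k by (intro mult_left_mono) auto
      then show "C0 * (3 * S l) powr (- 2 * k) \<le> R p" using growth[OF np1(1)] by simp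
    qed
    have Vl: "c1 * \<omega> powr (real DIM('a) - 2 * k) * E \<le> real N * V l" if l: "l < J" for l
    proof -
      define d where "d = real DIM('a)"
      have pw: "x ^ DIM('a) = x powr d" if "x > 0" for x using that by (simp add: d_def powr_realpow)
      have "V l = C0 * 3 powr (- 2 * k) * unit_ball_vol DIM('a) * (S l powr (- 2 * k) * S l powr d) * b powr d"
        unfolding V_def \<rho>_def using Spos[of l] b by (simp add: pw powr_mult power_mult_distrib)
      also have "S l powr (- 2 * k) * S l powr d = S l powr (d - 2 * k)"
        by (simp add: powr_add[symmetric])
      also have "b powr d = T powr ((1 - a) * d) / (8 * C) ^ DIM('a)"
      proof -
        have "b powr d = (T powr (1 - a)) powr d / (8 * C) powr d" unfolding b_def by (rule powr_divide)
        moreover have "(8 * C) powr d = (8 * C) ^ DIM('a)" using pw[of "8 * C"] C by simp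
        ultimately show ?thesis by (simp only: powr_powr)
      qed
      finally have Veq: "V l = (c1 / C) * S l powr (d - 2 * k) * T powr ((1 - a) * d)"
        using C by (simp add: c1_def)
      have c1: "0 \<le> c1 / C" using C k by (simp add: c1_def)
      \<comment> \<open>With one shell this is an equality. With several, the exponent is
        nonpositive, so the less steep shells weigh at least as much as the steepest one; this gives
        the factor \<open>J\<close>.\<close>
      have Sge: "(\<omega> / T) powr (d - 2 * k) \<le> S l powr (d - 2 * k)" using J
      proof
        assume "J = 1"
        then show ?thesis using l by (simp add: S_def)
      next
        assume "real DIM('a) \<le> 2 * k"
        moreover have "S l \<le> \<omega> / T" using Santi[of 0 l] by (simp add: S_def)
        ultimately show ?thesis using Spos[of l] by (intro powr_mono2') (auto simp: d_def)
      qed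
      have "(c1 / C) * (\<omega> / T) powr (d - 2 * k) * T powr ((1 - a) * d) \<le> V l"
        unfolding Veq using Sge c1 by (intro mult_right_mono mult_left_mono) auto
      moreover have "0 \<le> (c1 / C) * (\<omega> / T) powr (d - 2 * k) * T powr ((1 - a) * d)" by (intro mult_nonneg_nonneg c1) auto
      ultimately have "(C * T powr (a - 1)) * ((c1 / C) * (\<omega> / T) powr (d - 2 * k) * T powr ((1 - a) * d)) \<le> real N * V l"
        using N(2) by (intro mult_mono) auto
      moreover have "(C * T powr (a - 1)) * ((c1 / C) * (\<omega> / T) powr (d - 2 * k) * T powr ((1 - a) * d)) =
          c1 * \<omega> powr (d - 2 * k) * (T powr (a - 1) * T powr (- (d - 2 * k)) * T powr ((1 - a) * d))"
      proof -
        have "(\<omega> / T) powr (d - 2 * k) = \<omega> powr (d - 2 * k) * T powr (- (d - 2 * k))"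
          by (simp only: powr_divide powr_minus_divide) simp
        then show ?thesis using C by simp
      qed
      moreover have "T powr (a - 1) * T powr (- (d - 2 * k)) * T powr ((1 - a) * d) = E"
        unfolding E_def d_def[symmetric] powr_add[symmetric] by (rule arg_cong[where f="\<lambda>e. T powr e"]) (simp add: algebra_simps)
      ultimately show ?thesis by (simp add: d_def)
    qed
    have "real J * (c1 * \<omega> powr (real DIM('a) - 2 * k) * E) = (\<Sum>l<J. c1 * \<omega> powr (real DIM('a) - 2 * k) * E)" by simp
    also have "\<dots> \<le> (\<Sum>l<J. real N * V l)" using Vl by (intro sum_mono) auto
    also have "\<dots> = (\<Sum>l<J. \<Sum>i<N. V l)" by simp
    also have "\<dots> = (\<Sum>x\<in>X. V (fst x))" unfolding X_def sum.cartesian_product by (simp add: case_prod_unfold)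
    finally have "ennreal (real J * (c1 * \<omega> powr (real DIM('a) - 2 * k) * E)) \<le> ennreal (\<Sum>x\<in>X. V (fst x))"
      by (rule ennreal_leI)
    also have "\<dots> = (\<Sum>x\<in>X. ennreal (V (fst x)))"
      using k Spos by (intro sum_ennreal[symmetric]) (auto simp: V_def less_imp_le)
    also have "\<dots> \<le> (\<Sum>x\<in>X. R_measure R (B x))" using one by (intro sum_mono) (auto simp: X_def)
    also have "\<dots> = R_measure R P" unfolding P_def by (rule R_measure_disjoint_UN[OF R fX Bl disj, symmetric])
    finally show "ennreal (real J * c1 * \<omega> powr (real DIM('a) - 2 * k) * T powr (2 * k - (1 + a * (real DIM('a) - 1)))) \<le> R_measure R P"
      by (simp add: E_def mult.assoc)
  qed
qed

section \<open>Bounds and boundary barriers\<close>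

context fe_sequence
begin

lemma closure_D_split: "x \<in> closure (D j) \<Longrightarrow> x \<in> D j \<or> x \<in> frontier (D j)"
  using mesh_over.open_U[OF mesh_over_\<T>[of j]] by (auto simp: frontier_def interior_open)

text \<open>Lower the plane of slope \<open>p\<close> through the point over \<open>x\<close> until
  it supports the graph over the closure. It starts strictly below the boundary values, so it cannot
  touch at the frontier.\<close>

lemma touching_slope:
  assumes x: "x \<in> D j" and p: "\<And>y. y \<in> frontier (D j) \<Longrightarrow> v j y > v j x + p \<bullet> (y - x)"
  shows "\<exists>y\<in>D j. p \<in> subdiff (D j) (v j) y \<and> v j y \<le> v j x + p \<bullet> (y - x)"
proof -
  have xc: "x \<in> closure (D j)" using x closure_subset by blast
  have "continuous_on (closure (D j)) (\<lambda>y. v j y - p \<bullet> y)" using v_cont by (intro continuous_intros)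
  moreover have "closure (D j) \<noteq> {}" using xc by auto
  ultimately have "\<exists>y\<in>closure (D j). \<forall>z\<in>closure (D j). v j y - p \<bullet> y \<le> v j z - p \<bullet> z"
    by (intro continuous_attains_inf mesh_over.compact_closure_U[OF mesh_over_\<T>])
  then obtain y where y: "y \<in> closure (D j)" "\<And>z. z \<in> closure (D j) \<Longrightarrow> v j y - p \<bullet> y \<le> v j z - p \<bullet> z"
    by blast
  have le: "v j y \<le> v j x + p \<bullet> (y - x)" using y(2)[OF xc] by (simp add: inner_diff_right)
  then have "y \<notin> frontier (D j)" using p[of y] by auto
  then have "y \<in> D j" using closure_D_split[OF y(1)] by blast
  moreover have "p \<in> subdiff (D j) (v j) y" unfolding subdiff_def
  proof (intro CollectI ballI)
    fix z assume "z \<in> D j"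
    then have "v j y - p \<bullet> y \<le> v j z - p \<bullet> z" using y(2) closure_subset by blast
    then show "v j y + p \<bullet> (z - y) \<le> v j z" by (simp add: inner_diff_right)
  qed
  ultimately show ?thesis using le by blast
qed

lemma R_measure_le_cover:
  assumes "P \<subseteq> subdiff_set (D j) (v j) E" "E \<subseteq> D j" "F \<in> sets \<mu>"
    "\<And>x y. x \<in> D j \<Longrightarrow> y \<in> E \<Longrightarrow> dist x y \<le> hs j \<Longrightarrow> x \<in> F" shows "R_measure R P \<le> emeasure \<mu> F"
proof -
  obtain P' where P': "\<And>p. p \<in> subdiff_set (D j) (v j) E \<Longrightarrow> p \<in> P' \<or> p \<in> overlap (D j) (v j)" "R_measure R P' \<le> emeasure \<mu> F"
    using mesh_over.R_measure_subdiff_set_le[OF mesh_over_\<T> mu_sets fe_v R_meas assms(3) _ assms(2)] assms(4) by metis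
  have "R_measure R P \<le> R_measure R (P' \<union> overlap (D j) (v j))"
    using assms(1) P'(1) by (intro R_measure_mono) blast
  also have "\<dots> = R_measure R P'" by (rule R_measure_Un_negligible[OF negligible_overlap[OF mesh_over.bounded_U[OF mesh_over_\<T>]]])
  finally show ?thesis using P'(2) by simp
qed

lemma uniform_bound:
  assumes g: "\<And>y. y \<in> frontier \<Omega> \<Longrightarrow> \<bar>g y\<bar> \<le> Mg" shows "\<exists>M. \<forall>j. \<forall>x\<in>closure (D j). \<bar>v j x\<bar> \<le> M"
proof -
  obtain B where B: "\<And>y. y \<in> closure \<Omega> \<Longrightarrow> norm y \<le> B"
    using bounded_closure[OF bounded_dom] unfolding bounded_iff by blast
  have B0: "0 \<le> B"
  proof -
    obtain y where "y \<in> closure \<Omega>" using dom_nonempty closure_subset by blast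
    from order_trans[OF norm_ge_zero B[OF this]] show ?thesis .
  qed
  have "(\<Union>n. cball (0::'a) (real n)) = UNIV" using real_arch_simple by auto
  moreover have "incseq (\<lambda>n. cball (0::'a) (real n))" by (auto simp: incseq_def intro!: subset_cball)
  ultimately have "R_measure R UNIV = (SUP n. R_measure R (cball 0 (real n)))"
    using R_measure_UN_incseq[OF R_meas, of "\<lambda>n. cball 0 (real n)"] by simp
  \<comment> \<open>Balls exhaust the space of slopes, so one of some radius \<open>N\<close>
    carries more than the mass of \<Omega>. A plane with such a slope varies by at most
    \<open>N * (2 * B)\<close> over \<Omega>; through a point deeper than \<open>H\<close> it stays
    below all boundary values.\<close>
  then obtain N where N: "emeasure \<mu> \<Omega> < R_measure R (cball 0 (real N))"
    using mass by (auto simp: less_SUP_iff)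
  define H where "H = real N * (2 * B) + 1"
  have upper: "v j x \<le> Mg" if "x \<in> closure (D j)" for j x
    using mesh_over.H_space_le_affine[OF mesh_over_\<T> v_H that, where c=0 and a=Mg] g mesh_over.bv_subset[OF mesh_over_\<T>] by fastforce
  have fr: "- Mg \<le> v j x" if "x \<in> frontier (D j)" for j x
    using mesh_over.H_space_ge_affine_frontier[OF mesh_over_\<T> v_H that, where c=0 and a="- Mg"] g mesh_over.bv_subset[OF mesh_over_\<T>] by fastforce
  have lower: "- Mg - H \<le> v j x" if x: "x \<in> D j" for j x
  proof (rule ccontr)
    assume neg: "\<not> - Mg - H \<le> v j x"
    have "cball 0 (real N) \<subseteq> subdiff_set (D j) (v j) (D j)"
    proof
      fix p :: 'a assume "p \<in> cball 0 (real N)"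
      then have np: "norm p \<le> real N" by simp
      have "\<exists>y\<in>D j. p \<in> subdiff (D j) (v j) y \<and> v j y \<le> v j x + p \<bullet> (y - x)"
      proof (rule touching_slope[OF x])
        fix y assume y: "y \<in> frontier (D j)"
        then have yc: "y \<in> closure \<Omega>" using mesh_over.closure_U_subset[OF mesh_over_\<T>] unfolding frontier_def by blast
        have xc: "x \<in> closure \<Omega>" using x mesh_over.U_subset[OF mesh_over_\<T>] closure_subset by blast
        have "p \<bullet> (y - x) \<le> norm p * norm (y - x)" by (rule norm_cauchy_schwarz)
        also have "\<dots> \<le> real N * (2 * B)"
          using np B[OF yc] B[OF xc] norm_triangle_ineq4[of y x] by (intro mult_mono) auto
        finally show "v j x + p \<bullet> (y - x) < v j y" using fr[OF y] neg by (simp add: H_def)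
      qed
      then show "p \<in> subdiff_set (D j) (v j) (D j)" unfolding subdiff_set_def by blast
    qed
    then have "R_measure R (cball 0 (real N)) \<le> emeasure \<mu> \<Omega>"
      using mesh_over.U_subset[OF mesh_over_\<T>[of j]] sets.top[of \<mu>] by (intro R_measure_le_cover[where E="D j" and j=j]) (auto simp: space_mu)
    then show False using N by simp
  qed
  have H: "0 \<le> H" using B0 by (simp add: H_def)
  have "\<bar>v j x\<bar> \<le> \<bar>Mg\<bar> + H" if "x \<in> closure (D j)" for j x
    using upper[OF that] closure_D_split[OF that] lower[of x j] fr[of x j] H by fastforce
  then show ?thesis by blast
qed

end

text \<open>Of the geometry at \<open>a0\<close> only \<open>height\<close> and \<open>geom\<close>
  are kept, with \<open>a\<close> standing for \<open>1 / (\<tau> + 2)\<close>. Twice the critical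
  exponent is \<open>2 * K0 + lam\<close>, so \<open>expo\<close> says that \<open>k\<close> is
  subcritical, or critical with \<open>2 * k\<close> at least the dimension.\<close>

locale fe_boundary = fe_sequence +
  fixes a0 n :: 'a and C a K0 lam C1 \<rho> k C0 r0 :: real
  assumes g_cont: "continuous_on (frontier \<Omega>) g"
    and a0: "a0 \<in> frontier \<Omega>" and n: "norm n = 1" and C: "1 \<le> C" and a: "0 < a" "a \<le> 1"
    and height: "\<And>y. y \<in> closure \<Omega> \<Longrightarrow> 0 \<le> (y - a0) \<bullet> n"
    and geom: "\<And>y. y \<in> closure \<Omega> \<Longrightarrow> norm (y - a0) \<le> C * ((y - a0) \<bullet> n) powr a"
    and k: "0 \<le> k" and C0: "0 < C0" and growth: "\<And>p. norm p \<ge> r0 \<Longrightarrow> R p \<ge> C0 * norm p powr (- 2 * k)"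
    and lam: "0 \<le> lam" and C1: "0 < C1" and \<rho>: "0 < \<rho>"
    and dens: "\<And>e. e \<in> sets borel \<Longrightarrow> e \<subseteq> ball a0 \<rho> \<inter> \<Omega> \<Longrightarrow> emeasure \<mu> (e \<inter> \<Omega>) \<le>
            ennreal (C1 * (Sup ((\<lambda>x. infdist x (frontier \<Omega>)) ` e)) powr lam) * emeasure lborel e"
    and K0: "K0 = 1 + a * (real DIM('a) - 1)"
    and expo: "2 * k < 2 * K0 + lam \<or>
      (2 * k = 2 * K0 + lam \<and> real DIM('a) \<le> 2 * k)"
begin

abbreviation "f y \<equiv> (y - a0) \<bullet> n"

lemma g_bounded: "\<exists>Mg. \<forall>y\<in>frontier \<Omega>. \<bar>g y\<bar> \<le> Mg"
proof -
  have "compact (frontier \<Omega>)" using bounded_dom by (simp add: compact_frontier_bounded)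
  from compact_imp_bounded[OF compact_continuous_image[OF g_cont this]]
  show ?thesis unfolding bounded_iff by auto
qed

lemma small_height_near:
  assumes "d > 0" obtains t where "t > 0" "\<And>y. y \<in> closure \<Omega> \<Longrightarrow> f y \<le> t \<Longrightarrow> norm (y - a0) < d"
proof
  define t where "t = (d / (2 * C)) powr (1 / a)"
  show "t > 0" using assms C by (simp add: t_def)
  fix y assume y: "y \<in> closure \<Omega>" "f y \<le> t"
  have "f y powr a \<le> t powr a" using y height a by (intro powr_mono2) auto
  also have "t powr a = d / (2 * C)" using a assms C by (simp add: t_def powr_powr)
  finally have "C * f y powr a \<le> C * (d / (2 * C))" using C by (intro mult_left_mono) auto
  then show "norm (y - a0) < d" using geom[OF y(1)] C assms by simp
qed

text \<open>Continuity of \<open>g\<close> handles small heights; where the height exceeds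
  \<open>t\<close>, the term \<open>2 * Mg / t\<close> times the height dominates the whole
  oscillation of \<open>g\<close>.\<close>

lemma g_barrier:
  assumes "\<epsilon> > 0" obtains c where "0 \<le> c" "\<And>y. y \<in> frontier \<Omega> \<Longrightarrow> \<bar>g y - g a0\<bar> \<le> \<epsilon> + c * f y"
proof -
  obtain Mg where Mg: "\<And>y. y \<in> frontier \<Omega> \<Longrightarrow> \<bar>g y\<bar> \<le> Mg" using g_bounded by blast
  obtain d where d: "d > 0" "\<And>y. y \<in> frontier \<Omega> \<Longrightarrow> dist y a0 < d \<Longrightarrow> dist (g y) (g a0) < \<epsilon>"
    using g_cont a0 assms unfolding continuous_on_iff by blast
  obtain t where t: "t > 0" "\<And>y. y \<in> closure \<Omega> \<Longrightarrow> f y \<le> t \<Longrightarrow> norm (y - a0) < d"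
    using small_height_near[OF d(1)] by blast
  have Mg0: "0 \<le> Mg" using Mg[OF a0] by simp
  show ?thesis
  proof (rule that[of "2 * Mg / t"])
    show "0 \<le> 2 * Mg / t" using Mg0 t by simp
    fix y assume y: "y \<in> frontier \<Omega>"
    have yc: "y \<in> closure \<Omega>" using y by (simp add: frontier_def)
    show "\<bar>g y - g a0\<bar> \<le> \<epsilon> + 2 * Mg / t * f y"
    proof (cases "f y \<le> t")
      case True
      then have "\<bar>g y - g a0\<bar> < \<epsilon>" using t(2)[OF yc True] d(2)[OF y] by (simp add: dist_norm)
      moreover have "0 \<le> 2 * Mg / t * f y" using Mg0 t height[OF yc] by simp
      ultimately show ?thesis by linarith
    next
      case False
      then have "2 * Mg / t * t \<le> 2 * Mg / t * f y" using Mg0 t by (intro mult_left_mono) auto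
      then show ?thesis using Mg[OF y] Mg[OF a0] t assms by simp
    qed
  qed
qed

lemma upper_barrier:
  assumes "\<epsilon> > 0" shows "\<exists>t>0. \<forall>j. \<forall>x\<in>closure (D j). f x \<le> t \<longrightarrow> v j x \<le> g a0 + \<epsilon>"
proof -
  obtain c where c: "0 \<le> c" "\<And>y. y \<in> frontier \<Omega> \<Longrightarrow> \<bar>g y - g a0\<bar> \<le> \<epsilon> / 2 + c * f y"
    using g_barrier[of "\<epsilon> / 2"] assms by auto
  have up: "v j x \<le> g a0 + \<epsilon> / 2 + c * f x" if x: "x \<in> closure (D j)" for j x
  proof -
    have "v j x \<le> (c *\<^sub>R n) \<bullet> x + (g a0 + \<epsilon> / 2 - c * (a0 \<bullet> n))"
    proof (rule mesh_over.H_space_le_affine[OF mesh_over_\<T> v_H x])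
      fix b assume "b \<in> boundary_vertices (\<T> j)"
      then show "g b \<le> (c *\<^sub>R n) \<bullet> b + (g a0 + \<epsilon> / 2 - c * (a0 \<bullet> n))"
        using c(2)[of b] mesh_over.bv_subset[OF mesh_over_\<T>[of j]] by (fastforce simp: inner_diff_left inner_commute[of n] algebra_simps)
    qed
    then show ?thesis by (simp add: inner_diff_left inner_commute[of n] algebra_simps)
  qed
  show ?thesis
  proof (intro exI[of _ "\<epsilon> / (2 * (c + 1))"] conjI allI ballI impI)
    show "0 < \<epsilon> / (2 * (c + 1))" using c(1) assms by simp
    fix j x assume x: "x \<in> closure (D j)" and fx: "f x \<le> \<epsilon> / (2 * (c + 1))"
    have "0 \<le> f x" using height x mesh_over.closure_U_subset[OF mesh_over_\<T>] by blast
    then have "c * f x \<le> (c + 1) * f x" by (simp add: distrib_right)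
    also have "\<dots> \<le> (c + 1) * (\<epsilon> / (2 * (c + 1)))" using fx c(1) by (intro mult_left_mono) auto
    also have "\<dots> = \<epsilon> / 2" using c(1) by (simp add: field_simps)
    finally show "v j x \<le> g a0 + \<epsilon>" using up[OF x] by simp
  qed
qed

text \<open>The volume contributes \<open>T powr K0\<close>. Points of the cap reach the frontier by
  descending along \<open>-n\<close> at most \<open>T\<close>, which bounds the supremum in
  \<open>dens\<close> and contributes \<open>T powr lam\<close>.\<close>

lemma mass_cap: "\<exists>Cm>0. \<exists>T0>0. \<forall>T. 0 < T \<longrightarrow> T \<le> T0 \<longrightarrow> emeasure \<mu> {y\<in>\<Omega>. f y \<le> T} \<le> ennreal (Cm * T powr (K0 + lam))"
proof -
  obtain t where t: "t > 0" "\<And>y. y \<in> closure \<Omega> \<Longrightarrow> f y \<le> t \<Longrightarrow> norm (y - a0) < \<rho>"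
    using small_height_near[OF \<rho>] by blast
  define Cv where "Cv = unit_ball_vol DIM('a) * 5 ^ DIM('a) * C ^ (DIM('a) - 1)"
  have Cv: "Cv > 0" using C by (simp add: Cv_def)
  have main: "emeasure \<mu> {y\<in>\<Omega>. f y \<le> T} \<le> ennreal (C1 * Cv * T powr (K0 + lam))" if T: "0 < T" "T \<le> min 1 t" for T
  \<comment> \<open>The empty cap is treated apart, since \<open>Sup\<close> over an empty set of
    reals has no useful value.\<close>
  proof (cases "{y\<in>\<Omega>. f y \<le> T} = {}")
    case False
    define Q where "Q = {y\<in>\<Omega>. f y \<le> T}"
    have Qne: "Q \<noteq> {}" using False by (simp add: Q_def)
    have Qb: "Q \<in> sets borel"
    proof -
      have "closed {y. f y \<le> T}" by (intro closed_Collect_le continuous_intros)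
      then have "\<Omega> \<inter> {y. f y \<le> T} \<in> sets borel" using open_dom by auto
      moreover have "\<Omega> \<inter> {y. f y \<le> T} = Q" by (auto simp: Q_def)
      ultimately show ?thesis by simp
    qed
    have Qc: "y \<in> closure \<Omega>" if "y \<in> Q" for y using that closure_subset unfolding Q_def by blast
    have sub: "Q \<subseteq> ball a0 \<rho> \<inter> \<Omega>"
    proof
      fix y assume y: "y \<in> Q"
      then have "norm (y - a0) < \<rho>" using t(2)[OF Qc[OF y]] T by (simp add: Q_def)
      then show "y \<in> ball a0 \<rho> \<inter> \<Omega>" using y by (simp add: Q_def dist_norm norm_minus_commute)
    qed
    have id: "infdist y (frontier \<Omega>) \<le> T" if y: "y \<in> Q" for y
    proof -
      obtain s where s: "0 \<le> s" "s \<le> f y" "y - s *\<^sub>R n \<in> frontier \<Omega>"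
        using exit_point[OF bounded_dom n height Qc[OF y]] by blast
      have "infdist y (frontier \<Omega>) \<le> dist y (y - s *\<^sub>R n)" using s(3) by (rule infdist_le)
      also have "\<dots> = s" using s(1) n by (simp add: dist_norm)
      finally show ?thesis using s(2) y by (simp add: Q_def)
    qed
    have "Sup ((\<lambda>x. infdist x (frontier \<Omega>)) ` Q) \<le> T" using id Qne by (intro cSUP_least) auto
    moreover have "0 \<le> Sup ((\<lambda>x. infdist x (frontier \<Omega>)) ` Q)"
    proof -
      obtain y where y: "y \<in> Q" using Qne by blast
      have "infdist y (frontier \<Omega>) \<le> Sup ((\<lambda>x. infdist x (frontier \<Omega>)) ` Q)"
        using y id by (intro cSUP_upper) (auto intro!: bdd_aboveI2)
      then show ?thesis using infdist_nonneg[of y "frontier \<Omega>"] by linarith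
    qed
    ultimately have "(Sup ((\<lambda>x. infdist x (frontier \<Omega>)) ` Q)) powr lam \<le> T powr lam"
      using lam by (intro powr_mono2) auto
    then have 1: "C1 * (Sup ((\<lambda>x. infdist x (frontier \<Omega>)) ` Q)) powr lam \<le> C1 * T powr lam"
      using C1 by (intro mult_left_mono) auto
    have 2: "emeasure lborel Q \<le> ennreal (Cv * T powr K0)" unfolding Cv_def K0
    proof (rule cap_volume[OF n C a T(1) _ Qb])
      show "T \<le> 1" using T(2) by simp
      fix y assume y: "y \<in> Q"
      show "0 \<le> f y" "norm (y - a0) \<le> C * f y powr a" by (rule height[OF Qc[OF y]], rule geom[OF Qc[OF y]])
      show "f y \<le> T" using y by (simp add: Q_def)
    qed
    have "emeasure \<mu> (Q \<inter> \<Omega>) \<le> ennreal (C1 * (Sup ((\<lambda>x. infdist x (frontier \<Omega>)) ` Q)) powr lam) * emeasure lborel Q"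
      by (rule dens[OF Qb sub])
    also have "\<dots> \<le> ennreal (C1 * T powr lam) * ennreal (Cv * T powr K0)"
      by (rule mult_mono[OF ennreal_leI[OF 1] 2]) auto
    also have "\<dots> = ennreal (C1 * Cv * T powr (K0 + lam))"
      using C1 Cv by (simp add: ennreal_mult[symmetric] powr_add mult_ac)
    finally show ?thesis using sub by (simp add: Q_def Int_absorb2 Int_assoc[symmetric] Collect_conj_eq Int_commute)
  qed (simp only: emeasure_empty zero_le)
  show ?thesis
    by (intro exI[of _ "C1 * Cv"] exI[of _ "min 1 t"] conjI allI impI main) (use C1 Cv t in auto)
qed

text \<open>The slope \<open>-(c + s) n + q\<close> is attained in the cap of height \<open>3 * T\<close> as soon as the graph of \<open>v j\<close> has a point over
  the cap of height \<open>T\<close> lying almost as deep as possible below the affine barrier.\<close>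

lemma steep_slope_contact:
  fixes \<epsilon> c H \<kappa> M t0 T s :: real
  defines "w \<equiv> \<lambda>j y. v j y - g a0 + \<epsilon> + c * f y"
  assumes fr: "\<And>y. y \<in> frontier (D j) \<Longrightarrow> 0 \<le> w j y"
    and deep: "\<And>y. y \<in> D j \<Longrightarrow> f y \<le> t0 \<Longrightarrow> w j y \<ge> - (H + \<kappa>)"
    and M: "\<And>y. y \<in> D j \<Longrightarrow> w j y \<ge> - M"
    and x: "x \<in> D j" "f x \<le> T" "w j x < - (H - \<kappa>)"
    and H: "0 < H" "\<kappa> \<le> H / 4" and T: "0 < T"
    and s: "0 < s" "s * T \<le> H / 6" "6 * \<kappa> \<le> s * T" "4 * (M + H) \<le> s * t0 * 3"
    and q: "norm q \<le> s * T powr (1 - a) / (4 * C)"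
  shows "q - (c + s) *\<^sub>R n \<in> subdiff_set (D j) (v j) {y\<in>D j. f y \<le> 3 * T}"
proof -
  define p where "p = q - (c + s) *\<^sub>R n"
  have clD: "y \<in> closure \<Omega>" if "y \<in> closure (D j)" for y using that mesh_over.closure_U_subset[OF mesh_over_\<T>] by blast
  have xc: "x \<in> closure \<Omega>" using x(1) closure_subset clD by blast
  \<comment> \<open>A weighted geometric mean of \<open>T\<close> and \<open>z\<close> is at most
    their maximum.\<close>
  have mix: "T powr (1 - a) * z powr a \<le> T + z" if z: "0 \<le> z" for z
  proof (cases "z = 0")
    case False
    then have zp: "0 < z" using z by simp
    have "T powr (1 - a) * z powr a \<le> (max T z) powr (1 - a) * (max T z) powr a"
      using T zp a by (intro mult_mono powr_mono2) auto
    also have "\<dots> = max T z" using T by (simp add: powr_add[symmetric])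
    also have "\<dots> \<le> T + z" using T zp by simp
    finally show ?thesis .
  qed (use T in simp)
  have tilt: "norm q * norm (y - a0) \<le> s * (T + f y) / 4" if y: "y \<in> closure \<Omega>" for y
  proof -
    have "norm q * norm (y - a0) \<le> (s * T powr (1 - a) / (4 * C)) * (C * f y powr a)"
      using q geom[OF y] order_trans[OF norm_ge_zero q] by (intro mult_mono) auto
    also have "\<dots> = s * (T powr (1 - a) * f y powr a) / 4" using C by simp
    also have "\<dots> \<le> s * (T + f y) / 4" using mix[OF height[OF y]] s(1) by (intro divide_right_mono mult_left_mono) auto
    finally show ?thesis .
  qed
  have sfx: "s * f x \<le> s * T" using x(2) s(1) by (intro mult_left_mono) auto
  \<comment> \<open>Change of the plane relative to the barrier: \<open>7/4 = 1 + 1/2 + 1/4\<close>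
    collects \<open>s * f x\<close> and the tilts at \<open>x\<close> and \<open>y\<close>, and
    \<open>3/4\<close> is what the tilt at \<open>y\<close> leaves of the gain
    \<open>s * f y\<close>.\<close>
  have key: "p \<bullet> (y - x) + c * (f y - f x) \<le> s * T * (7/4) - (3/4) * (s * f y)" if y: "y \<in> closure \<Omega>" for y
  proof -
    have "p \<bullet> (y - x) + c * (f y - f x) = q \<bullet> (y - x) - s * (f y - f x)"
      by (simp add: p_def inner_diff_left inner_diff_right inner_commute[of n] algebra_simps)
    moreover have "q \<bullet> (y - x) \<le> norm q * norm (y - a0) + norm q * norm (x - a0)"
    proof -
      have "q \<bullet> (y - x) \<le> norm q * norm (y - x)" by (rule norm_cauchy_schwarz)
      also have "\<dots> \<le> norm q * (norm (y - a0) + norm (x - a0))"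
        using norm_triangle_ineq4[of "y - a0" "x - a0"] by (intro mult_left_mono) auto
      finally show ?thesis by (simp add: distrib_left)
    qed
    moreover have "norm q * norm (x - a0) \<le> s * T / 2"
      using tilt[OF xc] sfx by (simp add: distrib_left)
    moreover have "norm q * norm (y - a0) \<le> s * T / 4 + s * f y / 4"
      using tilt[OF y] by (simp add: distrib_left add_divide_distrib)
    ultimately show ?thesis using sfx unfolding right_diff_distrib[of s "f y" "f x"] by linarith
  qed
  have "\<exists>y\<in>D j. p \<in> subdiff (D j) (v j) y \<and> v j y \<le> v j x + p \<bullet> (y - x)"
  proof (rule touching_slope[OF x(1)])
    fix y assume y: "y \<in> frontier (D j)"
    then have yc: "y \<in> closure \<Omega>" using clD unfolding frontier_def by blast
    have "0 \<le> s * f y" using s height[OF yc] by simp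
    \<comment> \<open>\<open>7/4\<close> times \<open>H / 6\<close> is below \<open>H / 3\<close>,
      while the depth at \<open>x\<close> exceeds \<open>H - \<kappa> \<ge> 3 * H / 4\<close>: the
      plane stays below the boundary values.\<close>
    then have "p \<bullet> (y - x) + c * (f y - f x) \<le> H / 3" using key[OF yc] s(2) H(1) by linarith
    then show "v j x + p \<bullet> (y - x) < v j y"
      using fr[OF y] x(3) H unfolding w_def by (simp add: right_diff_distrib)
  qed
  then obtain y where y: "y \<in> D j" "p \<in> subdiff (D j) (v j) y" "v j y \<le> v j x + p \<bullet> (y - x)" by blast
  have yc: "y \<in> closure \<Omega>" using y(1) closure_subset clD by blast
  have wy: "w j y \<le> w j x + (s * T * (7/4) - (3/4) * (s * f y))"
    using y(3) key[OF yc] unfolding w_def by (simp add: right_diff_distrib)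
  \<comment> \<open>Beyond height \<open>t0\<close> only the crude bound \<open>M\<close> is
    available, but there the term \<open>(3/4) * (s * f y)\<close> alone exceeds
    \<open>M + H\<close>.\<close>
  have fy0: "f y \<le> t0"
  proof (rule ccontr)
    assume "\<not> f y \<le> t0"
    then have "s * t0 < s * f y" using s(1) by simp
    then show False using wy M[OF y(1)] x(3) H s(2,4) by simp
  qed
  \<comment> \<open>Here the near-minimality of \<open>H\<close> enters: the depth at
    \<open>y\<close> exceeds that at \<open>x\<close> by less than
    \<open>2 * \<kappa> \<le> s * T / 3\<close>, and \<open>(4/3) * (1/3 + 7/4) = 25/9\<close> is
    below 3.\<close>
  have "(3/4) * (s * f y) \<le> 2 * \<kappa> + s * T * (7/4)" using wy deep[OF y(1) fy0] x(3) by linarith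
  then have "s * f y \<le> 3 * (s * T)" using s(3) mult_pos_pos[OF s(1) T] by linarith
  then have "s * f y \<le> s * (3 * T)" by (simp only: mult.left_commute)
  then have "f y \<le> 3 * T" using s(1) by simp
  then show ?thesis using y unfolding subdiff_set_def p_def by blast
qed

lemma shells_beat_mass:
  assumes "A > 0" "B \<ge> 0"
  obtains J T2 where "J = 1 \<or> real DIM('a) \<le> 2 * k" "T2 > 0" "\<And>T. 0 < T \<Longrightarrow> T \<le> T2 \<Longrightarrow> B * T powr (K0 + lam) < real J * A * T powr (2 * k - K0)"
proof -
  \<comment> \<open>Difference of the two powers of \<open>T\<close>. If it vanishes, the size of
    \<open>T\<close> has no influence and the number of shells must beat the constants.\<close>
  define e where "e = 2 * K0 + lam - 2 * k"
  have red: "B * T powr (K0 + lam) < real J * A * T powr (2 * k - K0)" if "0 < T" "B * T powr e < real J * A" for T J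
  proof -
    have "B * T powr (K0 + lam) = (B * T powr e) * T powr (2 * k - K0)"
    proof -
      have "e + (2 * k - K0) = K0 + lam" by (simp add: e_def)
      then show ?thesis by (simp only: mult.assoc powr_add[symmetric])
    qed
    also have "\<dots> < (real J * A) * T powr (2 * k - K0)" using that by (intro mult_strict_right_mono) auto
    finally show ?thesis by simp
  qed
  show ?thesis using expo
  proof
    assume "2 * k < 2 * K0 + lam"
    then have e: "e > 0" by (simp add: e_def)
    show ?thesis
    proof (rule that[of 1 "(A / (2 * (B + 1))) powr (1 / e)"])
      show "(A / (2 * (B + 1))) powr (1 / e) > 0" using assms by simp
      fix T :: real assume T: "0 < T" "T \<le> (A / (2 * (B + 1))) powr (1 / e)"
      have "T powr e \<le> ((A / (2 * (B + 1))) powr (1 / e)) powr e" using T e by (intro powr_mono2) auto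
      also have "\<dots> = A / (2 * (B + 1))" using e assms by (simp add: powr_powr)
      finally have "B * T powr e \<le> B * (A / (2 * (B + 1)))" using assms by (intro mult_left_mono) auto
      also have "\<dots> < A" using assms by (simp add: field_simps add_nonneg_pos)
      finally show "B * T powr (K0 + lam) < real 1 * A * T powr (2 * k - K0)" using T by (intro red) auto
    qed simp
  next
    assume as: "2 * k = 2 * K0 + lam \<and> real DIM('a) \<le> 2 * k"
    then have e: "e = 0" by (simp add: e_def)
    obtain J :: nat where J: "B < real J * A" using reals_Archimedean3[OF assms(1)] by blast
    show ?thesis by (rule that[of J 1]) (use as e J red in auto)
  qed
qed

text \<open>The order of choices matters: the constants of both mass estimates, hence the number
  \<open>J\<close> of shells and \<open>\<kappa>\<close>, depend on \<open>H\<close> only; the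
  height \<open>t0\<close> comes afterwards, from \<open>good (H + \<kappa>)\<close>, and
  \<open>T\<close> is adapted to it last.\<close>

lemma lower_barrier_step:
  fixes \<epsilon> c H :: real
  defines "w \<equiv> \<lambda>j y. v j y - g a0 + \<epsilon> + c * f y"
  defines "good \<equiv> \<lambda>h. \<exists>t>0. \<forall>\<^sub>F j in sequentially. \<forall>y\<in>D j. f y \<le> t \<longrightarrow> w j y \<ge> - h"
  assumes c: "0 \<le> c" and fr: "\<And>j y. y \<in> frontier (D j) \<Longrightarrow> 0 \<le> w j y"
    and M: "\<And>j y. y \<in> D j \<Longrightarrow> w j y \<ge> - M" and H: "0 < H" shows "\<exists>\<kappa>>0. good (H + \<kappa>) \<longrightarrow> good (H - \<kappa>)"
proof -
  define \<omega> where "\<omega> = H / 6"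
  have \<omega>: "\<omega> > 0" using H by (simp add: \<omega>_def)
  define c1 where "c1 = C * C0 * 3 powr (- 2 * k) * unit_ball_vol DIM('a) / (8 * C) ^ DIM('a)"
  have c1: "c1 > 0" using C C0 by (simp add: c1_def)
  obtain Cm T0 where Cm: "Cm > 0" "T0 > 0" "\<And>T. 0 < T \<Longrightarrow> T \<le> T0 \<Longrightarrow> emeasure \<mu> {y\<in>\<Omega>. f y \<le> T} \<le> ennreal (Cm * T powr (K0 + lam))"
    using mass_cap by blast
  have A: "c1 * \<omega> powr (real DIM('a) - 2 * k) > 0" using c1 \<omega> by simp
  have B: "Cm * 4 powr (K0 + lam) \<ge> 0" using Cm by simp
  obtain J T2 where J: "J = 1 \<or> real DIM('a) \<le> 2 * k" and T2: "T2 > 0"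
    and beat: "\<And>T. 0 < T \<Longrightarrow> T \<le> T2 \<Longrightarrow> Cm * 4 powr (K0 + lam) * T powr (K0 + lam) < real J * (c1 * \<omega> powr (real DIM('a) - 2 * k)) * T powr (2 * k - K0)"
    using shells_beat_mass[OF A B] by metis
  define E where "E = \<omega> / 2 ^ J"
  have E: "E > 0" using \<omega> by (simp add: E_def)
  \<comment> \<open>All slopes in use satisfy \<open>s * T \<ge> E\<close>, so \<open>E / 6\<close>
    secures \<open>6 * \<kappa> \<le> s * T\<close>.\<close>
  define \<kappa> where "\<kappa> = min (H / 4) (E / 6)"
  have \<kappa>: "\<kappa> > 0" "\<kappa> \<le> H / 4" "6 * \<kappa> \<le> E" using H E by (auto simp: \<kappa>_def)
  have "good (H - \<kappa>)" if gd: "good (H + \<kappa>)"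
  proof -
    obtain t0 where t0: "t0 > 0" "\<forall>\<^sub>F j in sequentially. \<forall>y\<in>D j. f y \<le> t0 \<longrightarrow> w j y \<ge> - (H + \<kappa>)"
      using gd unfolding good_def by blast
    \<comment> \<open>The later entries secure, in this order: the comparison of masses, the mass
      bound on a cap of height \<open>4 * T\<close> (the cap of height \<open>3 * T\<close> widened
      by the mesh size), steepness beyond \<open>c\<close> and \<open>r0\<close>, and contact below
      height \<open>t0\<close>.\<close>
    define S where "S = {1, T2, T0 / 4, E / (\<bar>c\<bar> + 1), E / (\<bar>r0\<bar> + 1), E * t0 / (4 * (\<bar>M\<bar> + H))}"
    define T where "T = Min S"
    have pos: "0 < \<bar>z\<bar> + H" "0 < \<bar>z\<bar> + 1" for z :: real using H by linarith+
    have fS: "finite S" "S \<noteq> {}" by (simp_all add: S_def)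
    have "\<forall>z\<in>S. 0 < z" using T2 Cm(2) E t0(1) pos by (simp add: S_def del: distrib_left_numeral)
    then have T0: "0 < T" unfolding T_def using fS by simp
    have TS: "T \<le> z" if "z \<in> S" for z unfolding T_def using fS(1) that by (rule Min_le)
    have T: "0 < T" "T \<le> 1" "T \<le> T2" "T \<le> T0 / 4" "T \<le> E / (\<bar>c\<bar> + 1)" "T \<le> E / (\<bar>r0\<bar> + 1)" "T \<le> E * t0 / (4 * (\<bar>M\<bar> + H))"
      by (rule T0) (rule TS, simp add: S_def)+
    have ET: "\<omega> / T / 2 ^ J = E / T" by (simp add: E_def)
    have big: "z \<le> E / T" if "T \<le> E / (\<bar>z\<bar> + 1)" for z
    proof -
      have "z * T \<le> (\<bar>z\<bar> + 1) * T" using T(1) by (intro mult_right_mono) auto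
      also have "\<dots> \<le> E" using that pos(2)[of z] by (simp add: pos_le_divide_eq mult.commute)
      finally show ?thesis using T(1) by (simp add: pos_le_divide_eq)
    qed
    have big1: "c \<le> \<omega> / T / 2 ^ J" "r0 \<le> \<omega> / T / 2 ^ J" using big T(5,6) unfolding ET by auto
    obtain P where P: "P \<in> sets lebesgue"
      "\<And>p. p \<in> P \<Longrightarrow> \<exists>s q. p = q - (c + s) *\<^sub>R n \<and> norm q \<le> s * T powr (1 - a) / (4 * C) \<and> \<omega> / T / 2 ^ J \<le> s \<and> s \<le> \<omega> / T"
      "ennreal (real J * c1 * \<omega> powr (real DIM('a) - 2 * k) * T powr (2 * k - K0)) \<le> R_measure R P"
      using steep_slopes_mass[OF R_meas n C a T(1,2) k C0 growth \<omega> c J big1] unfolding c1_def K0 by metis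
    have "\<forall>\<^sub>F j in sequentially. \<forall>y\<in>D j. f y \<le> T \<longrightarrow> w j y \<ge> - (H - \<kappa>)" using t0(2) hs_small[OF T(1)]
    proof eventually_elim
      case (elim j)
      show ?case
      proof (intro ballI impI, rule ccontr)
        fix x assume x: "x \<in> D j" "f x \<le> T" "\<not> - (H - \<kappa>) \<le> w j x"
        have "P \<subseteq> subdiff_set (D j) (v j) {y\<in>D j. f y \<le> 3 * T}"
        proof
          fix p assume "p \<in> P"
          then obtain s q where sq: "p = q - (c + s) *\<^sub>R n" "norm q \<le> s * T powr (1 - a) / (4 * C)" "E / T \<le> s" "s \<le> \<omega> / T"
            using P(2) unfolding ET by blast
          have sT: "E \<le> s * T" "s * T \<le> H / 6" using sq(3,4) T(1) by (auto simp: field_simps \<omega>_def)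
          have s0: "0 < s" using sq(3) divide_pos_pos[OF E T(1)] by linarith
          have \<kappa>T: "6 * \<kappa> \<le> s * T" using \<kappa>(3) sT(1) by linarith
          have MH: "0 < \<bar>M\<bar> + H" using H by simp
          have "T * (4 * (\<bar>M\<bar> + H)) \<le> E * t0" using T(7) MH by (simp add: pos_le_divide_eq)
          also have "\<dots> \<le> (s * T) * t0" using sT t0(1) by (intro mult_right_mono) auto
          finally have "T * (4 * (\<bar>M\<bar> + H)) \<le> T * (s * t0)" by (simp add: mult_ac)
          then have "4 * (\<bar>M\<bar> + H) \<le> s * t0" using T(1) by simp
          moreover have "s * t0 \<le> s * t0 * 3" using s0 t0(1) by simp
          moreover have "4 * (M + H) \<le> 4 * (\<bar>M\<bar> + H)" by simp
          ultimately have st0: "4 * (M + H) \<le> s * t0 * 3" by (meson order_trans)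
          show "p \<in> subdiff_set (D j) (v j) {y\<in>D j. f y \<le> 3 * T}" unfolding sq(1)
          proof (rule steep_slope_contact[where H=H and \<kappa>=\<kappa> and M=M and ?t0.0=t0 and x=x and \<epsilon>=\<epsilon>])
            show "0 \<le> v j y - g a0 + \<epsilon> + c * f y" if "y \<in> frontier (D j)" for y
              using fr[OF that] by (simp add: w_def)
            show "- (H + \<kappa>) \<le> v j y - g a0 + \<epsilon> + c * f y" if "y \<in> D j" "f y \<le> t0" for y
              using elim(1) that by (simp add: w_def)
            show "- M \<le> v j y - g a0 + \<epsilon> + c * f y" if "y \<in> D j" for y using M[OF that] by (simp add: w_def)
            show "v j x - g a0 + \<epsilon> + c * f x < - (H - \<kappa>)" using x(3) by (simp add: w_def)
          qed (fact x(1) x(2) H \<kappa>(2) T(1) s0 sT(2) \<kappa>T st0 sq(2))+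
        qed
        then have "R_measure R P \<le> emeasure \<mu> {y\<in>\<Omega>. f y \<le> 4 * T}"
        proof (rule R_measure_le_cover)
          have "closed {y. f y \<le> 4 * T}" by (intro closed_Collect_le continuous_intros)
          then have "\<Omega> \<inter> {y. f y \<le> 4 * T} \<in> sets borel" using open_dom by auto
          from in_sets_mu[OF this] show "{y\<in>\<Omega>. f y \<le> 4 * T} \<in> sets \<mu>"
            by (simp only: Collect_conj_eq Collect_mem_eq Int_lower1)
          fix z y assume zy: "z \<in> D j" "y \<in> {y\<in>D j. f y \<le> 3 * T}" "dist z y \<le> hs j"
          have "f z - f y = (z - y) \<bullet> n" by (simp add: inner_diff_left)
          also have "\<dots> \<le> dist z y" using norm_cauchy_schwarz[of "z - y" n] n by (simp add: dist_norm)
          finally show "z \<in> {y\<in>\<Omega>. f y \<le> 4 * T}" using zy elim(2) mesh_over.U_subset[OF mesh_over_\<T>[of j]] by auto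
        qed auto
        also have "\<dots> \<le> ennreal (Cm * (4 * T) powr (K0 + lam))" using T by (intro Cm(3)) auto
        finally have "ennreal (real J * c1 * \<omega> powr (real DIM('a) - 2 * k) * T powr (2 * k - K0)) \<le> ennreal (Cm * (4 * T) powr (K0 + lam))"
          using P(3) by (rule order_trans[rotated])
        then have "real J * c1 * \<omega> powr (real DIM('a) - 2 * k) * T powr (2 * k - K0) \<le> Cm * (4 * T) powr (K0 + lam)"
          using Cm(1) by (subst (asm) ennreal_le_iff) auto
        also have "(4 * T) powr (K0 + lam) = 4 powr (K0 + lam) * T powr (K0 + lam)" by (rule powr_mult)
        finally show False using beat[OF T(1,3)] by (simp add: mult_ac)
      qed
    qed
    then show ?thesis unfolding good_def using T(1) by blast
  qed
  then show ?thesis using \<kappa>(1) by blast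
qed

text \<open>\<open>good h\<close> says that eventually the depth below the barrier near
  \<open>a0\<close> is at most \<open>h\<close>. The improvement \<open>\<kappa>\<close> of a step
  depends on \<open>H\<close> in an uncontrolled way, hence the infimum of the good depths in place
  of an iteration.\<close>

lemma lower_barrier:
  assumes "\<epsilon> > 0" shows "\<exists>t>0. \<forall>\<^sub>F j in sequentially. \<forall>x\<in>D j. f x \<le> t \<longrightarrow> v j x \<ge> g a0 - \<epsilon>"
proof -
  obtain c where c: "0 \<le> c" "\<And>y. y \<in> frontier \<Omega> \<Longrightarrow> \<bar>g y - g a0\<bar> \<le> \<epsilon> / 3 + c * f y"
    using g_barrier[of "\<epsilon> / 3"] assms by auto
  obtain Mg where Mg: "\<And>y. y \<in> frontier \<Omega> \<Longrightarrow> \<bar>g y\<bar> \<le> Mg" using g_bounded by blast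
  obtain M where M: "\<And>j x. x \<in> closure (D j) \<Longrightarrow> \<bar>v j x\<bar> \<le> M" using uniform_bound[OF Mg] by blast
  define w where "w = (\<lambda>j y. v j y - g a0 + \<epsilon> / 3 + c * f y)"
  define good where "good = (\<lambda>h. \<exists>t>0. \<forall>\<^sub>F j in sequentially. \<forall>y\<in>D j. f y \<le> t \<longrightarrow> w j y \<ge> - h)"
  have fD: "0 \<le> f y" if "y \<in> D j" for y j using height that mesh_over.U_subset[OF mesh_over_\<T>] closure_subset by blast
  have fr: "0 \<le> w j y" if y: "y \<in> frontier (D j)" for j y
  proof -
    have "(- c *\<^sub>R n) \<bullet> y + (g a0 - \<epsilon> / 3 + c * (a0 \<bullet> n)) \<le> v j y"
    proof (rule mesh_over.H_space_ge_affine_frontier[OF mesh_over_\<T> v_H y])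
      fix b assume "b \<in> boundary_vertices (\<T> j)"
      then show "(- c *\<^sub>R n) \<bullet> b + (g a0 - \<epsilon> / 3 + c * (a0 \<bullet> n)) \<le> g b"
        using c(2)[of b] mesh_over.bv_subset[OF mesh_over_\<T>[of j]] by (fastforce simp: inner_diff_left inner_commute[of n] algebra_simps)
    qed
    then show ?thesis by (simp add: w_def inner_diff_left inner_commute[of n] algebra_simps)
  qed
  have wM: "- (M + \<bar>g a0\<bar>) \<le> w j y" if y: "y \<in> D j" for j y
  proof -
    have "\<bar>v j y\<bar> \<le> M" using M y closure_subset by blast
    moreover have "0 \<le> c * f y" using c(1) fD[OF y] by simp
    ultimately show ?thesis using assms unfolding w_def by linarith
  qed
  have step: "\<exists>\<kappa>>0. good (H + \<kappa>) \<longrightarrow> good (H - \<kappa>)" if "H > 0" for H unfolding good_def w_def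
    by (rule lower_barrier_step[OF c(1) fr[unfolded w_def] wM[unfolded w_def] that])
  have mono: "good h'" if h: "good h" "h \<le> h'" for h h'
  proof -
    obtain t where t: "t > 0" "\<forall>\<^sub>F j in sequentially. \<forall>y\<in>D j. f y \<le> t \<longrightarrow> w j y \<ge> - h" using h(1) unfolding good_def by blast
    from t(2) have "\<forall>\<^sub>F j in sequentially. \<forall>y\<in>D j. f y \<le> t \<longrightarrow> w j y \<ge> - h'"
      by eventually_elim (use h(2) in force)
    then show ?thesis unfolding good_def using t(1) by blast
  qed
  define G where "G = {h. 0 \<le> h \<and> good h}"
  have "good (\<bar>M\<bar> + \<bar>g a0\<bar>)" unfolding good_def using wM by (intro exI[of _ 1]) (fastforce intro!: always_eventually)
  then have Gne: "G \<noteq> {}" unfolding G_def by (auto intro!: exI[of _ "\<bar>M\<bar> + \<bar>g a0\<bar>"])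
  have Gb: "bdd_below G" unfolding G_def by (auto intro!: bdd_belowI[of _ 0])
  have I0: "0 \<le> Inf G" using Gne by (intro cInf_greatest) (auto simp: G_def)
  have "Inf G = 0"
  proof (rule ccontr)
    assume "Inf G \<noteq> 0"
    then have ip: "Inf G > 0" using I0 by simp
    then obtain \<kappa> where \<kappa>: "\<kappa> > 0" "good (Inf G + \<kappa>) \<longrightarrow> good (Inf G - \<kappa>)" using step by blast
    have "\<exists>h\<in>G. h < Inf G + \<kappa>" using cInf_lessD[OF Gne, of "Inf G + \<kappa>"] \<kappa>(1) by auto
    then have "good (Inf G + \<kappa>)" using mono unfolding G_def by fastforce
    then have "good (Inf G - \<kappa>)" using \<kappa>(2) by blast
    then have "good (max 0 (Inf G - \<kappa>))" by (rule mono) simp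
    then have "max 0 (Inf G - \<kappa>) \<in> G" unfolding G_def by simp
    then have "Inf G \<le> max 0 (Inf G - \<kappa>)" using Gb by (rule cInf_lower)
    then show False using ip \<kappa>(1) by simp
  qed
  then have "\<exists>h\<in>G. h < \<epsilon> / 3" using cInf_lessD[OF Gne, of "\<epsilon> / 3"] assms by auto
  then have "good (\<epsilon> / 3)" using mono unfolding G_def by fastforce
  then obtain t where t: "t > 0" "\<forall>\<^sub>F j in sequentially. \<forall>y\<in>D j. f y \<le> t \<longrightarrow> w j y \<ge> - (\<epsilon> / 3)"
    unfolding good_def by blast
  \<comment> \<open>Three thirds of \<open>\<epsilon>\<close>: the constant of the barrier, the
    remaining depth, and \<open>c * f x\<close>; the summand 1 covers \<open>c = 0\<close>.\<close>
  define t' where "t' = min t (\<epsilon> / (3 * (c + 1)))"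
  have t': "t' > 0" using t assms c(1) by (simp add: t'_def)
  from t(2) have "\<forall>\<^sub>F j in sequentially. \<forall>x\<in>D j. f x \<le> t' \<longrightarrow> v j x \<ge> g a0 - \<epsilon>"
  proof eventually_elim
    case (elim j)
    show ?case
    proof (intro ballI impI)
      fix x assume x: "x \<in> D j" "f x \<le> t'"
      have "c * f x \<le> (c + 1) * f x" using fD[OF x(1)] by (simp add: distrib_right)
      also have "\<dots> \<le> (c + 1) * (\<epsilon> / (3 * (c + 1)))" using x(2) c(1) by (intro mult_left_mono) (auto simp: t'_def)
      also have "\<dots> = \<epsilon> / 3" using c(1) by (simp add: field_simps)
      finally have "c * f x \<le> \<epsilon> / 3" .
      moreover have "w j x \<ge> - (\<epsilon> / 3)" using elim x by (auto simp: t'_def)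
      ultimately show "g a0 - \<epsilon> \<le> v j x" by (simp add: w_def)
    qed
  qed
  then show ?thesis using t' by blast
qed

end

section \<open>Uniqueness\<close>

text \<open>Separate the strict epigraph from the point of the graph over \<open>x\<close>. A
  vertical hyperplane is impossible because \<open>x\<close> is interior, so the normal can be
  scaled to give a slope.\<close>

lemma subdiff_nonempty:
  fixes \<Omega> :: "'a::euclidean_space set"
  assumes \<Omega>: "open \<Omega>" and v: "convex_on \<Omega> v" and x: "x \<in> \<Omega>" shows "subdiff \<Omega> v x \<noteq> {}"
proof -
  define S where "S = {(y, t). y \<in> \<Omega> \<and> v y < t}"
  have cv: "convex S" unfolding convex_alt
  proof (intro ballI allI impI)
    fix p q :: "'a \<times> real" and s :: real
    assume "p \<in> S" "q \<in> S" and s: "0 \<le> s \<and> s \<le> 1"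
    then obtain y t y' t' where pq: "p = (y, t)" "q = (y', t')" "y \<in> \<Omega>" "y' \<in> \<Omega>" "v y < t" "v y' < t'" unfolding S_def by auto
    have 1: "(1 - s) *\<^sub>R y + s *\<^sub>R y' \<in> \<Omega>"
      using convexD_alt[OF convex_on_imp_convex[OF v] pq(3,4)] s by simp
    have "v ((1 - s) *\<^sub>R y + s *\<^sub>R y') \<le> (1 - s) * v y + s * v y'"
      using convex_onD[OF v, of s y y'] pq s by simp
    also have "\<dots> < (1 - s) * t + s * t'"
    proof (cases "s = 0")
      case False
      have "(1 - s) * v y \<le> (1 - s) * t" using pq s by (intro mult_left_mono) auto
      moreover have "s * v y' < s * t'" using pq s False by simp
      ultimately show ?thesis by linarith
    qed (use pq in simp)
    finally show "(1 - s) *\<^sub>R p + s *\<^sub>R q \<in> S" using 1 pq by (simp add: S_def)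
  qed
  have ne: "S \<noteq> {}" using x unfolding S_def by (auto intro!: exI[of _ x] gt_ex)
  have "S \<inter> {(x, v x)} = {}" unfolding S_def by auto
  then obtain c b where cb: "c \<noteq> 0" "\<forall>z\<in>S. c \<bullet> z \<le> b" "\<forall>z\<in>{(x, v x)}. b \<le> c \<bullet> z"
    using separating_hyperplane_sets[OF cv, of "{(x, v x)}"] ne by auto
  obtain p s where ps: "c = (p, s)" by (cases c)
  have sep: "p \<bullet> y + s * t \<le> p \<bullet> x + s * v x" if "y \<in> \<Omega>" "v y < t" for y t
    using cb(2,3) that by (force simp: ps S_def inner_prod_def)
  have "s \<le> 0"
  proof (rule ccontr)
    assume "\<not> s \<le> 0"
    then have "s * v x < s * (v x + 1)" by simp
    then show False using sep[OF x, of "v x + 1"] by simp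
  qed
  moreover have "s \<noteq> 0"
  proof
    assume s0: "s = 0"
    then have p0: "p \<noteq> 0" using cb(1) ps by (auto simp: zero_prod_def)
    obtain e where e: "e > 0" "cball x e \<subseteq> \<Omega>" using x \<Omega> open_contains_cball by blast
    define y where "y = x + (e / norm p) *\<^sub>R p"
    have "y \<in> \<Omega>" using e p0 by (intro subsetD[OF e(2)]) (auto simp: y_def dist_norm)
    then have "p \<bullet> y \<le> p \<bullet> x" using sep[of y "v y + 1"] s0 by simp
    moreover have "p \<bullet> y = p \<bullet> x + e * norm p"
      using p0 by (simp add: y_def inner_add_right power2_norm_eq_inner[symmetric] power2_eq_square)
    moreover have "e * norm p > 0" using e p0 by simp
    ultimately show False by simp
  qed
  ultimately have s: "s < 0" by simp
  define q where "q = (1 / (- s)) *\<^sub>R p"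
  have "q \<in> subdiff \<Omega> v x" unfolding subdiff_def
  proof (intro CollectI ballI)
    fix y assume y: "y \<in> \<Omega>"
    have "v x + q \<bullet> (y - x) \<le> t" if t: "v y < t" for t
    proof -
      have "p \<bullet> (y - x) \<le> (- s) * (t - v x)" using sep[OF y t] by (simp add: inner_diff_right algebra_simps)
      then have "(1 / (- s)) * (p \<bullet> (y - x)) \<le> (1 / (- s)) * ((- s) * (t - v x))" using s by (intro mult_left_mono) auto
      then show ?thesis using s by (simp add: q_def)
    qed
    then show "v x + q \<bullet> (y - x) \<le> v y" by (rule dense_ge)
  qed
  then show ?thesis by blast
qed

section \<open>Legendre transforms over a compact set\<close>

context
  fixes C :: "'a::euclidean_space set" and u :: "'a \<Rightarrow> real"
  assumes C: "compact C" "C \<noteq> {}" and u: "continuous_on C u"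
begin

lemma legendre_attained: "\<exists>x\<in>C. legendre C u p = p \<bullet> x - u x \<and> (\<forall>y\<in>C. p \<bullet> y - u y \<le> p \<bullet> x - u x)"
proof -
  have "continuous_on C (\<lambda>y. p \<bullet> y - u y)" using u by (intro continuous_intros)
  then obtain x where x: "x \<in> C" "\<forall>y\<in>C. p \<bullet> y - u y \<le> p \<bullet> x - u x"
    using continuous_attains_sup[OF C] by blast
  have "legendre C u p = p \<bullet> x - u x" unfolding legendre_def using x by (intro cSup_eq_maximum) auto
  then show ?thesis using x by blast
qed

lemma legendre_ge: "y \<in> C \<Longrightarrow> p \<bullet> y - u y \<le> legendre C u p" using legendre_attained[of p] by auto

lemma continuous_legendre_compact: "continuous_on UNIV (legendre C u)"
  using legendre_attained by (intro continuous_legendre C compact_imp_bounded) (fastforce intro: bdd_aboveI2)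

end

text \<open>From \<open>a\<close> to \<open>b\<close>, each transform grows by at least
  \<open>x \<bullet> (b - a)\<close> and at most \<open>y \<bullet> (b - a)\<close>. Since the
  contact points are common, both increments lie in the same interval.\<close>

lemma common_contact_monotone:
  fixes a b :: "'a::euclidean_space"
  assumes "x \<in> C" "legendre C u a = a \<bullet> x - u x" "legendre C v a = a \<bullet> x - v x"
    and "y \<in> C" "legendre C u b = b \<bullet> y - u y" "legendre C v b = b \<bullet> y - v y"
    and "compact C" "continuous_on C u" "continuous_on C v"
  shows "\<bar>(legendre C u b - legendre C v b) - (legendre C u a - legendre C v a)\<bar> \<le> (y - x) \<bullet> (b - a)"
proof -
  have ne: "C \<noteq> {}" using assms by auto
  show ?thesis
    using legendre_ge[OF assms(7) ne assms(8), of x b] legendre_ge[OF assms(7) ne assms(8), of y a]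
      legendre_ge[OF assms(7) ne assms(9), of x b] legendre_ge[OF assms(7) ne assms(9), of y a] assms(1-6)
    by (simp add: abs_le_iff inner_diff_left inner_diff_right inner_commute)
qed

text \<open>If \<open>v > u\<close> somewhere, the slopes \<open>p\<close> with \<open>legendre u p > legendre v p\<close> form an open set \<open>G\<close> on which, since
  \<open>u\<close> and \<open>v\<close> have the same mass, both functions share a contact point. Hence \<open>legendre u - legendre v\<close> is locally constant
  on \<open>G\<close>, which forces \<open>G = UNIV\<close> and a total mass equal to that of \<open>R\<close>.\<close>

lemma gen_solution_le:
  fixes \<Omega> :: "'a::euclidean_space set"
  assumes \<Omega>: "open \<Omega>" "bounded \<Omega>" and R: "R \<in> borel_measurable lebesgue" "\<forall>p. R p > 0"
    and mass: "emeasure \<mu> \<Omega> < R_measure R UNIV" and mu: "sets \<mu> = sets (restrict_space borel \<Omega>)"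
    and u: "gen_solution \<Omega> R \<mu> g u" and v: "gen_solution \<Omega> R \<mu> g v" and x: "x \<in> closure \<Omega>"
  shows "v x \<le> u x"
proof (rule ccontr)
  assume contra: "\<not> v x \<le> u x"
  define C where "C = closure \<Omega>"
  have C: "compact C" "C \<noteq> {}" using \<Omega>(2) x by (auto simp: C_def)
  have uc: "continuous_on C u" and vc: "continuous_on C v"
    using u v by (auto simp: gen_solution_def C_def)
  have bd: "u y = v y" if "y \<in> C" "y \<notin> \<Omega>" for y
  proof -
    have "y \<in> frontier \<Omega>" using that \<Omega>(1) by (simp add: C_def frontier_def interior_open)
    then show ?thesis using u v by (simp add: gen_solution_def)
  qed
  have sub: "\<Omega> \<subseteq> C" unfolding C_def by (rule closure_subset)
  have uo: "continuous_on \<Omega> u" "continuous_on \<Omega> v" using uc vc sub continuous_on_subset by blast+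
  note Lu = legendre_ge[OF C uc] legendre_attained[OF C uc]
  note Lv = legendre_ge[OF C vc] legendre_attained[OF C vc]
  have contact_le: "w y - p \<bullet> y \<le> w z - p \<bullet> z" if w: "continuous_on C w" "p \<in> subdiff \<Omega> w y" "z \<in> C" for w p y z
  proof -
    have "w y + p \<bullet> (z - y) - w z \<le> 0"
    proof (rule continuous_le_on_closure[where f="\<lambda>z. w y + p \<bullet> (z - y) - w z" and S=\<Omega>])
      show "continuous_on (closure \<Omega>) (\<lambda>z. w y + p \<bullet> (z - y) - w z)"
        using w(1) unfolding C_def by (intro continuous_intros)
    qed (use w in \<open>auto simp: C_def subdiff_def\<close>)
    then show ?thesis by (simp add: inner_diff_right)
  qed
  have contact_eq: "legendre C w p = p \<bullet> y - w y" if "continuous_on C w" "p \<in> subdiff \<Omega> w y" "y \<in> \<Omega>" for w p y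
  proof -
    have "y \<in> C" using that sub by blast
    then show ?thesis
      using contact_le[OF that(1,2)] unfolding legendre_def by (intro cSup_eq_maximum) (force)+
  qed
  have subdiffI: "p \<in> subdiff \<Omega> w y" if "legendre C w p = p \<bullet> y - w y" "continuous_on C w" for w p y
    using legendre_ge[OF C that(2), of _ p] sub unfolding subdiff_def that(1)
    by (fastforce simp: inner_diff_right)
  define E where "E c = {y\<in>\<Omega>. u y + c < v y}" for c
  have Eo: "open (E c)" for c
  proof -
    have "continuous_on \<Omega> (\<lambda>y. v y - u y)" using uo by (intro continuous_intros)
    then have "open (\<Omega> \<inter> (\<lambda>y. v y - u y) -` {c<..})" using \<Omega>(1) continuous_on_open_vimage[OF \<Omega>(1)] by (metis Int_commute open_greaterThan)
    moreover have "\<Omega> \<inter> (\<lambda>y. v y - u y) -` {c<..} = E c" by (auto simp: E_def)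
    ultimately show ?thesis by simp
  qed
  have E\<Omega>: "E c \<subseteq> \<Omega>" for c by (auto simp: E_def)
  \<comment> \<open>The minimiser \<open>z\<close> of \<open>u\<close> minus the linear function is
    no better than \<open>y\<close> for \<open>v\<close>, so the gap between \<open>v\<close> and
    \<open>u\<close> is at least as large at \<open>z\<close> as at \<open>y\<close>. As
    \<open>c\<close> is nonnegative, \<open>z\<close> is not on the boundary, where the gap
    vanishes.\<close>
  have Esub: "subdiff_set \<Omega> v (E c) \<subseteq> subdiff_set \<Omega> u (E c)" if c: "0 \<le> c" for c
  proof
    fix p assume "p \<in> subdiff_set \<Omega> v (E c)"
    then obtain y where y: "y \<in> E c" "p \<in> subdiff \<Omega> v y" unfolding subdiff_set_def by blast
    obtain z where z: "z \<in> C" "legendre C u p = p \<bullet> z - u z" using Lu(2) by blast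
    have yC: "y \<in> C" using y E\<Omega> sub by blast
    have "u z - p \<bullet> z \<le> u y - p \<bullet> y" using Lu(1)[OF yC, of p] z(2) by simp
    then have uz: "u z + c < v z" using contact_le[OF vc y(2) z(1)] y(1) by (simp add: E_def)
    then have "z \<in> \<Omega>" using bd[OF z(1)] c by auto
    then have "z \<in> E c" using uz by (simp add: E_def)
    then show "p \<in> subdiff_set \<Omega> u (E c)" using subdiffI[OF z(2) uc] unfolding subdiff_set_def by blast
  qed
  have Eneg: "negligible (subdiff_set \<Omega> u (E c) - subdiff_set \<Omega> v (E c))" if c: "0 \<le> c" for c
  proof -
    have m: "subdiff_set \<Omega> u (E c) \<in> sets lebesgue" "subdiff_set \<Omega> v (E c) \<in> sets lebesgue"
      using subdiff_set_open_lebesgue[OF uo(1) Eo E\<Omega>] subdiff_set_open_lebesgue[OF uo(2) Eo E\<Omega>] by auto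
    have Eb: "E c \<in> sets borel" using Eo by (rule borel_open)
    have eq: "R_measure R (subdiff_set \<Omega> u (E c)) = emeasure \<mu> (E c)" "R_measure R (subdiff_set \<Omega> v (E c)) = emeasure \<mu> (E c)"
      using u v Eb E\<Omega>[of c] unfolding gen_solution_def by auto
    have "space \<mu> = \<Omega>" using sets_eq_imp_space_eq[OF mu] by (simp add: space_restrict_space)
    then have "emeasure \<mu> (E c) < R_measure R UNIV" using emeasure_space[of \<mu> "E c"] mass by simp
    then have fin: "emeasure \<mu> (E c) \<noteq> \<infinity>" by auto
    have "R_measure R (subdiff_set \<Omega> u (E c) - subdiff_set \<Omega> v (E c)) = 0"
      using R_measure_Diff[OF R(1) m Esub[OF c]] eq fin by (simp add: less_top)
    then show ?thesis using negligible_of_R_measure_zero[OF R sets.Diff[OF m]] by blast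
  qed
  \<comment> \<open>Rational levels keep the union countable, and they are dense enough to separate
    \<open>Df p\<close> from \<open>v z - u z\<close> in \<open>cc1\<close>.\<close>
  define Nl where "Nl = (\<Union>c\<in>{c\<in>\<rat>. 0 < c}. subdiff_set \<Omega> u (E c) - subdiff_set \<Omega> v (E c))"
  have Nl: "negligible Nl" unfolding Nl_def using Eneg
    by (intro negligible_countable_Union countable_image countable_subset[OF _ countable_rat]) auto
  define Df where "Df p = legendre C u p - legendre C v p" for p
  have Dc: "continuous_on UNIV Df"
    unfolding Df_def using continuous_legendre_compact[OF C uc] continuous_legendre_compact[OF C vc] by (intro continuous_intros)
  define G where "G = {p. 0 < Df p}"
  have Go: "open G" unfolding G_def using Dc by (intro open_Collect_less) auto
  define cc where "cc p z \<longleftrightarrow> z \<in> C \<and> legendre C u p = p \<bullet> z - u z \<and> legendre C v p = p \<bullet> z - v z" for p z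
  have G\<Omega>: "p \<in> subdiff_set \<Omega> u \<Omega>" if p: "p \<in> G" for p
  proof -
    obtain z where z: "z \<in> C" "legendre C u p = p \<bullet> z - u z" using Lu(2) by blast
    have "u z < v z" using p z Lv(1)[OF z(1), of p] by (simp add: G_def Df_def)
    then have "z \<in> \<Omega>" using bd[OF z(1)] by auto
    then show ?thesis using subdiffI[OF z(2) uc] unfolding subdiff_set_def by blast
  qed
  have cc1: "\<exists>z. cc p z" if p: "p \<in> G" "p \<notin> Nl" for p
  proof -
    obtain z where z: "z \<in> C" "legendre C u p = p \<bullet> z - u z" using Lu(2) by blast
    have "u z < v z" using p(1) z Lv(1)[OF z(1), of p] by (simp add: G_def Df_def)
    then have z\<Omega>: "z \<in> \<Omega>" using bd[OF z(1)] by auto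
    have pz: "p \<in> subdiff \<Omega> u z" by (rule subdiffI[OF z(2) uc])
    have "Df p \<ge> v z - u z"
    proof (rule ccontr)
      assume "\<not> v z - u z \<le> Df p"
      then have "max 0 (Df p) < v z - u z" using \<open>u z < v z\<close> by simp
      then obtain c where c: "c \<in> \<rat>" "max 0 (Df p) < c" "c < v z - u z" using Rats_dense_in_real by blast
      have "z \<in> E c" using z\<Omega> c by (simp add: E_def)
      then have "p \<in> subdiff_set \<Omega> u (E c)" using pz unfolding subdiff_set_def by blast
      then have "p \<in> subdiff_set \<Omega> v (E c)" using p(2) c unfolding Nl_def by auto
      then obtain y where y: "y \<in> E c" "p \<in> subdiff \<Omega> v y" unfolding subdiff_set_def by blast
      have "legendre C v p = p \<bullet> y - v y" using y E\<Omega> by (intro contact_eq[OF vc]) auto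
      moreover have "y \<in> C" using y E\<Omega> sub by blast
      ultimately have "Df p > c" using Lu(1)[of y p] y(1) by (simp add: Df_def E_def)
      then show False using c by simp
    qed
    then have "legendre C v p = p \<bullet> z - v z" using Lv(1)[OF z(1), of p] z(2) by (simp add: Df_def)
    then show ?thesis using z unfolding cc_def by blast
  qed
  have cc2: "\<exists>z. cc p z" if p: "p \<in> G" for p
  proof -
    \<comment> \<open>A null set contains no nonempty open set, so each slope in \<open>G\<close> is
      a limit of slopes outside \<open>Nl\<close>; by compactness and continuity of both transforms
      their common contact points accumulate at one for \<open>p\<close>.\<close>
    have "\<exists>q. q \<in> G \<and> q \<notin> Nl \<and> dist q p < 1 / Suc n" for n :: nat
    proof (rule ccontr)
      assume "\<not> (\<exists>q. q \<in> G \<and> q \<notin> Nl \<and> dist q p < 1 / Suc n)"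
      then have "G \<inter> ball p (1 / Suc n) \<subseteq> Nl" by (auto simp: dist_commute)
      then have "negligible (G \<inter> ball p (1 / Suc n))" using Nl negligible_subset by blast
      moreover have "open (G \<inter> ball p (1 / Suc n))" using Go by auto
      moreover have "p \<in> G \<inter> ball p (1 / Suc n)" using p by simp
      ultimately show False using open_not_negligible by blast
    qed
    then obtain q where q: "\<And>n. q n \<in> G" "\<And>n. q n \<notin> Nl" "\<And>n. dist (q n) p < 1 / Suc n" by metis
    have ql: "q \<longlonglongrightarrow> p"
    proof (rule metric_tendsto_imp_tendsto[where f="\<lambda>n. 1 / real (Suc n)" and a=0])
      show "(\<lambda>n. 1 / real (Suc n)) \<longlonglongrightarrow> 0" using LIMSEQ_inverse_real_of_nat by (simp add: inverse_eq_divide)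
      show "\<forall>\<^sub>F n in sequentially. dist (q n) p \<le> dist (1 / real (Suc n)) 0" using q(3) by (auto simp: less_imp_le)
    qed
    have "\<forall>n. \<exists>z. cc (q n) z" using cc1 q by blast
    then obtain z where z: "\<And>n. cc (q n) (z n)" by metis
    have "\<And>n. z n \<in> C" using z by (simp add: cc_def)
    then obtain y r where y: "y \<in> C" "strict_mono r" "(z \<circ> r) \<longlonglongrightarrow> y" using C(1) unfolding compact_def by metis
    have qr: "(q \<circ> r) \<longlonglongrightarrow> p" using LIMSEQ_subseq_LIMSEQ[OF ql y(2)] .
    have lim: "legendre C w p = p \<bullet> y - w y" if w: "continuous_on C w" and e: "\<And>n. legendre C w (q n) = q n \<bullet> z n - w (z n)" for w
    proof (rule LIMSEQ_unique)
      show "(\<lambda>n. legendre C w ((q \<circ> r) n)) \<longlonglongrightarrow> legendre C w p"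
        using continuous_on_tendsto_compose[OF continuous_legendre_compact[OF C w] qr] by auto
      have "(\<lambda>n. w ((z \<circ> r) n)) \<longlonglongrightarrow> w y"
        using continuous_on_tendsto_compose[OF w y(3,1)] z by (auto simp: cc_def)
      then have "(\<lambda>n. (q \<circ> r) n \<bullet> (z \<circ> r) n - w ((z \<circ> r) n)) \<longlonglongrightarrow> p \<bullet> y - w y"
        by (intro tendsto_intros qr y(3))
      then show "(\<lambda>n. legendre C w ((q \<circ> r) n)) \<longlonglongrightarrow> p \<bullet> y - w y" using e by simp
    qed
    have "cc p y" unfolding cc_def using y(1) lim[OF uc] lim[OF vc] z by (auto simp: cc_def)
    then show ?thesis by blast
  qed
  then obtain X where X: "\<And>p. p \<in> G \<Longrightarrow> cc p (X p)" by metis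
  have Dmono: "\<bar>Df b - Df a\<bar> \<le> (X b - X a) \<bullet> (b - a)" if "a \<in> G" "b \<in> G" for a b
    unfolding Df_def using X[OF that(1)] X[OF that(2)] common_contact_monotone[of "X a" C u a v "X b" b] C uc vc
    by (simp add: cc_def)
  \<comment> \<open>Cutting the segment into \<open>N\<close> equal pieces turns the right-hand
    sides of \<open>Dmono\<close> into a telescoping sum with factor \<open>1 / N\<close>, so
    \<open>X\<close> enters only through its end values and \<open>N\<close> can grow.\<close>
  have Dconst: "Df q = Df p" if seg: "closed_segment p q \<subseteq> G" for p q
  proof -
    define P where "P N i = p + (real i / real N) *\<^sub>R (q - p)" for N i :: nat
    have PG: "P N i \<in> G" if "i \<le> N" "N > 0" for N i
    proof -
      have "P N i \<in> closed_segment p q"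
        unfolding closed_segment_def P_def using that by (auto intro!: exI[of _ "real i / real N"] simp: algebra_simps)
      then show ?thesis using seg by blast
    qed
    have bnd: "\<bar>Df q - Df p\<bar> * real N \<le> (X q - X p) \<bullet> (q - p)" if N: "N > 0" for N :: nat
    proof -
      have P0: "P N 0 = p" "P N N = q" using N by (simp_all add: P_def)
      have step: "\<bar>Df (P N (Suc i)) - Df (P N i)\<bar> \<le> (X (P N (Suc i)) - X (P N i)) \<bullet> ((1 / real N) *\<^sub>R (q - p))" if i: "i < N" for i
      proof -
        have "P N (Suc i) - P N i = (1 / real N) *\<^sub>R (q - p)"
          by (simp add: P_def scaleR_diff_left[symmetric] diff_divide_distrib[symmetric])
        then show ?thesis using Dmono[OF PG PG, of i N "Suc i" N] i N by simp
      qed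
      have "Df q - Df p = (\<Sum>i<N. Df (P N (Suc i)) - Df (P N i))"
        using P0 sum_lessThan_telescope[of "\<lambda>i. Df (P N i)" N] by simp
      also have "\<bar>\<dots>\<bar> \<le> (\<Sum>i<N. \<bar>Df (P N (Suc i)) - Df (P N i)\<bar>)" by (rule sum_abs)
      also have "\<dots> \<le> (\<Sum>i<N. (X (P N (Suc i)) - X (P N i)) \<bullet> ((1 / real N) *\<^sub>R (q - p)))"
        using step by (intro sum_mono) auto
      also have "\<dots> = (\<Sum>i<N. X (P N (Suc i)) - X (P N i)) \<bullet> ((1 / real N) *\<^sub>R (q - p))"
        by (simp only: inner_sum_left)
      also have "(\<Sum>i<N. X (P N (Suc i)) - X (P N i)) = X q - X p"
        using P0 sum_lessThan_telescope[of "\<lambda>i. X (P N i)" N] by simp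
      finally have "\<bar>Df q - Df p\<bar> \<le> ((X q - X p) \<bullet> (q - p)) / real N"
        unfolding inner_scaleR_right by simp
      then show ?thesis using N by (simp add: pos_le_divide_eq)
    qed
    have "\<bar>Df q - Df p\<bar> \<le> 0"
    proof (rule ccontr)
      assume "\<not> \<bar>Df q - Df p\<bar> \<le> 0"
      then have pos: "0 < \<bar>Df q - Df p\<bar>" by simp
      obtain N :: nat where N: "max 0 ((X q - X p) \<bullet> (q - p)) < real N * \<bar>Df q - Df p\<bar>"
        using reals_Archimedean3[OF pos] by blast
      then have "N > 0" by (cases "N = 0") auto
      from bnd[OF this] show False using N by (simp add: mult.commute)
    qed
    then show ?thesis by simp
  qed
  \<comment> \<open>Where \<open>v - u\<close> is largest it is positive, so the point is interior
    and \<open>v\<close> has a subgradient there; at this slope \<open>Df\<close> is at least the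
    maximum.\<close>
  have "\<exists>p0. p0 \<in> G"
  proof -
    obtain z where z: "z \<in> C" "\<forall>y\<in>C. v y - u y \<le> v z - u z"
      using continuous_attains_sup[OF C, of "\<lambda>y. v y - u y"] uc vc continuous_on_diff by blast
    have pos: "0 < v z - u z" using z(2) x contra by (fastforce simp: C_def)
    then have z\<Omega>: "z \<in> \<Omega>" using bd[OF z(1)] by auto
    have "convex_on \<Omega> v" using v by (simp add: gen_solution_def)
    then obtain p where p: "p \<in> subdiff \<Omega> v z" using subdiff_nonempty[OF \<Omega>(1) _ z\<Omega>] by blast
    have "Df p \<ge> v z - u z" using contact_eq[OF vc p z\<Omega>] Lu(1)[OF z(1), of p] by (simp add: Df_def)
    then show ?thesis using pos unfolding G_def by (intro exI[of _ p]) simp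
  qed
  then obtain p0 where p0: "p0 \<in> G" by blast
  \<comment> \<open>A level set of \<open>Df\<close> at a positive value: closed by continuity,
    inside \<open>G\<close>, and open since \<open>Df\<close> is constant on balls in
    \<open>G\<close>; hence it is the whole space.\<close>
  define W where "W = {p. Df p = Df p0}"
  have "W \<subseteq> G" using p0 by (auto simp: W_def G_def)
  have "closed W" unfolding W_def using Dc by (intro closed_Collect_eq) auto
  moreover have "open W" unfolding open_contains_ball
  proof
    fix p assume p: "p \<in> W"
    then obtain e where e: "e > 0" "ball p e \<subseteq> G" using \<open>W \<subseteq> G\<close> Go open_contains_ball by blast
    have "ball p e \<subseteq> W"
    proof
      fix q assume "q \<in> ball p e"
      then have "closed_segment p q \<subseteq> ball p e" using e(1) by (intro closed_segment_subset) auto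
      then have "Df q = Df p" using e(2) by (intro Dconst) auto
      then show "q \<in> W" using p by (simp add: W_def)
    qed
    then show "\<exists>e>0. ball p e \<subseteq> W" using e(1) by blast
  qed
  moreover have "p0 \<in> W" by (simp add: W_def)
  ultimately have "W = UNIV" using clopen by blast
  then have "UNIV \<subseteq> subdiff_set \<Omega> u \<Omega>" using G\<Omega> \<open>W \<subseteq> G\<close> by blast
  then have "R_measure R UNIV \<le> R_measure R (subdiff_set \<Omega> u \<Omega>)" by (rule R_measure_mono)
  also have "\<dots> = emeasure \<mu> \<Omega>" using u \<Omega>(1) by (auto simp: gen_solution_def)
  finally show False using mass by simp
qed

section \<open>Compactness and convergence\<close>

context fe_sequence
begin

text \<open>Convexity provides subgradients at both points, each bounded by
  \<open>2 * M / r\<close>; each of them bounds the difference from one side.\<close>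

lemma v_lipschitz:
  assumes r: "0 < r" "cball x r \<subseteq> D j" "cball y r \<subseteq> D j" and M: "\<And>z. z \<in> closure (D j) \<Longrightarrow> \<bar>v j z\<bar> \<le> M"
  shows "\<bar>v j x - v j y\<bar> \<le> (2 * M / r) * dist x y"
proof -
  have one: "v j y - v j x \<le> (2 * M / r) * dist x y" if "cball y r \<subseteq> D j" "x \<in> D j" for x y
  proof -
    have y: "y \<in> D j" using that r(1) by auto
    obtain p where p: "p \<in> subdiff (D j) (v j) y"
      using subdiff_nonempty[OF mesh_over.open_U[OF mesh_over_\<T>] v_convex y] by blast
    have np: "norm p \<le> 2 * M / r"
      using that(1) M closure_subset by (intro norm_subdiff_le[OF p r(1) that(1)]) blast
    have "v j x \<ge> v j y + p \<bullet> (x - y)" using p that(2) by (auto simp: subdiff_def)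
    moreover have "- (p \<bullet> (x - y)) \<le> norm p * norm (x - y)"
      using Cauchy_Schwarz_ineq2[of p "x - y"] by linarith
    moreover have "norm p * norm (x - y) \<le> (2 * M / r) * norm (x - y)" using np by (intro mult_right_mono) auto
    ultimately show ?thesis by (simp add: dist_norm)
  qed
  have xy: "x \<in> D j" "y \<in> D j" using r by auto
  show ?thesis
    using one[OF r(3) xy(1)] one[OF r(2) xy(2), unfolded dist_commute[of y x]] by (intro abs_leI) simp_all
qed

text \<open>Interior Lipschitz bounds upgrade convergence on a countable dense set to locally uniform convergence.\<close>

lemma convergent_subsequence:
  assumes M: "\<And>j x. x \<in> closure (D j) \<Longrightarrow> \<bar>v j x\<bar> \<le> M"
  obtains s u where "strict_mono s" "\<And>K. compact K \<Longrightarrow> K \<subseteq> \<Omega> \<Longrightarrow> uniform_limit K (\<lambda>j. v (s j)) u sequentially"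
proof -
  obtain S where S: "countable S" "S \<subseteq> \<Omega>" "\<Omega> \<subseteq> closure S" using separable[of \<Omega>] by blast
  \<comment> \<open>The mesh domain of an early index may miss \<open>x\<close>. The value 0 there
    gives functions bounded by \<open>M\<close> for every index, which agree with \<open>v j\<close>
    at a given point of \<Omega> for all late \<open>j\<close>.\<close>
  define w where "w j x = (if x \<in> closure (D j) then v j x else 0)" for j x
  have M0: "0 \<le> M"
  proof -
    obtain x where "x \<in> D 0" using mesh_over.U_nonempty[OF mesh_over_\<T>] by blast
    then show ?thesis using M[of x 0] closure_subset abs_ge_zero order_trans by blast
  qed
  have "norm (w n x) \<le> M" for n x using M M0 by (simp add: w_def)
  then obtain s where s: "strict_mono s" "\<And>x. x \<in> S \<Longrightarrow> \<exists>l. (\<lambda>n. w (s n) x) \<longlonglongrightarrow> l"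
    using function_convergent_subsequence[OF S(1), of w M] by metis
  have ev: "\<forall>\<^sub>F j in sequentially. K \<subseteq> D (s j)" if "compact K" "K \<subseteq> \<Omega>" for K
    using eventually_subseq[OF s(1) exhaust[OF that]] .
  have conv: "Cauchy (\<lambda>n. v (s n) x)" if x: "x \<in> S" for x
  proof -
    obtain l where l: "(\<lambda>n. w (s n) x) \<longlonglongrightarrow> l" using s(2)[OF x] by blast
    have "\<forall>\<^sub>F n in sequentially. {x} \<subseteq> D (s n)" using x S(2) by (intro ev) auto
    then have "\<forall>\<^sub>F n in sequentially. w (s n) x = v (s n) x"
      by eventually_elim (use closure_subset in \<open>auto simp: w_def\<close>)
    then have "(\<lambda>n. v (s n) x) \<longlonglongrightarrow> l" using l by (rule Lim_transform_eventually[rotated])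
    then show ?thesis by (rule LIMSEQ_imp_Cauchy)
  qed
  define u where "u x = lim (\<lambda>n. v (s n) x)" for x
  show ?thesis
  proof (rule that[OF s(1), of u])
    fix K assume K: "compact K" "K \<subseteq> \<Omega>"
    obtain r where r: "r > 0" "nbhd K r \<subseteq> \<Omega>" using compact_nbhd_exhausts[OF K(1) open_dom K(2)] by blast
    define r' where "r' = r / 2"
    have r': "r' > 0" "r' + r' = r" using r by (auto simp: r'_def)
    have evN: "\<forall>\<^sub>F j in sequentially. nbhd K r \<subseteq> D (s j)" using ev[OF compact_nbhd[OF K(1)] r(2)] .
    define L where "L = 2 * M / r'"
    have L0: "0 \<le> L" using M0 r' by (simp add: L_def)
    have lip: "\<bar>v j x - v j y\<bar> \<le> L * dist x y" if "nbhd K r \<subseteq> D j" "x \<in> nbhd K r'" "y \<in> nbhd K r'" for j x y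
      unfolding L_def using nbhd_dist[OF that(2), of _ r', unfolded r'(2)] nbhd_dist[OF that(3), of _ r', unfolded r'(2)] that(1)
      by (intro v_lipschitz r'(1) M) auto
    have "uniformly_Cauchy_on K (\<lambda>j. v (s j))"
    proof (rule uniformly_Cauchy_onI)
      fix e :: real assume e: "e > 0"
      define d where "d = min r' (e / (3 * (L + 1)))"
      have d: "0 < d" "d \<le> r'" using e r' L0 by (auto simp: d_def)
      have Ld: "L * d < e / 3"
      proof -
        have "L * d \<le> L * (e / (3 * (L + 1)))" using L0 by (intro mult_left_mono) (auto simp: d_def)
        also have "\<dots> < e / 3" using L0 e by (simp add: field_simps)
        finally show ?thesis .
      qed
      have "K \<subseteq> (\<Union>y\<in>S. ball y d)"
      proof
        fix x assume "x \<in> K"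
        then have "x \<in> closure S" using K(2) S(3) by blast
        then obtain y where "y \<in> S" "dist y x < d" using d(1) unfolding closure_approachable by blast
        then show "x \<in> (\<Union>y\<in>S. ball y d)" by auto
      qed
      then obtain F where F: "F \<subseteq> S" "finite F" "K \<subseteq> (\<Union>y\<in>F. ball y d)"
        using compactE_image[OF K(1), of S "\<lambda>y. ball y d"] by auto
      have "\<exists>N. \<forall>m\<ge>N. \<forall>n\<ge>N. dist (v (s m) y) (v (s n) y) < e / 3" if "y \<in> F" for y
        using conv[of y] F(1) that e unfolding Cauchy_def by (meson divide_pos_pos subsetD zero_less_numeral)
      then obtain N where N: "\<And>y m n. y \<in> F \<Longrightarrow> m \<ge> N y \<Longrightarrow> n \<ge> N y \<Longrightarrow> dist (v (s m) y) (v (s n) y) < e / 3"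
        by metis
      obtain N0 where N0: "\<And>j. j \<ge> N0 \<Longrightarrow> nbhd K r \<subseteq> D (s j)" using evN unfolding eventually_sequentially by blast
      define N1 where "N1 = N0 + (\<Sum>y\<in>F. N y)"
      have N1: "N0 \<le> N1" "N y \<le> N1" if "y \<in> F" for y
        using member_le_sum[OF that, of N] F(2) by (auto simp: N1_def)
      show "\<exists>Na. \<forall>x\<in>K. \<forall>m\<ge>Na. \<forall>n\<ge>Na. dist (v (s m) x) (v (s n) x) < e"
      proof (intro exI[of _ N1] ballI allI impI)
        fix x m n assume x: "x \<in> K" and mn: "m \<ge> N1" "n \<ge> N1"
        obtain y where y: "y \<in> F" "dist y x < d" using F(3) x by auto
        have xN: "x \<in> nbhd K r'" using x r' subset_nbhd[of r' K] by auto
        have yN: "y \<in> nbhd K r'" using x y d(2) unfolding nbhd_def by (auto simp: dist_commute intro!: bexI[of _ x])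
        have l: "\<bar>v (s i) x - v (s i) y\<bar> < e / 3" if "i \<ge> N1" for i
        proof -
          have "\<bar>v (s i) x - v (s i) y\<bar> \<le> L * dist x y" using N0[of i] N1(1)[OF y(1)] that xN yN by (intro lip) auto
          also have "\<dots> \<le> L * d" using y(2) L0 by (intro mult_left_mono) (auto simp: dist_commute)
          finally show ?thesis using Ld by simp
        qed
        have "dist (v (s m) y) (v (s n) y) < e / 3" using N[OF y(1)] N1(2)[OF y(1)] mn by auto
        then show "dist (v (s m) x) (v (s n) x) < e" using l[OF mn(1)] l[OF mn(2)] unfolding dist_real_def by linarith
      qed
    qed
    then have "uniformly_convergent_on K (\<lambda>j. v (s j))" by (rule Cauchy_uniformly_convergent)
    then show "uniform_limit K (\<lambda>j. v (s j)) u sequentially"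
      unfolding uniformly_convergent_uniform_limit_iff u_def .
  qed
qed

lemma limit_convex:
  assumes lim: "\<And>K. compact K \<Longrightarrow> K \<subseteq> \<Omega> \<Longrightarrow> uniform_limit K v u sequentially" shows "convex_on \<Omega> u"
proof -
  have pt: "(\<lambda>j. v j x) \<longlonglongrightarrow> u x" if "x \<in> \<Omega>" for x
    using tendsto_uniform_limitI[OF lim[of "{x}"], of x] that by auto
  show ?thesis unfolding convex_on_def
  proof (intro conjI ballI allI impI)
    fix x y and a b :: real assume xy: "x \<in> \<Omega>" "y \<in> \<Omega>" "0 \<le> a" "0 \<le> b" "a + b = 1"
    have z: "a *\<^sub>R x + b *\<^sub>R y \<in> \<Omega>" using convex_dom xy by (auto simp: convex_def)
    have "\<forall>\<^sub>F j in sequentially. {x, y} \<subseteq> D j" using xy by (intro exhaust) auto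
    then have "\<forall>\<^sub>F j in sequentially. v j (a *\<^sub>R x + b *\<^sub>R y) \<le> a * v j x + b * v j y"
      by eventually_elim (use v_convex xy in \<open>auto simp: convex_on_def\<close>)
    moreover have "(\<lambda>j. a * v j x + b * v j y) \<longlonglongrightarrow> a * u x + b * u y" by (intro tendsto_intros pt xy)
    ultimately show "u (a *\<^sub>R x + b *\<^sub>R y) \<le> a * u x + b * u y"
      using tendsto_le[OF sequentially_bot _ pt[OF z]] by blast
  qed (rule convex_dom)
qed

lemma subsequence:
  assumes s: "strict_mono s" shows "fe_sequence \<Omega> g R \<mu> (\<lambda>j. \<T> (s j)) (\<lambda>j. hs (s j)) (\<lambda>j. v (s j))"
proof unfold_locales
  fix K :: "'a set" assume K: "compact K" "K \<subseteq> \<Omega>"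
  show "\<forall>\<^sub>F j in sequentially. K \<subseteq> D (s j)" by (rule eventually_subseq[OF s exhaust[OF K]])
qed (use s open_dom bounded_dom convex_dom dom_nonempty R_pos R_loc mu_sets mass mesh_T fe_v
     LIMSEQ_subseq_LIMSEQ[OF hs_lim, of s] in \<open>auto simp: comp_def\<close>)

text \<open>The limit is known inside \<Omega> only, so \<open>g\<close> is glued on at the
  boundary. Convexity and mass see \<Omega> alone, and \<open>bdry\<close> survives the pointwise
  limit, which yields continuity up to the boundary.\<close>

lemma limit_gen_solution:
  assumes lim: "\<And>K. compact K \<Longrightarrow> K \<subseteq> \<Omega> \<Longrightarrow> uniform_limit K v u sequentially"
    and g: "continuous_on (frontier \<Omega>) g"
    and bdry: "\<And>a0 \<epsilon>. a0 \<in> frontier \<Omega> \<Longrightarrow> \<epsilon> > 0 \<Longrightarrow>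
      \<exists>\<delta>>0. \<forall>\<^sub>F j in sequentially. \<forall>x\<in>D j. dist x a0 < \<delta> \<longrightarrow> \<bar>v j x - g a0\<bar> \<le> \<epsilon>"
  shows "gen_solution \<Omega> R \<mu> g (\<lambda>x. if x \<in> \<Omega> then u x else g x)"
proof -
  define w where "w x = (if x \<in> \<Omega> then u x else g x)" for x
  have pt: "(\<lambda>j. v j x) \<longlonglongrightarrow> u x" if "x \<in> \<Omega>" for x
    using tendsto_uniform_limitI[OF lim[of "{x}"], of x] that by auto
  have cu: "convex_on \<Omega> u" by (rule limit_convex[OF lim])
  then have uc: "continuous_on \<Omega> u" by (rule convex_on_continuous[OF open_dom])
  have wu: "w x = u x" if "x \<in> \<Omega>" for x using that by (simp add: w_def)
  have cw: "convex_on \<Omega> w" using cu convex_dom by (auto simp: convex_on_def convex_def wu)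
  have wc: "continuous_on \<Omega> w" using uc by (simp add: wu cong: continuous_on_cong)
  have fr: "frontier \<Omega> = closure \<Omega> - \<Omega>" using open_dom by (simp add: frontier_def interior_open)
  have near: "\<exists>\<delta>>0. \<forall>x\<in>closure \<Omega>. dist x a0 < \<delta> \<longrightarrow> \<bar>w x - g a0\<bar> \<le> \<epsilon>" if a0: "a0 \<in> frontier \<Omega>" and \<epsilon>: "\<epsilon> > 0" for a0 \<epsilon>
  proof -
    obtain d where d: "d > 0" "\<forall>\<^sub>F j in sequentially. \<forall>x\<in>D j. dist x a0 < d \<longrightarrow> \<bar>v j x - g a0\<bar> \<le> \<epsilon>"
      using bdry[OF a0 \<epsilon>] by blast
    obtain d' where d': "d' > 0" "\<And>x. x \<in> frontier \<Omega> \<Longrightarrow> dist x a0 < d' \<Longrightarrow> dist (g x) (g a0) < \<epsilon>"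
      using g a0 \<epsilon> unfolding continuous_on_iff by blast
    have "\<bar>w x - g a0\<bar> \<le> \<epsilon>" if x: "x \<in> closure \<Omega>" "dist x a0 < min d d'" for x
    proof (cases "x \<in> \<Omega>")
      case True
      have "\<forall>\<^sub>F j in sequentially. {x} \<subseteq> D j" using True by (intro exhaust) auto
      with d(2) have "\<forall>\<^sub>F j in sequentially. \<bar>v j x - g a0\<bar> \<le> \<epsilon>" by eventually_elim (use x in auto)
      moreover have "(\<lambda>j. \<bar>v j x - g a0\<bar>) \<longlonglongrightarrow> \<bar>u x - g a0\<bar>" by (intro tendsto_intros pt True)
      ultimately have "\<bar>u x - g a0\<bar> \<le> \<epsilon>" using tendsto_upperbound sequentially_bot by blast
      then show ?thesis using wu[OF True] by simp
    next
      case False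
      then show ?thesis using d'(2)[of x] x fr by (auto simp: w_def dist_real_def)
    qed
    then show ?thesis using d(1) d'(1) by (intro exI[of _ "min d d'"]) auto
  qed
  have "continuous_on (closure \<Omega>) w" unfolding continuous_on_iff
  proof (intro ballI allI impI)
    fix x and e :: real assume x: "x \<in> closure \<Omega>" and e: "0 < e"
    show "\<exists>d>0. \<forall>x'\<in>closure \<Omega>. dist x' x < d \<longrightarrow> dist (w x') (w x) < e"
    proof (cases "x \<in> \<Omega>")
      case True
      then obtain d where d: "d > 0" "\<And>x'. x' \<in> \<Omega> \<Longrightarrow> dist x' x < d \<Longrightarrow> dist (w x') (w x) < e"
        using wc e unfolding continuous_on_iff by blast
      obtain d' where d': "d' > 0" "ball x d' \<subseteq> \<Omega>" using open_dom True open_contains_ball by blast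
      show ?thesis
        by (intro exI[of _ "min d d'"]) (use d d' in \<open>auto simp: dist_commute subset_iff\<close>)
    next
      case False
      then have xf: "x \<in> frontier \<Omega>" using x fr by blast
      obtain d where d: "d > 0" "\<And>x'. x' \<in> closure \<Omega> \<Longrightarrow> dist x' x < d \<Longrightarrow> \<bar>w x' - g x\<bar> \<le> e / 2"
        using near[OF xf, of "e / 2"] e by auto
      have "w x = g x" using False by (simp add: w_def)
      then show ?thesis using d e by (intro exI[of _ d]) (force simp: dist_real_def)
    qed
  qed
  moreover have "R_measure R (subdiff_set \<Omega> w e) = emeasure \<mu> e" if e: "e \<in> sets borel \<and> e \<subseteq> \<Omega>" for e
  proof -
    have "subdiff_set \<Omega> w e = subdiff_set \<Omega> u e"
      unfolding subdiff_set_def subdiff_def using e by (intro SUP_cong refl) (auto simp: subset_iff wu)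
    then show ?thesis using limit_mass_eq[OF uc lim] e by simp
  qed
  moreover have "w x = g x" if "x \<in> frontier \<Omega>" for x using that fr by (simp add: w_def)
  ultimately have "gen_solution \<Omega> R \<mu> g w" unfolding gen_solution_def using cw by blast
  then show ?thesis unfolding w_def[abs_def] .
qed

end

lemma (in fe_boundary) boundary_values:
  assumes "\<epsilon> > 0" shows "\<exists>\<delta>>0. \<forall>\<^sub>F j in sequentially. \<forall>x\<in>D j. dist x a0 < \<delta> \<longrightarrow> \<bar>v j x - g a0\<bar> \<le> \<epsilon>"
proof -
  obtain t where t: "t > 0" "\<And>j x. x \<in> closure (D j) \<Longrightarrow> f x \<le> t \<Longrightarrow> v j x \<le> g a0 + \<epsilon>"
    using upper_barrier[OF assms] by blast
  obtain t' where t': "t' > 0" "\<forall>\<^sub>F j in sequentially. \<forall>x\<in>D j. f x \<le> t' \<longrightarrow> v j x \<ge> g a0 - \<epsilon>"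
    using lower_barrier[OF assms] by blast
  have fd: "f x \<le> dist x a0" for x using norm_cauchy_schwarz[of "x - a0" n] n by (simp add: dist_norm)
  from t'(2) have "\<forall>\<^sub>F j in sequentially. \<forall>x\<in>D j. dist x a0 < min t t' \<longrightarrow> \<bar>v j x - g a0\<bar> \<le> \<epsilon>"
  proof eventually_elim
    case (elim j)
    show ?case
    proof (intro ballI impI)
      fix x assume x: "x \<in> D j" "dist x a0 < min t t'"
      have "f x \<le> t" "f x \<le> t'" using fd[of x] x(2) by auto
      moreover have "x \<in> closure (D j)" using x(1) closure_subset by blast
      ultimately have "v j x \<le> g a0 + \<epsilon>" "v j x \<ge> g a0 - \<epsilon>" using t(2) elim x(1) by auto
      then show "\<bar>v j x - g a0\<bar> \<le> \<epsilon>" by linarith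
    qed
  qed
  then show ?thesis using t(1) t'(1) by (intro exI[of _ "min t t'"]) simp
qed

section \<open>Exhaustion by inner sets and the convergence theorem\<close>

lemma inner_set_exhausts:
  fixes \<Omega> :: "'a::euclidean_space set"
  assumes \<Omega>: "open \<Omega>" "bounded \<Omega>" "\<Omega> \<noteq> {}" and K: "compact K" "K \<subseteq> \<Omega>"
  shows "\<exists>\<delta>>0. K \<subseteq> inner_set \<Omega> \<delta>"
proof -
  obtain r where r: "r > 0" "nbhd K r \<subseteq> \<Omega>" using compact_nbhd_exhausts[OF K(1) \<Omega>(1) K(2)] by blast
  have ne: "frontier \<Omega> \<noteq> {}" using \<Omega>(2,3) not_bounded_UNIV frontier_eq_empty by metis
  have "r \<le> infdist x (frontier \<Omega>)" if x: "x \<in> K" for x unfolding infdist_notempty[OF ne]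
  proof (rule cINF_greatest[OF ne])
    fix y assume "y \<in> frontier \<Omega>"
    then have "y \<notin> \<Omega>" using \<Omega>(1) by (simp add: frontier_def interior_open)
    then have "y \<notin> cball x r" using r(2) x unfolding nbhd_def by blast
    then show "r \<le> dist x y" by simp
  qed
  then have "K \<subseteq> inner_set \<Omega> (r / 2)" using K(2) r(1) unfolding inner_set_def by force
  then show ?thesis using r(1) by (intro exI[of _ "r / 2"]) simp
qed

lemma closure_inner_set:
  fixes \<Omega> :: "'a::euclidean_space set"
  assumes \<Omega>: "open \<Omega>" "bounded \<Omega>" and \<delta>: "\<delta> > 0"
  shows "compact (closure (inner_set \<Omega> \<delta>))" "closure (inner_set \<Omega> \<delta>) \<subseteq> \<Omega>"
proof -
  have sub: "inner_set \<Omega> \<delta> \<subseteq> \<Omega>" by (auto simp: inner_set_def)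
  then show "compact (closure (inner_set \<Omega> \<delta>))" using \<Omega>(2) bounded_subset by auto
  show "closure (inner_set \<Omega> \<delta>) \<subseteq> \<Omega>"
  proof
    fix x assume x: "x \<in> closure (inner_set \<Omega> \<delta>)"
    have "closed {x. \<delta> \<le> infdist x (frontier \<Omega>)}" by (intro closed_Collect_le continuous_intros)
    moreover have "inner_set \<Omega> \<delta> \<subseteq> {x. \<delta> \<le> infdist x (frontier \<Omega>)}" by (auto simp: inner_set_def)
    ultimately have "\<delta> \<le> infdist x (frontier \<Omega>)" using closure_minimal x by blast
    then have "x \<notin> frontier \<Omega>" using \<delta> by auto
    moreover have "x \<in> closure \<Omega>" using x closure_mono[OF sub] by blast
    ultimately show "x \<in> \<Omega>" using \<Omega>(1) by (simp add: frontier_def interior_open)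
  qed
qed

theorem theorem6p6:
  fixes \<Omega> :: "'a::euclidean_space set"
    and g R :: "'a \<Rightarrow> real"
    and \<mu> :: "'a measure"
    and \<tau> k C0 r0 C1 lam :: real
    and I :: "real set"
    and \<T> :: "real \<Rightarrow> 'a set set"
    and uh :: "real \<Rightarrow> 'a \<Rightarrow> real"
  assumes dom: "open \<Omega>" "bounded \<Omega>" "convex \<Omega>" "\<Omega> \<noteq> {}"
    and g_cont: "continuous_on (frontier \<Omega>) g"
    and R_pos: "\<forall>p. R p > 0"
    and R_loc: "\<forall>K. compact K \<longrightarrow> R integrable_on K"
    and mu_sets: "sets \<mu> = sets (restrict_space borel \<Omega>)"
    and A: "0 \<le> \<tau>" "\<forall>a0\<in>frontier \<Omega>. local_parabolic_support \<Omega> \<tau> a0"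
    and B: "0 \<le> k" "C0 > 0" "r0 > 0" "\<forall>p. norm p \<ge> r0 \<longrightarrow> R p \<ge> C0 * norm p powr (- 2 * k)"
    and C: "emeasure \<mu> \<Omega> < (\<integral>\<^sup>+ p. ennreal (R p) \<partial>lebesgue)"
    and D: "C1 > 0" "lam \<ge> 0"
      "\<forall>x0\<in>frontier \<Omega>. \<exists>\<rho>>0. \<forall>e. e \<in> sets borel \<and> e \<subseteq> ball x0 \<rho> \<inter> \<Omega> \<longrightarrow>
          emeasure \<mu> (e \<inter> \<Omega>) \<le>
            ennreal (C1 * (Sup ((\<lambda>x. infdist x (frontier \<Omega>)) ` e)) powr lam) * emeasure lborel e"
    and k_small: "(k < 1 \<or> k \<ge> real DIM('a) / 2) \<longrightarrow>
                    k \<le> (real DIM('a) + \<tau> + 1) / (\<tau> + 2) + lam / 2"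
    and k_mid: "(1 \<le> k \<and> k < real DIM('a) / 2) \<longrightarrow>
                    k < (real DIM('a) + \<tau> + 1) / (\<tau> + 2) + lam / 2"
    and adm: "admissible_family \<Omega> I \<T>"
    and fe: "\<forall>h\<in>I. fe_solution (\<T> h) R \<mu> g (uh h)"
  shows "\<exists>u. gen_solution \<Omega> R \<mu> g u \<and>
             (\<forall>v. gen_solution \<Omega> R \<mu> g v \<longrightarrow> (\<forall>x\<in>closure \<Omega>. v x = u x)) \<and>
             (\<forall>\<delta>>0. uniform_limit (closure (inner_set \<Omega> \<delta>)) uh u (at 0 within I))"
proof -
  define a where "a = 1 / (\<tau> + 2)"
  have a: "0 < a" "a \<le> 1" using A(1) by (auto simp: a_def)
  have dim: "1 \<le> real DIM('a)" by (simp add: Suc_leI)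
  define X where "X = 1 + a * (real DIM('a) - 1)"
  have K: "(real DIM('a) + \<tau> + 1) / (\<tau> + 2) = X" using A(1) by (simp add: X_def a_def field_simps)
  have K1: "1 \<le> X" using a dim by (simp add: X_def)
  \<comment> \<open>For \<open>k < 1\<close> the inequality is strict because
    \<open>X \<ge> 1\<close>, for \<open>1 \<le> k < d / 2\<close> by hypothesis, with
    \<open>d\<close> the dimension; so equality leaves only \<open>2 * k \<ge> d\<close>.\<close>
  have expo: "2 * k < 2 * X + lam \<or>
      (2 * k = 2 * X + lam \<and> real DIM('a) \<le> 2 * k)"
  proof (cases "k < 1 \<or> k < real DIM('a) / 2")
    case True
    have "2 * k < 2 * X + lam"
    proof (cases "k < 1")
      case True
      then show ?thesis using K1 D(2) by linarith
    next
      case False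
      then have "k < X + lam / 2" using k_mid True unfolding K by simp
      then show ?thesis by linarith
    qed
    then show ?thesis ..
  next
    case False
    then have "k \<le> X + lam / 2" using k_small unfolding K by simp
    then have "2 * k \<le> 2 * X + lam" by linarith
    moreover have "real DIM('a) \<le> 2 * k" using False by linarith
    ultimately show ?thesis using order_le_less by blast
  qed
  have Rm: "R \<in> borel_measurable lebesgue" by (rule measurable_of_integrable_on_compact[OF R_pos R_loc])
  have mass: "emeasure \<mu> \<Omega> < R_measure R UNIV" using C by (simp add: R_measure_UNIV)
  have I: "\<And>h. h \<in> I \<Longrightarrow> 0 < h" "0 islimpt I" "\<And>h. h \<in> I \<Longrightarrow> is_mesh \<Omega> (\<T> h) h"
    and fam: "\<And>\<delta>. \<delta> > 0 \<Longrightarrow> \<exists>h\<delta>>0. \<forall>h\<in>I. h < h\<delta> \<longrightarrow> closure (inner_set \<Omega> \<delta>) \<subseteq> mesh_domain (\<T> h)"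
    using adm unfolding admissible_family_def by auto
  have seq: "fe_sequence \<Omega> g R \<mu> (\<lambda>j. \<T> (hs j)) hs (\<lambda>j. uh (hs j))"
    if hs: "\<And>j. hs j \<in> I" "hs \<longlonglongrightarrow> 0" for hs
  proof (unfold_locales)
    fix K assume K: "compact K" "K \<subseteq> \<Omega>"
    obtain \<delta> where \<delta>: "\<delta> > 0" "K \<subseteq> inner_set \<Omega> \<delta>" using inner_set_exhausts[OF dom(1,2,4) K] by blast
    obtain h\<delta> where h\<delta>: "h\<delta> > 0" "\<And>h. h \<in> I \<Longrightarrow> h < h\<delta> \<Longrightarrow> closure (inner_set \<Omega> \<delta>) \<subseteq> mesh_domain (\<T> h)"
      using fam[OF \<delta>(1)] by blast
    have "\<forall>\<^sub>F j in sequentially. hs j < h\<delta>" using order_tendstoD(2)[OF hs(2) h\<delta>(1)] .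
    then show "\<forall>\<^sub>F j in sequentially. K \<subseteq> mesh_domain (\<T> (hs j))"
      by eventually_elim (use h\<delta>(2) hs(1) \<delta>(2) closure_subset in blast)
  qed (use dom R_pos R_loc mu_sets mass I(3) hs fe in auto)
  have bdry: "\<exists>\<delta>>0. \<forall>\<^sub>F j in sequentially. \<forall>x\<in>mesh_domain (Tj j). dist x a0 < \<delta> \<longrightarrow> \<bar>vj j x - g a0\<bar> \<le> \<epsilon>"
    if fs: "fe_sequence \<Omega> g R \<mu> Tj hs vj" and a0: "a0 \<in> frontier \<Omega>" and \<epsilon>: "\<epsilon> > 0" for Tj hs vj a0 \<epsilon>
  proof -
    obtain n Cg where n: "norm n = 1" "1 \<le> Cg"
      "\<And>y. y \<in> closure \<Omega> \<Longrightarrow> 0 \<le> (y - a0) \<bullet> n"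
      "\<And>y. y \<in> closure \<Omega> \<Longrightarrow> norm (y - a0) \<le> Cg * ((y - a0) \<bullet> n) powr a"
      using parabolic_support_height[OF dom(2,3) a0 A(1)] A(2) a0 unfolding a_def by blast
    obtain \<rho> where \<rho>: "\<rho> > 0" and dens: "\<forall>e. e \<in> sets borel \<and> e \<subseteq> ball a0 \<rho> \<inter> \<Omega> \<longrightarrow>
          emeasure \<mu> (e \<inter> \<Omega>) \<le>
            ennreal (C1 * (Sup ((\<lambda>x. infdist x (frontier \<Omega>)) ` e)) powr lam) * emeasure lborel e"
      using bspec[OF D(3) a0] by (elim exE conjE) (rule that)
    have "fe_boundary \<Omega> g R \<mu> Tj hs vj a0 n Cg a X lam C1 \<rho> k C0 r0"
    proof (rule fe_boundary.intro[OF fs fe_boundary_axioms.intro])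
      fix e :: "'a set" assume "e \<in> sets borel" "e \<subseteq> ball a0 \<rho> \<inter> \<Omega>"
      then show "emeasure \<mu> (e \<inter> \<Omega>) \<le>
            ennreal (C1 * (Sup ((\<lambda>x. infdist x (frontier \<Omega>)) ` e)) powr lam) * emeasure lborel e"
        using dens by blast
    qed (fact g_cont a0 n a B(1,2) B(4)[rule_format] D(1,2) \<rho> X_def expo)+
    then show ?thesis by (rule fe_boundary.boundary_values[OF _ \<epsilon>])
  qed
  \<comment> \<open>Serves twice: one sequence tending to 0 gives existence, and a sequence along
    which convergence fails gives the contradiction at the end.\<close>
  have sub: "\<exists>s u. strict_mono s \<and> gen_solution \<Omega> R \<mu> g u \<and>
      (\<forall>K. compact K \<longrightarrow> K \<subseteq> \<Omega> \<longrightarrow> uniform_limit K (\<lambda>j. uh (hs (s j))) u sequentially)"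
    if hs: "\<And>j. hs j \<in> I" "hs \<longlonglongrightarrow> 0" for hs
  proof -
    note fs0 = seq[OF hs]
    have "compact (frontier \<Omega>)" using dom(2) by (simp add: compact_frontier_bounded)
    from compact_imp_bounded[OF compact_continuous_image[OF g_cont this]]
    obtain Mg where "\<And>y. y \<in> frontier \<Omega> \<Longrightarrow> \<bar>g y\<bar> \<le> Mg" unfolding bounded_iff by auto
    then obtain M where M: "\<And>j x. x \<in> closure (mesh_domain (\<T> (hs j))) \<Longrightarrow> \<bar>uh (hs j) x\<bar> \<le> M"
      using fe_sequence.uniform_bound[OF fs0] by blast
    obtain s u where s: "strict_mono s" "\<And>K. compact K \<Longrightarrow> K \<subseteq> \<Omega> \<Longrightarrow> uniform_limit K (\<lambda>j. uh (hs (s j))) u sequentially"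
      using fe_sequence.convergent_subsequence[OF fs0 M] by metis
    have fs: "fe_sequence \<Omega> g R \<mu> (\<lambda>j. \<T> (hs (s j))) (\<lambda>j. hs (s j)) (\<lambda>j. uh (hs (s j)))"
      by (rule fe_sequence.subsequence[OF fs0 s(1)])
    define w where "w x = (if x \<in> \<Omega> then u x else g x)" for x
    have "gen_solution \<Omega> R \<mu> g w"
      unfolding w_def by (rule fe_sequence.limit_gen_solution[OF fs s(2) g_cont bdry[OF fs]])
    moreover have "uniform_limit K (\<lambda>j. uh (hs (s j))) w sequentially" if "compact K" "K \<subseteq> \<Omega>" for K
      using s(2)[OF that] that(2) by (subst uniform_limit_cong'[where g="\<lambda>j. uh (hs (s j))" and i=u]) (auto simp: w_def)
    ultimately show ?thesis using s(1) by blast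
  qed
  obtain hs where hs: "\<And>j. hs j \<in> I" "hs \<longlonglongrightarrow> 0" using I(2) unfolding islimpt_sequential by auto
  obtain u where u: "gen_solution \<Omega> R \<mu> g u" using sub[OF hs] by blast
  have uniq: "w x = u x" if w: "gen_solution \<Omega> R \<mu> g w" and x: "x \<in> closure \<Omega>" for w x
    using gen_solution_le[OF dom(1,2) Rm R_pos mass mu_sets u w x]
      gen_solution_le[OF dom(1,2) Rm R_pos mass mu_sets w u x] by simp
  \<comment> \<open>Failure of convergence supplies mesh sizes below \<open>1 / Suc j\<close> with
    error at least \<open>e\<close> somewhere; a subsequence converges to a generalised solution,
    which uniqueness identifies with \<open>u\<close>.\<close>
  have "uniform_limit (closure (inner_set \<Omega> \<delta>)) uh u (at 0 within I)" if \<delta>: "\<delta> > 0" for \<delta>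
  proof (rule ccontr)
    define S where "S = closure (inner_set \<Omega> \<delta>)"
    have S: "compact S" "S \<subseteq> \<Omega>" unfolding S_def using closure_inner_set[OF dom(1,2) \<delta>] by auto
    assume "\<not> uniform_limit (closure (inner_set \<Omega> \<delta>)) uh u (at 0 within I)"
    then obtain e where e: "e > 0" "\<not> (\<forall>\<^sub>F h in at 0 within I. \<forall>x\<in>S. dist (uh h x) (u x) < e)"
      unfolding uniform_limit_iff S_def by blast
    have "\<exists>h. h \<in> I \<and> dist h 0 < 1 / Suc j \<and> \<not> (\<forall>x\<in>S. dist (uh h x) (u x) < e)" for j :: nat
    proof -
      have "0 < 1 / real (Suc j)" by simp
      then show ?thesis using e(2) unfolding eventually_at by blast
    qed
    then obtain hq where hq: "\<And>j. hq j \<in> I" "\<And>j. dist (hq j) 0 < 1 / Suc j" "\<And>j. \<not> (\<forall>x\<in>S. dist (uh (hq j) x) (u x) < e)"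
      by metis
    have "hq \<longlonglongrightarrow> 0"
    proof (rule metric_tendsto_imp_tendsto[where f="\<lambda>n. 1 / real (Suc n)" and a=0])
      show "(\<lambda>n. 1 / real (Suc n)) \<longlonglongrightarrow> 0" using LIMSEQ_inverse_real_of_nat by (simp add: inverse_eq_divide)
      show "\<forall>\<^sub>F n in sequentially. dist (hq n) 0 \<le> dist (1 / real (Suc n)) 0" using hq(2) by (auto simp: less_imp_le)
    qed
    then obtain s w where w: "gen_solution \<Omega> R \<mu> g w" "uniform_limit S (\<lambda>j. uh (hq (s j))) w sequentially"
      using sub[of hq] hq(1) S by blast
    have "\<forall>\<^sub>F j in sequentially. \<forall>x\<in>S. dist (uh (hq (s j)) x) (w x) < e" using uniform_limitD[OF w(2) e(1)] .
    then obtain j where j: "\<forall>x\<in>S. dist (uh (hq (s j)) x) (w x) < e"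
      unfolding eventually_sequentially by blast
    have "w x = u x" if "x \<in> S" for x using uniq[OF w(1)] that S(2) closure_subset by blast
    then show False using j hq(3)[of "s j"] by simp
  qed
  then show ?thesis using u uniq by blast
qed

end
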